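(* Let $\lambda\in\mathbb{R}$ be fixed. (1) Assume that $G$ is the complete graph $K_n$ on $n$ vertices. If $p\le\frac{1+\lambda n^{-1/3}}{n}$, then there exists $c=c(\lambda)>0$ (depending only on $\lambda$) such that, for $A>0$, $$\mathbf{P}\big(\exists\,\mathcal{C}\in\mathbf{CO}(G_p)\text{ with }\mathrm{diam}(\mathcal{C})>A n^{1/3}\big)\le e^{-cA^{3/2}}.$$ (2) The same inequality, with $c=c(d,\lambda)>0$ (depending only on $d$ and $\lambda$), holds if $G$ is a uniformly random $d$-regular graph on $n$ vertices, where $d\ge 3$ is fixed, and $p\le\frac{1+\lambda n^{-1/3}}{d-1}$.
   Context: For a finite graph $G$ and $p\in(0,1)$, $G_p$ is the random subgraph obtained by bond percolation: each edge of $G$ is independently retained with probability $p$ and erased with probability $1-p$. $\mathbf{CO}(G_p)$ is the collection of connected components of $G_p$, and $\mathrm{diam}(\mathcal{C})$ is the graph-distance diameter of the component $\mathcal{C}$. In part (2) the probability is over both the random choice of $G$ and the percolation.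
   Formalization: The bound is proved for all A at least some A_0>0 depending only on λ (part 1) or on d and λ (part 2), instead of for every A>0, because for A near 0 the inequality fails; in part 2 a d-regular graph on n vertices is assumed to exist. *)

theory Defs
  imports "HOL-Probability.Probability"
begin

text \<open>
  A simple graph on the vertex set \<open>V\<close> is given by its set of edges, a subset of
  \<open>all_edges V\<close>; every edge is a two-element set of vertices, so there are no loops.
\<close>

definition all_edges :: "'a set \<Rightarrow> 'a set set" where
  "all_edges V = {e. e \<subseteq> V \<and> card e = 2}"

definition vertex_degree :: "'a set set \<Rightarrow> 'a \<Rightarrow> nat" where
  "vertex_degree E v = card {e \<in> E. v \<in> e}"

definition regular_graphs :: "nat \<Rightarrow> 'a set \<Rightarrow> 'a set set set" where
  "regular_graphs d V = {E. E \<subseteq> all_edges V \<and> (\<forall>v\<in>V. vertex_degree E v = d)}"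

definition adj :: "'a set set \<Rightarrow> ('a \<times> 'a) set" where
  "adj E = {(u, v). {u, v} \<in> E}"

definition graph_components :: "'a set \<Rightarrow> 'a set set \<Rightarrow> 'a set set" where
  "graph_components V E = V // ((adj E)\<^sup>* \<inter> V \<times> V)"

text \<open>The distance is only meaningful for two vertices of the same component.\<close>

definition graph_dist :: "'a set set \<Rightarrow> 'a \<Rightarrow> 'a \<Rightarrow> nat" where
  "graph_dist E u v = (LEAST k. (u, v) \<in> adj E ^^ k)"

definition graph_diam :: "'a set set \<Rightarrow> 'a set \<Rightarrow> nat" where
  "graph_diam E C = Max {graph_dist E u v | u v. u \<in> C \<and> v \<in> C}"

text \<open>Law of the set of retained edges under bond percolation on the edge set \<open>E\<close>.\<close>

definition percolation :: "real \<Rightarrow> 'a set set \<Rightarrow> 'a set set pmf" where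
  "percolation p E =
     map_pmf (\<lambda>retained. {e \<in> E. retained e}) (Pi_pmf E False (\<lambda>_. bernoulli_pmf p))"

definition percolation_complete :: "nat \<Rightarrow> real \<Rightarrow> nat set set pmf" where
  "percolation_complete n p = percolation p (all_edges {..<n})"

text \<open>
  Annealed law: the graph is sampled first and then percolated. The uniform law
  is only meaningful if there is a \<open>d\<close>-regular graph on \<open>n\<close> vertices.
\<close>

definition percolation_random_regular :: "nat \<Rightarrow> nat \<Rightarrow> real \<Rightarrow> nat set set pmf" where
  "percolation_random_regular d n p =
     bind_pmf (pmf_of_set (regular_graphs d {..<n})) (percolation p)"

end

theory Submission
  imports Defs
begin

text \<open>
  Split according to the volume of a component, at the threshold \<open>A\<^sup>1\<^sup>/\<^sup>2 n\<^sup>2\<^sup>/\<^sup>3\<close>.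

  A component that is tall but has small volume \<open>V\<close> is unlikely in every graph with the given
  degrees. For the breadth-first levels \<open>Z\<^sub>k\<close> of the cluster of a vertex,
  \<open>(1 - (1 - a)^Z\<^sub>k) exp (a k / 8 - a\<^sup>2 (Z\<^sub>0 + \<dots> + Z\<^sub>k\<^sub>-\<^sub>1) / 8)\<close> is a supermartingale, and
  \<open>1 - (1 - a)^Z\<^sub>k\<close> bounds the probability of surviving the last \<open>O(1 / a)\<close> levels. With \<open>a\<close> of
  order \<open>R / V\<close> this gives the probability \<open>O(R / V) exp (- c R\<^sup>2 / V)\<close> for height \<open>R\<close>, which is
  divided by the volume and summed over dyadic volumes.

  A component of large volume is unlikely because the graph gets exhausted. The vertices are explored
  one by one; after \<open>t\<close> steps the number of active vertices has drift of order \<open>- t / n\<close>, and an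
  exponential supermartingale gives \<open>exp (- c t\<^sup>3 / n\<^sup>2)\<close>. For a random regular graph the part of
  the graph not yet explored is uniform given its degrees, and a switching argument shows that a
  newly exposed edge leads to a vertex of reduced degree with probability of order \<open>t / n\<close>, unless
  few vertices have reduced degree; but the latter would require so many edges between explored
  vertices that the exploration would have died out.
\<close>

subsection \<open>Percolation and breadth-first levels\<close>

text \<open>Passing from a single vertex to the existence of a component costs the factor n /
  volume, of order n^(1/3) / sqrt A, which no exponential in A absorbs. So each bound for a single
  vertex must carry a prefactor of the inverse order besides its exponential. This is why the
  potentials are close to 0 when few vertices are active: 1 - (1 - a)^Z is the probability that one
  of Z independent marks of rate a occurs, hence at most a Z. Its loss of order a^2 per generation
  comes from the variance of the number of children, the only force that kills a critical process.
  The volume threshold balances the two regimes: with R = A n^(1/3) and V = A^(1/2) n^(2/3), both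
  R^2 / V and V^3 / n^2 equal A^(3/2). In a regular graph the number of free edge ends at vertices
  of reduced degree is random. It is not estimated directly: a second exponential supermartingale
  combines it with the weight of the active vertices, with coefficients for which the contributions
  of edges between explored vertices cancel.\<close>

abbreviation expect :: "'a pmf \<Rightarrow> ('a \<Rightarrow> real) \<Rightarrow> real" where
  "expect \<equiv> measure_pmf.expectation"

lemma expect_mono:
  assumes "finite (set_pmf M)" "\<And>x. x \<in> set_pmf M \<Longrightarrow> f x \<le> g x"
  shows "expect M f \<le> expect M g"
  using assms by (intro integral_mono_AE integrable_measure_pmf_finite) (auto simp: AE_measure_pmf_iff)

lemma expect_cong:
  assumes "\<And>x. x \<in> set_pmf M \<Longrightarrow> f x = g x"
  shows "expect M f = expect M g"
  using assms by (intro integral_cong_AE) (auto simp: AE_measure_pmf_iff)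

lemma expect_const [simp]: "expect M (\<lambda>_. c) = c"
  by simp

lemma expect_add:
  assumes "finite (set_pmf M)"
  shows "expect M (\<lambda>x. f x + g x) = expect M f + expect M g"
  using assms by (intro Bochner_Integration.integral_add integrable_measure_pmf_finite)

lemma expect_diff:
  assumes "finite (set_pmf M)"
  shows "expect M (\<lambda>x. f x - g x) = expect M f - expect M g"
  using assms by (intro Bochner_Integration.integral_diff integrable_measure_pmf_finite)

lemma expect_sum:
  assumes "finite (set_pmf M)"
  shows "expect M (\<lambda>x. \<Sum>i\<in>I. f i x) = (\<Sum>i\<in>I. expect M (f i))"
  using assms by (intro Bochner_Integration.integral_sum integrable_measure_pmf_finite)

lemma expect_nonneg:
  assumes "\<And>x. x \<in> set_pmf M \<Longrightarrow> 0 \<le> f x"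
  shows "0 \<le> expect M f"
  using assms by (intro integral_nonneg_AE) (auto simp: AE_measure_pmf_iff)

lemma expect_bind:
  assumes "finite (set_pmf M)" "\<And>x. x \<in> set_pmf M \<Longrightarrow> finite (set_pmf (f x))"
  shows "expect (bind_pmf M f) h = expect M (\<lambda>x. expect (f x) h)"
proof -
  define A where "A = (\<Union>x\<in>set_pmf M. set_pmf (f x))"
  have A: "finite A" using assms by (auto simp: A_def)
  have "expect (bind_pmf M f) h = (\<Sum>y\<in>A. h y * pmf (bind_pmf M f) y)"
    by (rule integral_measure_pmf_real) (use A in \<open>auto simp: A_def\<close>)
  also have "\<dots> = (\<Sum>y\<in>A. h y * expect M (\<lambda>x. pmf (f x) y))"
    by (simp add: pmf_bind)
  also have "\<dots> = expect M (\<lambda>x. \<Sum>y\<in>A. h y * pmf (f x) y)"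
    by (subst expect_sum) (use assms in auto)
  also have "\<dots> = expect M (\<lambda>x. expect (f x) h)"
    by (rule expect_cong, rule integral_measure_pmf_real[symmetric])
       (use A in \<open>auto simp: A_def\<close>)
  finally show ?thesis .
qed

lemma expect_pair:
  assumes "finite (set_pmf M)" "finite (set_pmf N)"
  shows "expect (pair_pmf M N) h = expect M (\<lambda>x. expect N (\<lambda>y. h (x, y)))"
  unfolding pair_pmf_def using assms by (subst expect_bind; (subst expect_bind)?; simp)

lemma expect_indicator: "expect M (indicator A) = measure_pmf.prob M A"
  by simp

lemma expect_bernoulli:
  "expect (bernoulli_pmf p) f = p * f True + (1 - p) * f False" if "0 \<le> p" "p \<le> 1"
  using that by (simp add: integral_measure_pmf_real[where A=UNIV] UNIV_bool)

lemma prob_le_expect: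
  assumes "finite (set_pmf M)" "\<And>x. x \<in> set_pmf M \<Longrightarrow> x \<in> A \<Longrightarrow> 1 \<le> f x"
    "\<And>x. x \<in> set_pmf M \<Longrightarrow> 0 \<le> f x"
  shows "measure_pmf.prob M A \<le> expect M f"
  unfolding expect_indicator[symmetric]
  by (rule expect_mono) (use assms in \<open>auto simp: indicator_def\<close>)

section \<open>Bond percolation: independence of disjoint edge sets and generating functions\<close>

lemma set_percolation:
  assumes "finite E"
  shows "set_pmf (percolation p E) \<subseteq> Pow E" "finite (set_pmf (percolation p E))"
proof -
  show "set_pmf (percolation p E) \<subseteq> Pow E" by (auto simp: percolation_def)
  then show "finite (set_pmf (percolation p E))" using assms finite_subset by auto
qed

lemma percolation_union:
  assumes "finite E" "finite F" "E \<inter> F = {}"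
  shows "percolation p (E \<union> F) =
    map_pmf (\<lambda>(A, B). A \<union> B) (pair_pmf (percolation p E) (percolation p F))"
proof -
  have "percolation p (E \<union> F) = map_pmf (\<lambda>r. {e \<in> E \<union> F. r e})
     (map_pmf (\<lambda>(f,g) x. if x \<in> E then f x else g x)
       (pair_pmf (Pi_pmf E False (\<lambda>_. bernoulli_pmf p)) (Pi_pmf F False (\<lambda>_. bernoulli_pmf p))))"
    by (simp add: percolation_def Pi_pmf_union[OF assms])
  also have "\<dots> = map_pmf (\<lambda>(A, B). A \<union> B) (pair_pmf (percolation p E) (percolation p F))"
    unfolding percolation_def pair_map_pmf1 pair_map_pmf2 map_pmf_comp
    by (rule map_pmf_cong[OF refl]) (use assms(3) in \<open>auto split: if_splits\<close>)
  finally show ?thesis .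
qed

lemma expect_percolation_union:
  assumes "finite E" "finite F" "E \<inter> F = {}"
  shows "expect (percolation p (E \<union> F)) h =
    expect (percolation p E) (\<lambda>A. expect (percolation p F) (\<lambda>B. h (A \<union> B)))"
  using assms by (simp add: percolation_union expect_pair set_percolation)

lemma percolation_empty: "percolation p {} = return_pmf {}"
  by (simp add: percolation_def)

lemma expect_percolation_singleton:
  assumes "0 \<le> p" "p \<le> 1"
  shows "expect (percolation p {e}) h = p * h {e} + (1 - p) * h {}"
proof -
  have "percolation p {e} = map_pmf (\<lambda>b. if b then {e} else {}) (bernoulli_pmf p)"
    unfolding percolation_def Pi_pmf_singleton map_pmf_comp
    by (intro map_pmf_cong refl) (auto split: if_splits)
  then show ?thesis using expect_bernoulli[OF assms] by simp
qed

lemma expect_percolation_insert: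
  assumes "0 \<le> p" "p \<le> 1" "finite E" "e \<notin> E"
  shows "expect (percolation p (insert e E)) h =
    p * expect (percolation p E) (\<lambda>A. h (insert e A)) + (1 - p) * expect (percolation p E) h"
proof -
  have "insert e E = {e} \<union> E" by simp
  then show ?thesis
    using expect_percolation_union[of "{e}" E p h] assms
    by (simp add: expect_percolation_singleton)
qed

text \<open>Generating function of a binomial variable; the offspring estimates for the levels and
  for the number of active vertices are read off from it.\<close>

lemma expect_percolation_power_card:
  assumes "0 \<le> p" "p \<le> 1" "finite E"
  shows "expect (percolation p E) (\<lambda>A. u ^ card A) = (1 - p + p * u) ^ card E"
  using assms(3)
proof (induction E)
  case empty
  then show ?case by (simp add: percolation_empty)
next
  case (insert e E)
  have "expect (percolation p E) (\<lambda>A. u ^ card (insert e A)) =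
      expect (percolation p E) (\<lambda>A. u * u ^ card A)"
  proof (rule expect_cong)
    fix A assume "A \<in> set_pmf (percolation p E)"
    then have "A \<subseteq> E" using set_percolation[of E p] insert by auto
    then show "u ^ card (insert e A) = u * u ^ card A"
      using insert finite_subset[of A E] by (subst card_insert_disjoint) auto
  qed
  then show ?case
    using insert assms expect_percolation_insert[of p E e "\<lambda>A. u ^ card A"]
    by (simp add: algebra_simps)
qed

lemma expect_percolation_sum:
  assumes "0 \<le> p" "p \<le> 1" "finite E"
  shows "expect (percolation p E) (\<lambda>A. \<Sum>e\<in>A. c e) = p * (\<Sum>e\<in>E. c e)"
  using assms(3)
proof (induction E)
  case empty
  then show ?case by (simp add: percolation_empty)
next
  case (insert e E)
  have "expect (percolation p E) (\<lambda>A. \<Sum>e\<in>insert e A. c e) =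
      expect (percolation p E) (\<lambda>A. c e + (\<Sum>e\<in>A. c e))"
  proof (rule expect_cong)
    fix A assume "A \<in> set_pmf (percolation p E)"
    then have "A \<subseteq> E" using set_percolation[of E p] insert by auto
    then show "(\<Sum>e\<in>insert e A. c e) = c e + (\<Sum>e\<in>A. c e)"
      using insert finite_subset[of A E] by (subst sum.insert) auto
  qed
  also have "\<dots> = c e + expect (percolation p E) (\<lambda>A. \<Sum>e\<in>A. c e)"
    using insert by (subst expect_add) (auto simp: set_percolation)
  finally show ?case
    using insert assms expect_percolation_insert[of p E e "\<lambda>A. \<Sum>e\<in>A. c e"]
    by (simp add: algebra_simps)
qed

section \<open>Peeling off a level of the breadth-first search\<close>

definition strip :: "'a set set \<Rightarrow> 'a set \<Rightarrow> 'a set set" where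
  "strip H L = {e \<in> H. e \<inter> L = {}}"

definition touch :: "'a set set \<Rightarrow> 'a set \<Rightarrow> 'a set set" where
  "touch H L = {e \<in> H. e \<inter> L \<noteq> {}}"

definition nxt :: "'a set set \<Rightarrow> 'a set \<Rightarrow> 'a set" where
  "nxt H L = {w. w \<notin> L \<and> (\<exists>v\<in>L. {v, w} \<in> H)}"

definition reach :: "'a set set \<Rightarrow> 'a set \<Rightarrow> 'a set" where
  "reach H L = (adj H)\<^sup>* `` L"

lemma adj_iff [simp]: "(u, v) \<in> adj E \<longleftrightarrow> {u, v} \<in> E"
  by (simp add: adj_def)

lemma sym_adj: "sym (adj E)"
  by (auto simp: sym_def insert_commute)

lemma touch_strip: "H = touch H L \<union> strip H L" "touch H L \<inter> strip H L = {}"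
  by (auto simp: touch_def strip_def)

lemma strip_union_touch:
  assumes "H1 \<subseteq> touch E L" "H2 \<subseteq> strip E L"
  shows "strip (H1 \<union> H2) L = H2" "nxt (H1 \<union> H2) L = nxt H1 L"
  using assms by (auto simp: strip_def touch_def nxt_def)

text \<open>Markov property of the search: the next level is a function of the retained edges at
  \<open>L\<close>, which are independent of the percolation on the edges avoiding
  \<open>L\<close>.\<close>

lemma expect_percolation_split:
  assumes "finite E"
  shows "expect (percolation p E) (\<lambda>H. f (nxt H L) (strip H L)) =
    expect (percolation p (touch E L))
      (\<lambda>R. expect (percolation p (strip E L)) (\<lambda>H. f (nxt R L) H))"
proof -
  have fin: "finite (touch E L)" "finite (strip E L)"
    using assms by (auto simp: touch_def strip_def)
  have "expect (percolation p E) (\<lambda>H. f (nxt H L) (strip H L)) =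
    expect (percolation p (touch E L)) (\<lambda>R. expect (percolation p (strip E L))
      (\<lambda>H. f (nxt (R \<union> H) L) (strip (R \<union> H) L)))"
    using expect_percolation_union[OF fin touch_strip(2), of p "\<lambda>H. f (nxt H L) (strip H L)"]
    by (simp flip: touch_strip(1))
  also have "\<dots> = expect (percolation p (touch E L))
      (\<lambda>R. expect (percolation p (strip E L)) (\<lambda>H. f (nxt R L) H))"
  proof (intro expect_cong)
    fix R H assume "R \<in> set_pmf (percolation p (touch E L))" "H \<in> set_pmf (percolation p (strip E L))"
    then have "R \<subseteq> touch E L" "H \<subseteq> strip E L" using set_percolation(1) fin by blast+
    from strip_union_touch[OF this]
    show "f (nxt (R \<union> H) L) (strip (R \<union> H) L) = f (nxt R L) H" by simp
  qed
  finally show ?thesis .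
qed

lemma nxt_subset: "nxt H L \<subseteq> \<Union>H"
  by (auto simp: nxt_def)

lemma reach_superset: "L \<subseteq> reach H L"
  by (auto simp: reach_def)

lemma reach_subset_Un: "reach H L \<subseteq> L \<union> \<Union>H"
proof
  fix x assume "x \<in> reach H L"
  then obtain q where "(q, x) \<in> (adj H)\<^sup>*" "q \<in> L" by (auto simp: reach_def)
  then show "x \<in> L \<union> \<Union>H" by (induction rule: rtrancl_induct) auto
qed

lemma finite_reach:
  assumes "finite L" "finite H" "\<And>e. e \<in> H \<Longrightarrow> finite e"
  shows "finite (reach H L)"
  using reach_subset_Un assms by (metis finite_Un finite_Union finite_subset)

lemma reach_strip_disjoint: "reach (strip H L) (nxt H L) \<inter> L = {}"
  using reach_subset_Un[of "strip H L" "nxt H L"] by (auto simp: strip_def nxt_def)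

lemma reach_strip_subset: "reach (strip H L) (nxt H L) \<subseteq> reach H L"
proof -
  have "adj (strip H L) \<subseteq> adj H" by (auto simp: strip_def)
  then have "(adj (strip H L))\<^sup>* \<subseteq> (adj H)\<^sup>*" by (rule rtrancl_mono)
  moreover have "\<exists>u\<in>L. (u, v) \<in> (adj H)\<^sup>*" if "v \<in> nxt H L" for v
    using that by (auto simp: nxt_def intro!: r_into_rtrancl)
  ultimately have "x \<in> reach H L"
    if "v \<in> nxt H L" "(v, x) \<in> (adj (strip H L))\<^sup>*" for v x
    using that unfolding reach_def by (meson Image_iff rtrancl_trans subsetD)
  then show ?thesis by (auto simp: reach_def)
qed

text \<open>In terms of the distance to \<open>L\<close>: \<open>surv k\<close> says that some
  vertex is at distance exactly \<open>k\<close>, and \<open>vol j\<close> counts the vertices at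
  distance less than \<open>j\<close>.\<close>

fun surv :: "nat \<Rightarrow> 'a set set \<Rightarrow> 'a set \<Rightarrow> bool" where
  "surv 0 H L = (L \<noteq> {})"
| "surv (Suc k) H L = surv k (strip H L) (nxt H L)"

fun vol :: "nat \<Rightarrow> 'a set set \<Rightarrow> 'a set \<Rightarrow> nat" where
  "vol 0 H L = 0"
| "vol (Suc j) H L = card L + vol j (strip H L) (nxt H L)"

lemma surv_empty: "\<not> surv k H {}"
  by (induction k arbitrary: H) (auto simp: nxt_def)

lemma surv_mono: "surv k H L \<Longrightarrow> j \<le> k \<Longrightarrow> surv j H L"
proof (induction k arbitrary: j H L)
  case (Suc k)
  show ?case
  proof (cases j)
    case 0
    with Suc.prems surv_empty[of "Suc k" H] show ?thesis by auto
  qed (use Suc in auto)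
qed simp

lemma vol_le_reach:
  assumes "finite L" "finite H" "\<And>e. e \<in> H \<Longrightarrow> finite e"
  shows "vol j H L \<le> card (reach H L)"
  using assms
proof (induction j arbitrary: H L)
  case (Suc j)
  have fin: "finite (nxt H L)" "finite (strip H L)" "\<And>e. e \<in> strip H L \<Longrightarrow> finite e"
    using Suc.prems finite_subset[OF nxt_subset[of H L]] by (auto simp: strip_def)
  have "vol (Suc j) H L \<le> card L + card (reach (strip H L) (nxt H L))"
    using Suc.IH[OF fin] by simp
  also have "\<dots> = card (L \<union> reach (strip H L) (nxt H L))"
    using reach_strip_disjoint[of H L] finite_reach[OF fin] Suc.prems
    by (subst card_Un_disjoint) auto
  also have "\<dots> \<le> card (reach H L)"
    using reach_superset[of L H] reach_strip_subset[of H L]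
    by (intro card_mono finite_reach Suc.prems) auto
  finally show ?case .
qed simp

lemma strip_subset: "strip H L \<subseteq> H"
  by (auto simp: strip_def)

lemma relpow_adj_mono:
  assumes "(x, y) \<in> adj H ^^ j" "H \<subseteq> H'"
  shows "(x, y) \<in> adj H' ^^ j"
  using assms(1)
proof (induction j arbitrary: x)
  case (Suc j)
  then obtain z where "(x, z) \<in> adj H" "(z, y) \<in> adj H ^^ j" by (meson relpow_Suc_D2)
  with Suc.IH assms(2) show ?case by (intro relpow_Suc_I2[of x z]) auto
qed simp

text \<open>A walk that met \<open>L\<close> would contain a walk from \<open>L\<close> to
  \<open>w\<close> of length at most \<open>j\<close>.\<close>

lemma relpow_adj_strip:
  assumes "(x, w) \<in> adj H ^^ j" "\<And>y i. y \<in> L \<Longrightarrow> i \<le> j \<Longrightarrow> (y, w) \<notin> adj H ^^ i"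
  shows "(x, w) \<in> adj (strip H L) ^^ j"
  using assms
proof (induction j arbitrary: x)
  case (Suc j)
  then obtain z where z: "(x, z) \<in> adj H" "(z, w) \<in> adj H ^^ j" by (meson relpow_Suc_D2)
  have "x \<notin> L" using Suc.prems by blast
  moreover have "z \<notin> L" using Suc.prems(2)[of z j] z by auto
  ultimately have "(x, z) \<in> adj (strip H L)" using z by (auto simp: strip_def)
  moreover have "(z, w) \<in> adj (strip H L) ^^ j"
    by (rule Suc.IH[OF z(2)]) (use Suc.prems(2) in auto)
  ultimately show ?case by (rule relpow_Suc_I2)
qed simp

text \<open>A shortest walk from \<open>L\<close> to \<open>w\<close> leaves \<open>L\<close> with
  its first step and never returns, so its tail is a shortest walk from the next level in the
  stripped graph.\<close>

lemma surv_of_dist: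
  assumes "v \<in> L" "(v, w) \<in> adj H ^^ k" "\<And>x j. x \<in> L \<Longrightarrow> j < k \<Longrightarrow> (x, w) \<notin> adj H ^^ j"
  shows "surv k H L"
  using assms
proof (induction k arbitrary: H L v)
  case (Suc k)
  obtain y where y: "(v, y) \<in> adj H" "(y, w) \<in> adj H ^^ k"
    using Suc.prems(2) by (meson relpow_Suc_D2)
  have "y \<notin> L" using Suc.prems(3)[of y k] y by auto
  then have yn: "y \<in> nxt H L" using y Suc.prems(1) by (auto simp: nxt_def)
  have yw: "(y, w) \<in> adj (strip H L) ^^ k"
    by (rule relpow_adj_strip[OF y(2)]) (use Suc.prems(3) in auto)
  have "(x, w) \<notin> adj (strip H L) ^^ j" if x: "x \<in> nxt H L" and j: "j < k" for x j
  proof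
    assume "(x, w) \<in> adj (strip H L) ^^ j"
    then have "(x, w) \<in> adj H ^^ j" using relpow_adj_mono strip_subset by metis
    moreover obtain u where "u \<in> L" "(u, x) \<in> adj H" using x by (auto simp: nxt_def)
    ultimately have "(u, w) \<in> adj H ^^ Suc j" by (intro relpow_Suc_I2[of u x])
    with Suc.prems(3)[of u "Suc j"] \<open>u \<in> L\<close> j show False by auto
  qed
  with Suc.IH[OF yn yw] show ?case by simp
qed auto

text \<open>Choosing for each new vertex an edge that leads to it is injective, because the other
  end of that edge lies in \<open>L\<close> and the new vertex does not.\<close>

lemma nxt_card:
  assumes "finite R"
  shows "finite (nxt R L)" "card (nxt R L) \<le> card R"
proof -
  define f where "f w = (SOME e. e \<in> R \<and> (\<exists>v\<in>L. e = {v, w}))" for w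
  have f: "f w \<in> R \<and> (\<exists>v\<in>L. f w = {v, w})" if "w \<in> nxt R L" for w
    unfolding f_def by (rule someI_ex) (use that in \<open>auto simp: nxt_def\<close>)
  have inj: "inj_on f (nxt R L)"
  proof (rule inj_onI)
    fix w w' assume w: "w \<in> nxt R L" "w' \<in> nxt R L" "f w = f w'"
    obtain v v' where "v \<in> L" "v' \<in> L" "{v, w} = {v', w'}" using f[OF w(1)] f[OF w(2)] w(3) by auto
    then show "w = w'" using w by (auto simp: nxt_def doubleton_eq_iff)
  qed
  have sub: "f ` nxt R L \<subseteq> R" using f by auto
  show "finite (nxt R L)" using inj_on_finite[OF inj sub assms] .
  show "card (nxt R L) \<le> card R" using card_inj_on_le[OF inj sub assms] .
qed

section \<open>Comparison of the levels with a near-critical branching process\<close>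

lemma finite_touch_strip:
  assumes "finite E"
  shows "finite (touch E L)" "finite (strip E L)"
  using assms by (auto simp: touch_def strip_def)

lemma card_touch_le:
  assumes "finite E" "finite L" "\<And>v. v \<in> L \<Longrightarrow> vertex_degree E v \<le> D"
  shows "card (touch E L) \<le> D * card L"
proof -
  have "touch E L = (\<Union>v\<in>L. {e \<in> E. v \<in> e})" by (auto simp: touch_def)
  then have "card (touch E L) \<le> (\<Sum>v\<in>L. vertex_degree E v)"
    unfolding vertex_degree_def using card_UN_le[OF assms(2)] by metis
  also have "\<dots> \<le> (\<Sum>v\<in>L. D)" by (intro sum_mono assms(3))
  finally show ?thesis by (simp add: mult.commute)
qed

text \<open>\<open>D\<close> plays the role of the maximal number of children: it is
  \<open>d - 1\<close> for a d-regular graph and \<open>n\<close> for the complete graph.\<close>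

definition deg_inv :: "nat \<Rightarrow> 'a set set \<Rightarrow> 'a set \<Rightarrow> bool" where
  "deg_inv D E L \<longleftrightarrow> finite E \<and> finite L \<and> (\<forall>v. vertex_degree E v \<le> D + 1) \<and>
     (\<forall>v\<in>L. vertex_degree E v \<le> D)"

text \<open>The edge leading into a newly found vertex has been removed from the remaining graph.\<close>

lemma deg_inv_step:
  assumes "finite E" "\<And>v. vertex_degree E v \<le> D + 1" "R \<subseteq> touch E L"
  shows "deg_inv D (strip E L) (nxt R L)"
proof -
  have finR: "finite R" using assms finite_touch_strip finite_subset by metis
  have "vertex_degree (strip E L) v \<le> vertex_degree E v" for v
    unfolding vertex_degree_def by (intro card_mono) (use assms in \<open>auto simp: strip_def\<close>)
  then have 1: "vertex_degree (strip E L) v \<le> D + 1" for v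
    using assms(2) le_trans by blast
  have "vertex_degree (strip E L) w \<le> D" if w: "w \<in> nxt R L" for w
  proof -
    obtain v where v: "v \<in> L" "{v, w} \<in> E" using w assms(3) by (auto simp: nxt_def touch_def)
    have "{e \<in> strip E L. w \<in> e} \<subseteq> {e \<in> E. w \<in> e} - {{v, w}}"
      using v(1) by (auto simp: strip_def)
    then have "{e \<in> strip E L. w \<in> e} \<subset> {e \<in> E. w \<in> e}" using v(2) by blast
    then have "vertex_degree (strip E L) w < vertex_degree E w"
      unfolding vertex_degree_def by (intro psubset_card_mono) (use assms in auto)
    then show ?thesis using assms(2)[of w] by linarith
  qed
  then show ?thesis
    using 1 finR assms(1) by (simp add: deg_inv_def nxt_card finite_touch_strip)
qed

text \<open>The true quadratic coefficient \<open>D (D - 1) / 2\<close> is at least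
  \<open>D^2 / 4\<close> exactly because \<open>D\<close> is at least 2, with equality in the base
  case. The inductive step gives away \<open>y^2 (2 D - 1 - D^2 y) / 4\<close>, which is nonnegative
  since \<open>(D + 1) y\<close> is at most 2.\<close>

lemma one_minus_power_ge:
  fixes y :: real
  assumes "2 \<le> D" "0 \<le> y" "real D * y \<le> 2"
  shows "1 - real D * y + (real D * y)\<^sup>2 / 4 \<le> (1 - y) ^ D"
  using assms
proof (induction D rule: dec_induct)
  case base
  show ?case by (simp add: power2_eq_square algebra_simps)
next
  case (step D)
  let ?d = "real D"
  have d: "?d \<ge> 2" using step by simp
  have y: "(?d + 1) * y \<le> 2" using step by (simp add: algebra_simps)
  have dy: "?d * y \<le> 2" using y step d by (simp add: algebra_simps)
  have y1: "y \<le> 1" using dy mult_right_mono[OF d, of y] step by linarith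
  have "(?d + 1) * (?d\<^sup>2 * y) \<le> 2 * ?d\<^sup>2"
    using mult_left_mono[OF y, of "?d\<^sup>2"] by (simp add: algebra_simps)
  also have "\<dots> \<le> (?d + 1) * (2 * ?d - 1)" using d by (simp add: algebra_simps power2_eq_square)
  finally have *: "?d\<^sup>2 * y \<le> 2 * ?d - 1" by (rule mult_left_le_imp_le) (use d in simp)
  have **: "y\<^sup>2 * (2 * ?d - 1 - ?d\<^sup>2 * y) \<ge> 0" using * by simp
  have "1 - real (Suc D) * y + (real (Suc D) * y)\<^sup>2 / 4 =
      (1 - y) * (1 - ?d * y + (?d * y)\<^sup>2 / 4) - y\<^sup>2 * (2 * ?d - 1 - ?d\<^sup>2 * y) / 4"
    by (simp add: algebra_simps power2_eq_square add_divide_distrib diff_divide_distrib)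
  also have "\<dots> \<le> (1 - y) * (1 - ?d * y + (?d * y)\<^sup>2 / 4)" using ** by simp
  also have "\<dots> \<le> (1 - y) * (1 - y) ^ D"
    using step.IH[OF step.prems(1) dy] y1 by (intro mult_left_mono) auto
  finally show ?case by simp
qed

text \<open>\<open>(1 - p * a) ^ D\<close> is the generating function of the binomial law at
  \<open>1 - a\<close>. It decreases in \<open>p\<close>, so only the upper bound on
  \<open>p\<close> matters and subcritical values are covered as well.\<close>

lemma offspring_gf_ge:
  fixes p a lam :: real
  assumes "2 \<le> D" "0 \<le> p" "p * real D \<le> 1 + lam" "0 \<le> lam" "lam \<le> 1" "0 \<le> a" "a \<le> 1"
  shows "1 - (1 + lam) * a + a\<^sup>2 / 4 \<le> (1 - p * a) ^ D"
proof -
  define y where "y = (1 + lam) * a / real D"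
  have D: "real D > 0" using assms by simp
  have Dy: "real D * y = (1 + lam) * a" using D by (simp add: y_def)
  have "(1 + lam) * a \<le> 2 * 1" using assms by (intro mult_mono) auto
  then have Dy2: "real D * y \<le> 2" using Dy by simp
  have y0: "0 \<le> y" using assms by (simp add: y_def)
  have "2 * y \<le> real D * y" using assms y0 by (intro mult_right_mono) auto
  then have y1: "y \<le> 1" using Dy2 by simp
  have "p * a * real D \<le> (1 + lam) * a" using mult_right_mono[OF assms(3), of a] assms by (simp add: mult_ac)
  then have py: "p * a \<le> y" using D by (simp add: y_def pos_le_divide_eq)
  have "a\<^sup>2 \<le> ((1 + lam) * a)\<^sup>2"
    using assms by (intro power_mono) (auto simp: mult_le_cancel_right1)
  then have "1 - (1 + lam) * a + a\<^sup>2 / 4 \<le> 1 - real D * y + (real D * y)\<^sup>2 / 4"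
    using Dy by simp
  also have "\<dots> \<le> (1 - y) ^ D" using one_minus_power_ge[OF assms(1) y0 Dy2] .
  also have "\<dots> \<le> (1 - p * a) ^ D" using py y1 by (intro power_mono) auto
  finally show ?thesis .
qed

text \<open>Mark the vertices of the next level independently with rate \<open>a\<close>. A vertex
  of the present level then has a marked child with probability at most
  \<open>(1 + lam) a - a^2 / 4\<close>: one generation turns the rate \<open>a\<close> into this
  smaller rate, and independence of the vertices is replaced by the count of edges.\<close>

lemma level_bound:
  assumes "2 \<le> D" "0 \<le> p" "p \<le> 1" "p * real D \<le> 1 + lam" "0 \<le> lam" "lam \<le> 1/4" "0 \<le> a" "a \<le> 1"
    and "finite F" "card F \<le> D * k"
  shows "expect (percolation p F) (\<lambda>R. 1 - (1 - a) ^ card (nxt R L)) \<le>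
     1 - (1 - ((1 + lam) * a - a\<^sup>2 / 4)) ^ k"
proof -
  note fin = set_percolation(2)[OF \<open>finite F\<close>, of p]
  have "expect (percolation p F) (\<lambda>R. 1 - (1 - a) ^ card (nxt R L)) \<le>
      expect (percolation p F) (\<lambda>R. 1 - (1 - a) ^ card R)"
  proof (rule expect_mono[OF fin])
    fix R assume "R \<in> set_pmf (percolation p F)"
    then have "R \<subseteq> F" using set_percolation(1)[OF \<open>finite F\<close>, of p] by auto
    then have "card (nxt R L) \<le> card R" using nxt_card(2) finite_subset assms by metis
    then show "1 - (1 - a) ^ card (nxt R L) \<le> 1 - (1 - a) ^ card R"
      using assms by (simp add: power_decreasing)
  qed
  also have "\<dots> = 1 - (1 - p * a) ^ card F"
    using fin assms by (subst expect_diff) (auto simp: expect_percolation_power_card algebra_simps)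
  also have "\<dots> \<le> 1 - (1 - p * a) ^ (D * k)"
    using assms mult_le_one[of p a] by (simp add: power_decreasing)
  also have "\<dots> \<le> 1 - (1 - ((1 + lam) * a - a\<^sup>2 / 4)) ^ k"
  proof -
    have "(1 + lam) * a - a\<^sup>2 / 4 \<le> 1"
    proof -
      have "(1 + lam) * a \<le> 5/4 * a" using assms by (intro mult_right_mono) auto
      moreover have "0 \<le> (1 - a) * (4 - a)" using assms by (intro mult_nonneg_nonneg) auto
      ultimately show ?thesis by (simp add: algebra_simps power2_eq_square)
    qed
    then have "(1 - ((1 + lam) * a - a\<^sup>2 / 4)) ^ k \<le> ((1 - p * a) ^ D) ^ k"
      using offspring_gf_ge[of D p lam a] assms by (intro power_mono) auto
    then show ?thesis by (simp add: power_mult)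
  qed
  finally show ?thesis .
qed

lemma prob_eq_expect_of_bool: "measure_pmf.prob M {x. P x} = expect M (\<lambda>x. of_bool (P x))"
  unfolding expect_indicator[symmetric] by (intro expect_cong) (auto simp: indicator_def)

text \<open>Kolmogorov's estimate of order 1/k for the survival of a critical branching process,
  valid as long as \<open>k\<close> is at most of order \<open>1 / lam\<close>. The shift by 8 makes
  the bound trivial at \<open>k = 0\<close>.\<close>

lemma prob_surv_le:
  assumes "2 \<le> D" "0 \<le> p" "p \<le> 1" "p * real D \<le> 1 + lam" "0 \<le> lam" "lam * (real k + 8) \<le> 1"
    and "deg_inv D E L"
  shows "measure_pmf.prob (percolation p E) {H. surv k H L} \<le> 1 - (1 - 8 / (real k + 8)) ^ card L"
  using assms(6,7)
proof (induction k arbitrary: E L)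
  case 0
  then have "finite L" by (simp add: deg_inv_def)
  show ?case
  proof (cases "L = {}")
    case False
    then have "card L > 0" using \<open>finite L\<close> by (simp add: card_gt_0_iff)
    then show ?thesis by (simp add: zero_power)
  qed simp
next
  case (Suc k)
  define q where "q = 8 / (real k + 8)"
  define q' where "q' = 8 / (real k + 9)"
  have inv: "finite E" "finite L" "\<And>v. vertex_degree E v \<le> D + 1" "\<And>v. v \<in> L \<Longrightarrow> vertex_degree E v \<le> D"
    using Suc.prems by (auto simp: deg_inv_def)
  note fin = finite_touch_strip[OF inv(1), of L]
  have q: "0 \<le> q" "q \<le> 1" "q' \<le> 1" by (auto simp: q_def q'_def)
  have lamk: "lam * (real k + 8) \<le> 1" using Suc.prems assms(5) by (simp add: algebra_simps)
  have "lam * 8 \<le> lam * (real k + 8)" using assms(5) by (intro mult_left_mono) auto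
  then have lam4: "lam \<le> 1/4" using lamk by simp
  have "measure_pmf.prob (percolation p E) {H. surv (Suc k) H L} =
     expect (percolation p E) (\<lambda>H. of_bool (surv k (strip H L) (nxt H L)))"
    by (simp add: prob_eq_expect_of_bool)
  also have "\<dots> = expect (percolation p (touch E L)) (\<lambda>R. measure_pmf.prob (percolation p (strip E L)) {H. surv k H (nxt R L)})"
    by (subst expect_percolation_split[OF inv(1), of p "\<lambda>N S. of_bool (surv k S N)"])
       (simp add: prob_eq_expect_of_bool)
  also have "\<dots> \<le> expect (percolation p (touch E L)) (\<lambda>R. 1 - (1 - q) ^ card (nxt R L))"
  proof (rule expect_mono)
    show "finite (set_pmf (percolation p (touch E L)))" using fin set_percolation by metis
    fix R assume "R \<in> set_pmf (percolation p (touch E L))"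
    then have "R \<subseteq> touch E L" using set_percolation(1)[OF fin(1), of p] by auto
    from Suc.IH[OF lamk deg_inv_step[OF inv(1,3) this]]
    show "measure_pmf.prob (percolation p (strip E L)) {H. surv k H (nxt R L)} \<le> 1 - (1 - q) ^ card (nxt R L)"
      by (simp add: q_def)
  qed
  also have "\<dots> \<le> 1 - (1 - ((1 + lam) * q - q\<^sup>2 / 4)) ^ card L"
    using card_touch_le[OF inv(1,2,4)] fin q assms lam4 by (intro level_bound) auto
  \<comment> \<open>With \<open>x = k + 8\<close> the gain \<open>q^2 / 4 = 16 / x^2\<close> has to
    pay for the growth \<open>lam * q\<close>, at most \<open>8 / x^2\<close>, and for the
    difference \<open>8 / x - 8 / (x + 1)\<close>, also at most \<open>8 / x^2\<close>. This budget
    determines the constant 8.\<close>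
  also have "\<dots> \<le> 1 - (1 - q') ^ card L"
  proof -
    define x where "x = real k + 8"
    have x: "x \<ge> 8" by (simp add: x_def)
    have "lam * x \<le> 1" using lamk by (simp add: x_def)
    then have "(lam * x) * (8 * (x + 1)) \<le> 1 * (8 * (x + 1))" using x by (intro mult_right_mono) auto
    then have "(lam * x - 1) * (8 * (x + 1)) \<le> 0" by (simp add: algebra_simps)
    then have "8 * x * lam * (x + 1) \<le> 8 * (x + 1)" by (simp add: algebra_simps)
    then have "(8 * (1 + lam) * x - 16) * (x + 1) \<le> 8 * x\<^sup>2"
      by (simp add: algebra_simps power2_eq_square)
    then have "(8 * (1 + lam) * x - 16) / x\<^sup>2 \<le> 8 / (x + 1)"
      using x by (simp add: divide_simps mult.commute)
    moreover have "(1 + lam) * q - q\<^sup>2 / 4 = (8 * (1 + lam) * x - 16) / x\<^sup>2"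
      using x by (simp add: q_def x_def[symmetric] field_simps power2_eq_square)
    moreover have "q' = 8 / (x + 1)" by (simp add: q'_def x_def)
    ultimately have "(1 + lam) * q - q\<^sup>2 / 4 \<le> q'" by simp
    then show ?thesis using q by (simp add: power_mono)
  qed
  finally show ?case by (simp add: q'_def add.commute)
qed

lemma power_add_ge:
  fixes x d :: real
  assumes "0 \<le> x" "x \<le> 1" "0 \<le> d"
  shows "x ^ k + real k * d * x ^ k \<le> (x + d) ^ k"
proof (induction k)
  case (Suc k)
  have "x * x ^ k \<le> 1 * x ^ k" using assms by (intro mult_right_mono) auto
  then have "0 \<le> d * (x ^ k - x * x ^ k) + d * (real k * d * x ^ k)" using assms by simp
  then have "x ^ Suc k + real (Suc k) * d * x ^ Suc k \<le> (x + d) * (x ^ k + real k * d * x ^ k)"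
    by (simp add: algebra_simps)
  also have "\<dots> \<le> (x + d) * (x + d) ^ k" using Suc assms by (intro mult_left_mono) auto
  finally show ?case by simp
qed simp

text \<open>For small \<open>k\<close> the left side is smaller by a factor \<open>1 - a / 8\<close> because \<open>a'\<close> is smaller than \<open>a\<close>;
  for large \<open>k\<close> both sides are close to \<open>1\<close> and the factor \<open>exp (a\<^sup>2 k / 8)\<close> compensates.\<close>

lemma survival_contraction:
  fixes a a' :: real
  assumes "0 \<le> a" "a \<le> 1" "a' \<le> a - a\<^sup>2 / 8"
  shows "1 - (1 - a') ^ k \<le> exp (a\<^sup>2 / 8 * real k - a / 8) * (1 - (1 - a) ^ k)"
proof -
  define x where "x = 1 - a"
  have x: "0 \<le> x" "x \<le> 1" using assms by (auto simp: x_def)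
  define Y where "Y = 1 - x ^ k"
  have Y0: "0 \<le> Y" using x by (simp add: Y_def power_le_one)
  have bern: "1 - a * real k \<le> x ^ k"
    using Bernoulli_inequality[of "-a" k] assms by (simp add: x_def algebra_simps)
  have "x ^ k + real k * (a\<^sup>2 / 8) * x ^ k \<le> (x + a\<^sup>2 / 8) ^ k"
    using x by (intro power_add_ge) auto
  also have "\<dots> \<le> (1 - a') ^ k" using assms x by (intro power_mono) (auto simp: x_def)
  finally have "1 - (1 - a') ^ k \<le> Y - (real k * a) * (a / 8) * x ^ k"
    by (simp add: Y_def power2_eq_square)
  also have "\<dots> \<le> Y - Y * (a / 8) * x ^ k"
    using bern assms x by (intro diff_left_mono mult_right_mono) (auto simp: Y_def mult.commute)
  also have "\<dots> \<le> Y - Y * (a / 8) * (1 - a * real k)"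
    using bern assms Y0 by (intro diff_left_mono mult_left_mono) auto
  also have "\<dots> = (1 + (a\<^sup>2 / 8 * real k - a / 8)) * Y"
    by (simp add: field_simps power2_eq_square)
  also have "\<dots> \<le> exp (a\<^sup>2 / 8 * real k - a / 8) * Y"
    using Y0 by (intro mult_right_mono exp_ge_add_one_self)
  finally show ?thesis by (simp add: Y_def x_def)
qed

text \<open>The last \<open>r\<close> levels, about \<open>8 / a\<close> of them, turn survival into
  the potential since \<open>8 / (r + 8)\<close> is at most \<open>a\<close>. Each earlier level
  gains \<open>exp (- a / 8)\<close> at the price of the discount by its size. Because of
  \<open>32 * lam \<le> a\<close> the growth \<open>lam * a\<close> consumes at most
  \<open>a^2 / 32\<close> of the gain \<open>a^2 / 4\<close>, which leaves the
  \<open>a^2 / 8\<close> that \<open>survival_contraction\<close> asks for.\<close>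

lemma expect_surv_vol_le:
  assumes "2 \<le> D" "0 \<le> p" "p \<le> 1" "p * real D \<le> 1 + lam" "0 \<le> lam"
    and a: "32 * lam \<le> a" "0 < a" "a \<le> 1" and r: "8 / a \<le> real r" "real r \<le> 8 / a + 1"
    and "deg_inv D E L"
  shows "expect (percolation p E) (\<lambda>H. of_bool (surv (j + r) H L) * exp (- (a\<^sup>2 / 8) * real (vol j H L)))
    \<le> exp (- (a / 8) * real j) * (1 - (1 - a) ^ card L)"
  using assms(11)
proof (induction j arbitrary: E L)
  case 0
  have "lam * (real r + 8) \<le> a / 32 * (8 / a + 9)" using a r assms(5) by (intro mult_mono) auto
  also have "\<dots> \<le> 1" using a by (simp add: field_simps)
  finally have "expect (percolation p E) (\<lambda>H. of_bool (surv r H L)) \<le> 1 - (1 - 8 / (real r + 8)) ^ card L"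
    using prob_surv_le[OF assms(1-5) _ 0] by (simp add: prob_eq_expect_of_bool)
  also have "\<dots> \<le> 1 - (1 - a) ^ card L"
  proof -
    have "8 \<le> a * real r" using r a by (simp add: field_simps)
    then have "8 / (real r + 8) \<le> a" using a by (simp add: divide_simps distrib_left)
    then show ?thesis using a by (simp add: power_mono)
  qed
  finally show ?case by simp
next
  case (Suc j)
  let ?b = "a\<^sup>2 / 8"
  have inv: "finite E" "finite L" "\<And>v. vertex_degree E v \<le> D + 1" "\<And>v. v \<in> L \<Longrightarrow> vertex_degree E v \<le> D"
    using Suc.prems by (auto simp: deg_inv_def)
  note fin = finite_touch_strip[OF inv(1), of L]
  let ?f = "\<lambda>N S. of_bool (surv (j + r) S N) * exp (- ?b * real (vol j S N))"
  have "expect (percolation p E) (\<lambda>H. of_bool (surv (Suc j + r) H L) * exp (- ?b * real (vol (Suc j) H L))) =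
     expect (percolation p E) (\<lambda>H. exp (- ?b * real (card L)) * ?f (nxt H L) (strip H L))"
    by (intro expect_cong) (simp add: algebra_simps flip: exp_add)
  also have "\<dots> = exp (- ?b * real (card L)) * expect (percolation p E) (\<lambda>H. ?f (nxt H L) (strip H L))"
    by simp
  also have "expect (percolation p E) (\<lambda>H. ?f (nxt H L) (strip H L)) =
    expect (percolation p (touch E L)) (\<lambda>R. expect (percolation p (strip E L)) (?f (nxt R L)))"
    by (rule expect_percolation_split[OF inv(1)])
  also have "\<dots> \<le> expect (percolation p (touch E L)) (\<lambda>R. exp (- (a / 8) * real j) * (1 - (1 - a) ^ card (nxt R L)))"
  proof (rule expect_mono)
    show "finite (set_pmf (percolation p (touch E L)))" using fin set_percolation by metis
    fix R assume "R \<in> set_pmf (percolation p (touch E L))"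
    then have "R \<subseteq> touch E L" using set_percolation(1)[OF fin(1), of p] by auto
    from Suc.IH[OF deg_inv_step[OF inv(1,3) this]]
    show "expect (percolation p (strip E L)) (?f (nxt R L)) \<le> exp (- (a / 8) * real j) * (1 - (1 - a) ^ card (nxt R L))" .
  qed
  also have "\<dots> = exp (- (a / 8) * real j) * expect (percolation p (touch E L)) (\<lambda>R. 1 - (1 - a) ^ card (nxt R L))"
    by simp
  also have "\<dots> \<le> exp (- (a / 8) * real j) * (1 - (1 - ((1 + lam) * a - a\<^sup>2 / 4)) ^ card L)"
    using card_touch_le[OF inv(1,2,4)] fin assms by (intro mult_left_mono level_bound) auto
  also have "\<dots> \<le> exp (- (a / 8) * real j) * (exp (?b * real (card L) - a / 8) * (1 - (1 - a) ^ card L))"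
  proof (intro mult_left_mono survival_contraction)
    have "lam * a \<le> a / 32 * a" using a by (intro mult_right_mono) auto
    then show "(1 + lam) * a - a\<^sup>2 / 4 \<le> a - a\<^sup>2 / 8" using a by (simp add: algebra_simps power2_eq_square)
  qed (use a in auto)
  finally have "expect (percolation p E) (\<lambda>H. of_bool (surv (Suc j + r) H L) * exp (- ?b * real (vol (Suc j) H L)))
     \<le> exp (- ?b * real (card L)) * (exp (- (a / 8) * real j) * (exp (?b * real (card L) - a / 8) * (1 - (1 - a) ^ card L)))"
    by simp
  also have "\<dots> = (exp (- ?b * real (card L)) * exp (- (a / 8) * real j) * exp (?b * real (card L) - a / 8))
      * (1 - (1 - a) ^ card L)"
    by (simp only: mult.assoc)
  also have "exp (- ?b * real (card L)) * exp (- (a / 8) * real j) * exp (?b * real (card L) - a / 8) =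
      exp (- ?b * real (card L) + - (a / 8) * real j + (?b * real (card L) - a / 8))"
    by (simp only: exp_add)
  also have "- ?b * real (card L) + - (a / 8) * real j + (?b * real (card L) - a / 8) = - (a / 8) * real (Suc j)"
    by (simp add: field_simps)
  finally show ?case .
qed

text \<open>On the event of small volume the factor \<open>exp (a^2 V / 8)\<close> compensates the
  volume discount of the potential. The prefactor of order \<open>a\<close> survives because the
  potential of boundedly many vertices is of order \<open>a\<close>.\<close>

lemma prob_surv_root_le:
  assumes "2 \<le> D" "0 \<le> p" "p \<le> 1" "p * real D \<le> 1 + lam" "0 \<le> lam"
    and a: "32 * lam \<le> a" "0 < a" "a \<le> 1" and r: "8 / a \<le> real r" "real r \<le> 8 / a + 1"
    and E: "finite E" "\<And>v. vertex_degree E v \<le> D + 1"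
  shows "measure_pmf.prob (percolation p E) {H. surv (Suc (j + r)) H {v} \<and> real (vol (Suc j) H {v}) \<le> V}
    \<le> 2 * a * exp (- (a / 8) * real j + a\<^sup>2 / 8 * V)"
proof -
  let ?L = "{v}"
  let ?b = "a\<^sup>2 / 8"
  note fin = finite_touch_strip[OF E(1), of ?L]
  let ?f = "\<lambda>N S. of_bool (surv (j + r) S N) * exp (- ?b * real (vol j S N))"
  have "measure_pmf.prob (percolation p E) {H. surv (Suc (j + r)) H ?L \<and> real (vol (Suc j) H ?L) \<le> V}
    \<le> expect (percolation p E) (\<lambda>H. exp (?b * V) * ?f (nxt H ?L) (strip H ?L))"
    unfolding prob_eq_expect_of_bool
  proof (rule expect_mono[OF set_percolation(2)[OF E(1)]])
    fix H
    show "of_bool (surv (Suc (j + r)) H ?L \<and> real (vol (Suc j) H ?L) \<le> V)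
       \<le> exp (?b * V) * ?f (nxt H ?L) (strip H ?L)"
    proof (cases "surv (Suc (j + r)) H ?L \<and> real (vol (Suc j) H ?L) \<le> V")
      case True
      then have "?b * real (vol j (strip H ?L) (nxt H ?L)) \<le> ?b * V"
        by (intro mult_left_mono) auto
      then show ?thesis using True by (simp add: mult_exp_exp)
    qed auto
  qed
  also have "\<dots> = exp (?b * V) * expect (percolation p E) (\<lambda>H. ?f (nxt H ?L) (strip H ?L))"
    by simp
  also have "expect (percolation p E) (\<lambda>H. ?f (nxt H ?L) (strip H ?L)) =
    expect (percolation p (touch E ?L)) (\<lambda>R. expect (percolation p (strip E ?L)) (?f (nxt R ?L)))"
    by (rule expect_percolation_split[OF E(1)])
  also have "\<dots> \<le> expect (percolation p (touch E ?L)) (\<lambda>R. exp (- (a / 8) * real j) * (1 - (1 - a) ^ card (nxt R ?L)))"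
  proof (rule expect_mono)
    show "finite (set_pmf (percolation p (touch E ?L)))" using fin set_percolation by metis
    fix R assume "R \<in> set_pmf (percolation p (touch E ?L))"
    then have "R \<subseteq> touch E ?L" using set_percolation(1)[OF fin(1), of p] by auto
    from expect_surv_vol_le[OF assms(1-10) deg_inv_step[OF E this]]
    show "expect (percolation p (strip E ?L)) (?f (nxt R ?L)) \<le> exp (- (a / 8) * real j) * (1 - (1 - a) ^ card (nxt R ?L))" .
  qed
  also have "\<dots> = exp (- (a / 8) * real j) * expect (percolation p (touch E ?L)) (\<lambda>R. 1 - (1 - a) ^ card (nxt R ?L))"
    by simp
  also have "\<dots> \<le> exp (- (a / 8) * real j) * (1 - (1 - ((1 + lam) * a - a\<^sup>2 / 4)) ^ 2)"
  proof (intro mult_left_mono level_bound)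
    \<comment> \<open>The root alone may have \<open>D + 1\<close> open possibilities; as this is at
      most \<open>2 D\<close>, it is treated as two ordinary vertices.\<close>
    have "card (touch E ?L) \<le> (D + 1) * card ?L" by (rule card_touch_le) (use E in auto)
    then show "card (touch E ?L) \<le> D * 2" using assms(1) by simp
  qed (use assms fin in auto)
  also have "\<dots> \<le> exp (- (a / 8) * real j) * (2 * a)"
  proof (intro mult_left_mono)
    define a' where "a' = (1 + lam) * a - a\<^sup>2 / 4"
    have "lam * a \<le> a / 32 * a" using a by (intro mult_right_mono) auto
    then have "a' \<le> a" using a by (simp add: a'_def algebra_simps power2_eq_square)
    moreover have "1 - (1 - a')\<^sup>2 \<le> 2 * a'" by (simp add: power2_eq_square algebra_simps)
    ultimately show "1 - (1 - ((1 + lam) * a - a\<^sup>2 / 4))\<^sup>2 \<le> 2 * a" by (simp add: a'_def)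
  qed simp
  finally have "measure_pmf.prob (percolation p E) {H. surv (Suc (j + r)) H ?L \<and> real (vol (Suc j) H ?L) \<le> V}
      \<le> exp (?b * V) * (exp (- (a / 8) * real j) * (2 * a))"
    by simp
  also have "\<dots> = 2 * a * exp (- (a / 8) * real j + ?b * V)"
    by (simp only: exp_add mult_ac)
  finally show ?thesis .
qed

subsection \<open>Tall components of small volume\<close>

lemma Union_subset_all_edges: "H \<subseteq> all_edges V \<Longrightarrow> \<Union>H \<subseteq> V"
  by (auto simp: all_edges_def)

lemma finite_all_edges: "finite V \<Longrightarrow> finite (all_edges V)"
  by (rule finite_subset[of _ "Pow V"]) (auto simp: all_edges_def)

lemma finite_edge: "H \<subseteq> all_edges V \<Longrightarrow> e \<in> H \<Longrightarrow> finite e"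
  unfolding all_edges_def by (metis (mono_tags, lifting) card.infinite mem_Collect_eq subsetD zero_neq_numeral)

lemma component_eq_reach:
  assumes "H \<subseteq> all_edges V" "C \<in> graph_components V H" "x \<in> C"
  shows "C = reach H {x}" "x \<in> V"
proof -
  obtain y where y: "y \<in> V" "C = ((adj H)\<^sup>* \<inter> V \<times> V) `` {y}"
    using assms(2) by (auto simp: graph_components_def elim: quotientE)
  have V: "z \<in> V" if "(y, z) \<in> (adj H)\<^sup>*" for z
    using reach_subset_Un[of H "{y}"] Union_subset_all_edges[OF assms(1)] that y
    by (auto simp: reach_def)
  have C: "C = (adj H)\<^sup>* `` {y}" using y V by auto
  have yx: "(y, x) \<in> (adj H)\<^sup>*" using C assms by auto
  have xy: "(x, y) \<in> (adj H)\<^sup>*" using yx sym_rtrancl[OF sym_adj] by (meson symD)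
  show "C = reach H {x}" unfolding C reach_def using xy yx by (auto intro: rtrancl_trans)
  show "x \<in> V" using V yx by blast
qed

lemma graph_dist_relpow:
  assumes "(u, v) \<in> (adj H)\<^sup>*"
  shows "(u, v) \<in> adj H ^^ graph_dist H u v"
  using assms unfolding graph_dist_def by (metis LeastI rtrancl_imp_relpow)

lemma graph_dist_le: "(u, v) \<in> adj H ^^ k \<Longrightarrow> graph_dist H u v \<le> k"
  unfolding graph_dist_def by (rule Least_le)

lemma relpow_adj_sym: "(u, v) \<in> adj H ^^ k \<Longrightarrow> (v, u) \<in> adj H ^^ k"
proof (induction k arbitrary: u)
  case (Suc k)
  then obtain z where "(u, z) \<in> adj H" "(z, v) \<in> adj H ^^ k" by (meson relpow_Suc_D2)
  with Suc.IH have "(v, z) \<in> adj H ^^ k" "(z, u) \<in> adj H" by (auto simp: insert_commute)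
  then show ?case by (rule relpow_Suc_I)
qed simp

lemma surv_graph_dist:
  assumes "(x, w) \<in> (adj H)\<^sup>*"
  shows "surv (graph_dist H x w) H {x}"
  by (rule surv_of_dist[OF singletonI graph_dist_relpow[OF assms]])
     (auto dest: graph_dist_le)

lemma graph_diam_attained:
  assumes "finite C" "x \<in> C"
  obtains u v where "u \<in> C" "v \<in> C" "graph_diam H C = graph_dist H u v"
proof -
  let ?S = "{graph_dist H u v | u v. u \<in> C \<and> v \<in> C}"
  have "?S = (\<lambda>(u, v). graph_dist H u v) ` (C \<times> C)" by auto
  then have "finite ?S" using assms by simp
  moreover have "?S \<noteq> {}" using assms by blast
  ultimately have "graph_diam H C \<in> ?S" unfolding graph_diam_def by (rule Max_in)
  then show ?thesis using that by blast
qed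

text \<open>By the triangle inequality one of two vertices realising the diameter is at distance at
  least \<open>r\<close> from \<open>x\<close>. That every vertex of a tall component sees half of
  its height is what permits the division by the volume.\<close>

lemma surv_of_diam:
  assumes "H \<subseteq> all_edges V" "finite V" "C \<in> graph_components V H" "x \<in> C" "2 * r \<le> graph_diam H C"
  shows "surv r H {x}"
proof -
  note C = component_eq_reach(1)[OF assms(1,3)]
  have "finite C" using C[OF assms(4)] finite_reach[of "{x}" H] assms finite_all_edges
    by (metis finite_edge finite.emptyI finite_insert finite_subset)
  then obtain u v where uv: "u \<in> C" "v \<in> C" "graph_diam H C = graph_dist H u v"
    using assms graph_diam_attained by metis
  have xu: "(x, u) \<in> (adj H)\<^sup>*" and xv: "(x, v) \<in> (adj H)\<^sup>*"
    using uv C[OF assms(4)] by (auto simp: reach_def)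
  have "(u, v) \<in> adj H ^^ (graph_dist H x u + graph_dist H x v)"
    using relpow_adj_sym[OF graph_dist_relpow[OF xu]] graph_dist_relpow[OF xv]
    by (auto simp: relpow_add)
  then have "2 * r \<le> graph_dist H x u + graph_dist H x v"
    using graph_dist_le assms(5) uv(3) by fastforce
  then have "r \<le> graph_dist H x u \<or> r \<le> graph_dist H x v" by linarith
  then show ?thesis using surv_graph_dist[OF xu] surv_graph_dist[OF xv] surv_mono by blast
qed

lemma surv_le_vol:
  assumes "surv k H L" "finite L" "finite H"
  shows "Suc k \<le> vol (Suc k) H L"
  using assms
proof (induction k arbitrary: H L)
  case 0
  then show ?case by (simp add: Suc_le_eq card_gt_0_iff)
next
  case (Suc k)
  have "L \<noteq> {}" using Suc.prems surv_empty[of "Suc k"] by blast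
  then have "1 \<le> card L" using Suc.prems by (simp add: Suc_le_eq card_gt_0_iff)
  moreover have "Suc k \<le> vol (Suc k) (strip H L) (nxt H L)"
    using Suc.prems by (intro Suc.IH) (auto simp: nxt_card finite_touch_strip)
  ultimately show ?case by (simp only: vol.simps(2)[of "Suc k"])
qed

lemma diam_less_card:
  assumes "H \<subseteq> all_edges V" "finite V" "C \<in> graph_components V H"
  shows "graph_diam H C < card C" "card C \<le> card V"
proof -
  have fin: "finite H" "\<And>e. e \<in> H \<Longrightarrow> finite e"
    using assms finite_all_edges finite_subset finite_edge by metis+
  have "C \<noteq> {}" using assms(3) by (auto simp: graph_components_def elim!: quotientE)
  then obtain x where x: "x \<in> C" by blast
  note C = component_eq_reach[OF assms(1,3)]
  have CV: "C \<subseteq> V" using C(2) by blast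
  then have finC: "finite C" using assms finite_subset by metis
  obtain u v where uv: "u \<in> C" "v \<in> C" "graph_diam H C = graph_dist H u v"
    using x finC graph_diam_attained by metis
  have "surv (graph_dist H u v) H {u}"
    using uv C(1)[OF uv(1)] by (intro surv_graph_dist) (auto simp: reach_def)
  then have "Suc (graph_dist H u v) \<le> vol (Suc (graph_dist H u v)) H {u}"
    using fin by (intro surv_le_vol) auto
  also have "\<dots> \<le> card (reach H {u})" by (rule vol_le_reach) (use fin in auto)
  also have "\<dots> = card C" using C(1)[OF uv(1)] by simp
  finally show "graph_diam H C < card C" using uv by simp
  show "card C \<le> card V" using CV assms by (simp add: card_mono)
qed

text \<open>Markov's inequality for the number of vertices with property \<open>P\<close>: a
  component of the kind in question supplies at least \<open>m\<close> of them at once.\<close>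

lemma prob_component_le:
  fixes M :: "'a set set pmf"
  assumes "finite V" "finite (set_pmf M)" "0 < m"
    and "\<And>H C. H \<in> set_pmf M \<Longrightarrow> C \<in> graph_components V H \<Longrightarrow> Q H C \<Longrightarrow>
      C \<subseteq> V \<and> m \<le> real (card C) \<and> (\<forall>x\<in>C. P H x)"
  shows "measure_pmf.prob M {H. \<exists>C\<in>graph_components V H. Q H C} \<le>
    (1 / m) * (\<Sum>x\<in>V. measure_pmf.prob M {H. P H x})"
proof -
  have "measure_pmf.prob M {H. \<exists>C\<in>graph_components V H. Q H C} \<le>
     expect M (\<lambda>H. (1 / m) * (\<Sum>x\<in>V. of_bool (P H x)))"
  proof (rule prob_le_expect[OF assms(2)])
    fix H assume H: "H \<in> set_pmf M" "H \<in> {H. \<exists>C\<in>graph_components V H. Q H C}"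
    then obtain C where C: "C \<in> graph_components V H" "Q H C" by blast
    note * = assms(4)[OF H(1) C]
    have "m \<le> real (card C)" using * by blast
    also have "\<dots> = (\<Sum>x\<in>C. of_bool (P H x))" using * by simp
    also have "\<dots> \<le> (\<Sum>x\<in>V. of_bool (P H x))"
      using * assms(1) by (intro sum_mono2) auto
    finally show "1 \<le> 1 / m * (\<Sum>x\<in>V. of_bool (P H x))"
      using assms(3) by (simp add: divide_simps)
  qed (use assms in \<open>auto intro!: sum_nonneg\<close>)
  also have "\<dots> = (1 / m) * (\<Sum>x\<in>V. measure_pmf.prob M {H. P H x})"
    using assms(2) by (simp add: expect_sum prob_eq_expect_of_bool)
  finally show ?thesis .
qed

text \<open>Fixing the volume up to a factor 2 lets the same \<open>v\<close> serve as the upper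
  bound in the exponential estimate and, halved, as the number of vertices to divide by. For
  \<open>v < R\<close> the event is empty, since a component has more vertices than its
  diameter.\<close>

lemma prob_tall_component_one_scale:
  fixes R v y :: real
  assumes "2 \<le> D" "0 \<le> p" "p \<le> 1" "p * real D \<le> 1 + lam" "0 \<le> lam"
    and V: "finite V" "E \<subseteq> all_edges V" "\<And>x. vertex_degree E x \<le> D + 1"
    and R: "24 \<le> R" "0 < v" "R\<^sup>2 / v = y" "1024 \<le> y" "32 * lam \<le> R / (16 * v)" "real (card V) \<le> R ^ 3"
  shows "measure_pmf.prob (percolation p E) {H. \<exists>C\<in>graph_components V H.
      R < real (graph_diam H C) \<and> v / 2 < real (card C) \<and> real (card C) \<le> v} \<le> y\<^sup>2 * exp (- y / 1024)"
proof (cases "R \<le> v")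
  case False
  have "\<not> (R < real (graph_diam H C) \<and> real (card C) \<le> v)"
    if "H \<in> set_pmf (percolation p E)" "C \<in> graph_components V H" for H C
  proof -
    have "H \<subseteq> E" using set_percolation(1) that V finite_all_edges finite_subset by (metis PowD subsetD)
    then have "H \<subseteq> all_edges V" using V(2) by (rule subset_trans)
    then have "graph_diam H C < card C" using diam_less_card(1) V(1) that(2) by blast
    then show ?thesis using False by linarith
  qed
  then have "measure_pmf.prob (percolation p E) {H. \<exists>C\<in>graph_components V H.
      R < real (graph_diam H C) \<and> v / 2 < real (card C) \<and> real (card C) \<le> v} = 0"
    by (subst measure_pmf_zero_iff) blast
  then show ?thesis by simp
next
  case True
  let ?n = "real (card V)"
  \<comment> \<open>The exponent will be \<open>- a R / 32 + a^2 v / 8\<close>, minimal at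
    \<open>a = R / (8 v)\<close>. Half of the minimiser gives \<open>- 3 y / 2048\<close>, of the
    same order.\<close>
  define a where "a = R / (16 * v)"
  define r where "r = nat \<lceil>8 / a\<rceil>"
  define r' where "r' = nat \<lfloor>R / 2\<rfloor>"
  have finE: "finite E" using V finite_all_edges finite_subset by metis
  have a: "0 < a" "a \<le> 1" "32 * lam \<le> a" using R True by (auto simp: a_def divide_simps)
  have yv: "R\<^sup>2 = y * v" using R by (auto simp: field_simps)
  have "8 / a = 128 * v / R" using R by (simp add: a_def)
  moreover have "128 * v / R \<le> R / 8"
  proof -
    have "1024 * v \<le> R\<^sup>2" unfolding yv using R by (intro mult_right_mono) auto
    then show ?thesis using R by (simp add: divide_simps power2_eq_square)
  qed
  ultimately have a8: "8 / a \<le> R / 8" by simp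
  have r: "8 / a \<le> real r" "real r \<le> 8 / a + 1" using a by (auto simp: r_def)
  have r': "R / 2 - 1 \<le> real r'" "real r' \<le> R / 2" using R by (auto simp: r'_def) linarith+
  define j where "j = r' - Suc r"
  have "Suc r \<le> r'" using r r' a8 R by linarith
  then have j: "Suc (j + r) = r'" "real j = real r' - 1 - real r" by (auto simp: j_def of_nat_diff)
  \<comment> \<open>Of the at least \<open>R / 2 - 1\<close> levels, at most
    \<open>R / 8 + 1\<close> are spent on the final survival and one on the root. The remaining
    \<open>3 R / 8 - 3\<close> are at least \<open>R / 4\<close> because \<open>R\<close> is at
    least 24.\<close>
  have jR: "R / 4 \<le> real j" unfolding j using r r' a8 R by linarith
  have P: "measure_pmf.prob (percolation p E) {H. surv r' H {x} \<and> real (vol (Suc j) H {x}) \<le> v}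
    \<le> 2 * a * exp (- y / 1024)" for x
  proof -
    have "measure_pmf.prob (percolation p E) {H. surv r' H {x} \<and> real (vol (Suc j) H {x}) \<le> v}
      \<le> 2 * a * exp (- (a / 8) * real j + a\<^sup>2 / 8 * v)"
      using prob_surv_root_le[OF assms(1-5) a(3,1,2) r finE V(3)] unfolding j(1)[symmetric] by blast
    also have "\<dots> \<le> 2 * a * exp (- y / 1024)"
    proof -
      have "(a / 8) * (R / 4) \<le> (a / 8) * real j" using a jR by (intro mult_left_mono) auto
      moreover have "(a / 8) * (R / 4) = y / 512" using R by (auto simp: a_def power2_eq_square)
      moreover have "a\<^sup>2 / 8 * v = y / 2048" using R by (auto simp: a_def power2_eq_square)
      ultimately have "- (a / 8 * real j) + a\<^sup>2 / 8 * v \<le> - y / 1024" using R by linarith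
      then have "- (a / 8) * real j + a\<^sup>2 / 8 * v \<le> - y / 1024" by simp
      then show ?thesis using a by simp
    qed
    finally show ?thesis .
  qed
  have "measure_pmf.prob (percolation p E) {H. \<exists>C\<in>graph_components V H.
      R < real (graph_diam H C) \<and> v / 2 < real (card C) \<and> real (card C) \<le> v} \<le>
    (1 / (v / 2)) * (\<Sum>x\<in>V. measure_pmf.prob (percolation p E) {H. surv r' H {x} \<and> real (vol (Suc j) H {x}) \<le> v})"
  proof (rule prob_component_le[OF V(1) set_percolation(2)[OF finE]])
    show "0 < v / 2" using R by simp
    fix H C assume H: "H \<in> set_pmf (percolation p E)" "C \<in> graph_components V H"
      "R < real (graph_diam H C) \<and> v / 2 < real (card C) \<and> real (card C) \<le> v"
    have HV: "H \<subseteq> all_edges V" using set_percolation(1)[OF finE, of p] H V by blast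
    then have finH: "finite H" "\<And>e. e \<in> H \<Longrightarrow> finite e"
      using V finite_all_edges finite_subset finite_edge by metis+
    have "2 * r' \<le> graph_diam H C" using r' H by linarith
    then have "surv r' H {x} \<and> real (vol (Suc j) H {x}) \<le> v" if "x \<in> C" for x
      using surv_of_diam[OF HV V(1) H(2) that] vol_le_reach[of "{x}" H "Suc j"] finH
        component_eq_reach(1)[OF HV H(2) that] H(3) by auto
    then show "C \<subseteq> V \<and> v / 2 \<le> real (card C) \<and> (\<forall>x\<in>C. surv r' H {x} \<and> real (vol (Suc j) H {x}) \<le> v)"
      using component_eq_reach(2)[OF HV H(2)] H(3) by auto
  qed
  also have "\<dots> \<le> (1 / (v / 2)) * (\<Sum>x\<in>V. 2 * a * exp (- y / 1024))"
    using P R by (intro mult_left_mono sum_mono) auto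
  also have "\<dots> = (?n / 4 * (R / v\<^sup>2)) * exp (- y / 1024)"
    using R by (simp add: a_def power2_eq_square)
  also have "\<dots> \<le> y\<^sup>2 * exp (- y / 1024)"
  proof (intro mult_right_mono)
    \<comment> \<open>Averaging over the vertices has left the factor \<open>n R / (4 v^2)\<close>;
      it becomes a function of \<open>y\<close> alone because \<open>n\<close> is at most
      \<open>R^3\<close>.\<close>
    have "?n / 4 * (R / v\<^sup>2) \<le> R ^ 3 * (R / v\<^sup>2)" using R by (intro mult_right_mono) auto
    also have "\<dots> = y\<^sup>2" using R by (auto simp: power2_eq_square power3_eq_cube)
    finally show "?n / 4 * (R / v\<^sup>2) \<le> y\<^sup>2" .
  qed simp
  finally show ?thesis .
qed

text \<open>The polynomial factor is absorbed by half of the exponent, through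
  \<open>(1 + z / 3) ^ 3 \<le> exp z\<close> at \<open>z = y / 2048\<close>; hence
  \<open>6144 = 3 * 2048\<close>.\<close>

lemma square_exp_le:
  fixes y :: real
  assumes "6144 ^ 3 \<le> y"
  shows "y\<^sup>2 * exp (- y / 1024) \<le> exp (- y / 2048)"
proof -
  have y: "0 < y" using assms by simp
  have "y\<^sup>2 \<le> (y / 6144) ^ 3" using assms y by (simp add: power_divide power2_eq_square power3_eq_cube)
  also have "\<dots> \<le> (1 + (y / 2048) / real 3) ^ 3" using y by (intro power_mono) auto
  also have "\<dots> \<le> exp (y / 2048)" using y by (intro exp_ge_one_plus_x_over_n_power_n) auto
  finally have "y\<^sup>2 * exp (- y / 1024) \<le> exp (y / 2048) * exp (- y / 1024)" by (intro mult_right_mono) auto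
  also have "\<dots> = exp (- y / 2048)" by (simp add: mult_exp_exp)
  finally show ?thesis .
qed

text \<open>Each halving of the volume doubles \<open>R^2 / v\<close>, so the dyadic scale
  \<open>j\<close> has probability at most \<open>exp (- 2^j y / 2048)\<close>. With
  \<open>j + 1 \<le> 2^j\<close> the sum is dominated by a geometric series of ratio at most 1/2.
  There are finitely many scales since components have at least one vertex.\<close>

lemma prob_tall_thin_component:
  fixes R v :: real
  assumes "2 \<le> D" "0 \<le> p" "p \<le> 1" "p * real D \<le> 1 + lam" "0 \<le> lam"
    and V: "finite V" "E \<subseteq> all_edges V" "\<And>x. vertex_degree E x \<le> D + 1"
    and R: "24 \<le> R" "0 < v" "6144 ^ 3 \<le> R\<^sup>2 / v" "32 * lam \<le> R / (16 * v)" "real (card V) \<le> R ^ 3"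
  shows "measure_pmf.prob (percolation p E) {H. \<exists>C\<in>graph_components V H.
      R < real (graph_diam H C) \<and> real (card C) \<le> v} \<le> 2 * exp (- (R\<^sup>2 / v) / 2048)"
proof -
  define y where "y = R\<^sup>2 / v"
  obtain J where J: "v < 2 ^ J" using real_arch_pow[of 2 v] by auto
  let ?S = "\<lambda>j. {H. \<exists>C\<in>graph_components V H.
      R < real (graph_diam H C) \<and> v / 2 ^ j / 2 < real (card C) \<and> real (card C) \<le> v / 2 ^ j}"
  let ?B = "{H. \<exists>C\<in>graph_components V H. R < real (graph_diam H C) \<and> real (card C) \<le> v}"
  have finE: "finite E" using V finite_all_edges finite_subset by metis
  have sub: "?B \<inter> set_pmf (percolation p E) \<subseteq> (\<Union>j<J. ?S j)"
  proof
    fix H assume "H \<in> ?B \<inter> set_pmf (percolation p E)"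
    then obtain C where C: "C \<in> graph_components V H" "R < real (graph_diam H C)" "real (card C) \<le> v"
      and "H \<in> set_pmf (percolation p E)" by blast
    then have "H \<subseteq> all_edges V" using set_percolation(1)[OF finE, of p] V by blast
    then have "1 \<le> real (card C)" using diam_less_card(1)[of H V C] V C by linarith
    then have ex: "v / 2 ^ J < real (card C)" 
    proof -
      have "v / 2 ^ J < 1" using J by simp
      then show ?thesis using \<open>1 \<le> real (card C)\<close> by linarith
    qed
    define i where "i = (LEAST i. v / 2 ^ i < real (card C))"
    have i: "v / 2 ^ i < real (card C)" "i \<le> J"
      unfolding i_def using ex by (auto intro: LeastI Least_le)
    have "i \<noteq> 0" using i(1) C(3) by (cases i) auto
    then obtain j where j: "i = Suc j" by (cases i) auto
    have "\<not> v / 2 ^ j < real (card C)" using not_less_Least[of j "\<lambda>i. v / 2 ^ i < real (card C)"] j by (simp add: i_def)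
    then have "H \<in> ?S j" using C i j by (auto simp: mult.commute)
    then show "H \<in> (\<Union>j<J. ?S j)" using i j by auto
  qed
  have "measure_pmf.prob (percolation p E) ?B = measure_pmf.prob (percolation p E) (?B \<inter> set_pmf (percolation p E))"
    by (simp add: measure_Int_set_pmf)
  also have "\<dots> \<le> measure_pmf.prob (percolation p E) (\<Union>j<J. ?S j)"
    by (intro measure_pmf.finite_measure_mono sub) auto
  also have "\<dots> \<le> (\<Sum>j<J. measure_pmf.prob (percolation p E) (?S j))"
    by (intro measure_pmf.finite_measure_subadditive_finite) auto
  also have "\<dots> \<le> (\<Sum>j<J. exp (- y / 2048) ^ Suc j)"
  proof (rule sum_mono)
    fix j
    have yj: "R\<^sup>2 / (v / 2 ^ j) = 2 ^ j * y" by (simp add: y_def)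
    have "real (Suc j) \<le> 2 ^ j" by (induction j) auto
    then have jy: "real (Suc j) * y \<le> 2 ^ j * y" using R by (intro mult_right_mono) (auto simp: y_def)
    have "1 * y \<le> real (Suc j) * y" using R by (intro mult_right_mono) (auto simp: y_def)
    then have y1: "6144 ^ 3 \<le> 2 ^ j * y" using jy R by (simp add: y_def)
    have "measure_pmf.prob (percolation p E) (?S j) \<le> (2 ^ j * y)\<^sup>2 * exp (- (2 ^ j * y) / 1024)"
    proof (rule prob_tall_component_one_scale[OF assms(1-8) R(1) _ yj])
      show "1024 \<le> 2 ^ j * y" using y1 by simp
      have "R / (16 * v) \<le> R / (16 * (v / 2 ^ j))" using R by (intro divide_left_mono) (auto simp: divide_simps)
      then show "32 * lam \<le> R / (16 * (v / 2 ^ j))" using R by linarith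
    qed (use R in auto)
    also have "\<dots> \<le> exp (- (2 ^ j * y) / 2048)" using square_exp_le[OF y1] .
    also have "\<dots> \<le> exp (real (Suc j) * (- y / 2048))" using jy by simp
    also have "\<dots> = exp (- y / 2048) ^ Suc j" by (rule exp_of_nat_mult)
    finally show "measure_pmf.prob (percolation p E) (?S j) \<le> exp (- y / 2048) ^ Suc j" .
  qed
  also have "\<dots> \<le> 2 * exp (- y / 2048)"
  proof -
    define q where "q = exp (- y / 2048)"
    have "1 + y / 2048 \<le> exp (y / 2048)" by (rule exp_ge_add_one_self)
    moreover have "6144 ^ 3 \<le> y" using R by (simp add: y_def)
    moreover have "(1::real) \<le> 6144 ^ 3 / 2048" by simp
    ultimately have "2 \<le> exp (y / 2048)" by (smt (verit, best) divide_right_mono)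
    then have q: "0 < q" "q \<le> 1/2" by (auto simp: q_def exp_minus field_simps)
    have "(\<Sum>j<J. q ^ Suc j) = q * (\<Sum>j<J. q ^ j)" by (simp add: sum_distrib_left)
    also have "(\<Sum>j<J. q ^ j) \<le> 2"
    proof -
      have "(\<Sum>j<J. q ^ j) = (1 - q ^ J) / (1 - q)" using q by (simp add: sum_gp_strict)
      also have "\<dots> \<le> 1 / (1 - q)" using q by (intro divide_right_mono) auto
      also have "\<dots> \<le> 2" using q by (simp add: divide_simps)
      finally show ?thesis .
    qed
    finally show ?thesis using q by (simp add: q_def)
  qed
  finally show ?thesis by (simp add: y_def)
qed

subsection \<open>Survival of an exploration\<close>

text \<open>In the intended use \<open>P k s\<close> is the probability that an exploration started in state \<open>s\<close>
  survives \<open>k\<close> steps, \<open>N\<close> is the number of active vertices, \<open>Z\<close> a weight of the active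
  vertices and \<open>T\<close> the number of processed ones. After time \<open>t\<close> the weight has negative drift
  in \<open>good\<close> states; \<open>B\<close> bounds the probability of ever reaching a state that is not good.\<close>

locale exploration =
  fixes K :: "'s \<Rightarrow> 's pmf" and P :: "nat \<Rightarrow> 's \<Rightarrow> real" and inv good :: "'s \<Rightarrow> bool"
    and N T :: "'s \<Rightarrow> nat" and Z B :: "'s \<Rightarrow> real"
    and a d g lam b b1 :: real and t :: nat
  assumes finite_K: "inv s \<Longrightarrow> finite (set_pmf (K s))"
    and inv_step: "inv s \<Longrightarrow> 0 < N s \<Longrightarrow> s' \<in> set_pmf (K s) \<Longrightarrow> inv s' \<and> T s' = Suc (T s)"
    and P_le_1: "inv s \<Longrightarrow> P k s \<le> 1"
    and P_dead: "inv s \<Longrightarrow> N s = 0 \<Longrightarrow> P k s \<le> 0"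
    and P_step: "inv s \<Longrightarrow> 0 < N s \<Longrightarrow> P (Suc k) s \<le> expect (K s) (P k)"
    and Z_nonneg: "inv s \<Longrightarrow> 0 \<le> Z s"
    and B_nonneg: "inv s \<Longrightarrow> 0 \<le> B s"
    and N_step: "inv s \<Longrightarrow> 0 < N s \<Longrightarrow> 0 \<le> x \<Longrightarrow> x \<le> 1/2 \<Longrightarrow>
      (1 - x) ^ N s * (1 + x\<^sup>2 / 4 - 2 * lam * x) \<le> expect (K s) (\<lambda>s'. (1 - x) ^ N s')"
    and Z_step: "inv s \<Longrightarrow> 0 < N s \<Longrightarrow> expect (K s) (\<lambda>s'. exp (a * Z s')) \<le> exp d * exp (a * Z s)"
    and Z_step_good: "inv s \<Longrightarrow> 0 < N s \<Longrightarrow> t \<le> T s \<Longrightarrow> good s \<Longrightarrow>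
      expect (K s) (\<lambda>s'. exp (a * Z s')) \<le> exp (- g) * exp (a * Z s)"
    and B_step: "inv s \<Longrightarrow> 0 < N s \<Longrightarrow> expect (K s) B \<le> B s"
    and B_bad: "inv s \<Longrightarrow> 0 < N s \<Longrightarrow> t \<le> T s \<Longrightarrow> \<not> good s \<Longrightarrow> 1 \<le> B s"
    and a_nonneg: "0 \<le> a"
    and b1: "0 \<le> b1" "b1 \<le> 1/2" "exp d \<le> 1 + b1\<^sup>2 / 4 - 2 * lam * b1"
    and b: "32 * lam \<le> b" "0 < b" "b \<le> 1/2" "1 \<le> real t * b\<^sup>2"
begin

text \<open>The right side is a supersolution of the recursion for \<open>P\<close>: the first term
  contracts by \<open>exp (- g)\<close> in good states, and in a state that is not good
  \<open>B\<close> alone already exceeds 1.\<close>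

lemma late_survival:
  assumes "inv s" "t \<le> T s"
  shows "P k s \<le> exp (- g) ^ k * exp (a * Z s) + B s"
  using assms
proof (induction k arbitrary: s)
  case 0
  have "0 \<le> a * Z s" using a_nonneg Z_nonneg[OF 0(1)] by (rule mult_nonneg_nonneg)
  then have "1 \<le> exp (a * Z s)" by simp
  then show ?case using P_le_1[OF 0(1), of 0] B_nonneg[OF 0(1)]
    unfolding power_0 mult_1_left by linarith
next
  case (Suc k)
  show ?case
  proof (cases "N s = 0 \<or> \<not> good s")
    case True
    then have "P (Suc k) s \<le> 0 \<or> P (Suc k) s \<le> 1 \<and> 1 \<le> B s"
      using Suc.prems P_dead P_le_1 B_bad by blast
    moreover have "0 \<le> exp (- g) ^ Suc k * exp (a * Z s)" by simp
    ultimately show ?thesis using B_nonneg[OF Suc.prems(1)] by linarith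
  next
    case False
    then have s: "inv s" "0 < N s" "t \<le> T s" "good s" using Suc.prems by auto
    note fin = finite_K[OF s(1)]
    have "P (Suc k) s \<le> expect (K s) (P k)" using P_step s by blast
    also have "\<dots> \<le> expect (K s) (\<lambda>s'. exp (- g) ^ k * exp (a * Z s') + B s')"
      using Suc.IH inv_step[OF s(1,2)] s(3) by (intro expect_mono[OF fin]) fastforce
    also have "\<dots> = exp (- g) ^ k * expect (K s) (\<lambda>s'. exp (a * Z s')) + expect (K s) B"
      by (subst expect_add[OF fin]) simp
    also have "\<dots> \<le> exp (- g) ^ k * (exp (- g) * exp (a * Z s)) + B s"
      using Z_step_good[OF s] B_step[OF s(1,2)] by (intro add_mono mult_left_mono) auto
    finally show ?thesis by (simp add: mult_ac)
  qed
qed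

abbreviation w :: real where "w \<equiv> 1 - b\<^sup>2 / 8"

text \<open>Since \<open>t * b^2\<close> is at least 1, the discount accumulated over
  \<open>t\<close> steps is bounded away from 1; this keeps the normalisation
  \<open>1 / (1 - w ^ t)\<close> at most 9.\<close>

lemma w_bounds: "0 < w" "w < 1" "w ^ t \<le> 8 / 9"
proof -
  have "b\<^sup>2 \<le> (1/2)\<^sup>2" using b by (intro power_mono) auto
  then show w: "0 < w" "w < 1" using b by (auto simp: power2_eq_square)
  have "1 + real t * (b\<^sup>2 / 8) \<le> (1 + b\<^sup>2 / 8) ^ t"
    by (rule Bernoulli_inequality) (use zero_le_power2[of b] in linarith)
  then have 98: "9 / 8 \<le> (1 + b\<^sup>2 / 8) ^ t" using b(4) by simp
  have "w * (1 + b\<^sup>2 / 8) \<le> 1" by (simp add: algebra_simps)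
  then have "w ^ t * (1 + b\<^sup>2 / 8) ^ t \<le> 1 ^ t"
    using w by (simp only: flip: power_mult_distrib) (intro power_mono; simp)
  moreover have "w ^ t * (9 / 8) \<le> w ^ t * (1 + b\<^sup>2 / 8) ^ t"
    using 98 w by (intro mult_left_mono) auto
  ultimately show "w ^ t \<le> 8 / 9" by simp
qed

text \<open>The variance makes \<open>(1 - b) ^ N\<close> grow on average by
  \<open>1 + b^2 / 4\<close>. The condition \<open>32 * lam \<le> b\<close> limits the loss from
  \<open>2 * lam * b\<close> to \<open>b^2 / 16\<close>, and the remaining \<open>3 b^2 / 16\<close>
  outweighs the discount \<open>b^2 / 8\<close>.\<close>

lemma N_step_discounted:
  assumes "inv s" "0 < N s"
  shows "(1 - b) ^ N s \<le> w * expect (K s) (\<lambda>s'. (1 - b) ^ N s')"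
proof -
  have "2 * lam * b \<le> b / 16 * b" using b by (intro mult_right_mono) auto
  then have "1 + 3 * b\<^sup>2 / 16 \<le> 1 + b\<^sup>2 / 4 - 2 * lam * b" by (simp add: power2_eq_square)
  then have "w * (1 + 3 * b\<^sup>2 / 16) \<le> w * (1 + b\<^sup>2 / 4 - 2 * lam * b)"
    using w_bounds by (intro mult_left_mono) auto
  moreover have "1 \<le> w * (1 + 3 * b\<^sup>2 / 16)"
  proof -
    have "b\<^sup>2 \<le> (1/2)\<^sup>2" using b by (intro power_mono) auto
    then have "0 \<le> b\<^sup>2 * (8 - 3 * b\<^sup>2)" by (intro mult_nonneg_nonneg) (auto simp: power2_eq_square)
    then show ?thesis by (simp add: algebra_simps)
  qed
  ultimately have "(1 - b) ^ N s * 1 \<le> (1 - b) ^ N s * (w * (1 + b\<^sup>2 / 4 - 2 * lam * b))"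
    using b by (intro mult_left_mono) auto
  also have "\<dots> = w * ((1 - b) ^ N s * (1 + b\<^sup>2 / 4 - 2 * lam * b))" by (simp only: mult_ac)
  also have "\<dots> \<le> w * expect (K s) (\<lambda>s'. (1 - b) ^ N s')"
    using w_bounds b assms by (intro mult_left_mono N_step) auto
  finally show ?thesis by simp
qed

text \<open>The terminal value \<open>exp (a * Z s)\<close> of the late phase is split into
  \<open>exp (a * Z s) - (1 - b1) ^ N s\<close> and \<open>(1 - b1) ^ N s \<le> 1\<close>, both to
  be charged only while the process is alive. The first part grows by at most \<open>exp d\<close>
  per step, \<open>b1\<close> being chosen such that the subtracted power grows at least as fast as
  the exponential may. The second part is replaced by the quotient, which is at least 1 when no
  early step remains and majorises the probability of surviving \<open>k\<close> early steps. Both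
  parts are small if few vertices are active, which produces the prefactor.\<close>

lemma early_survival:
  assumes "inv s" "t \<le> T s + k" "k \<le> t"
  shows "P (t + k) s \<le> exp (- g) ^ t * (exp d ^ k * (exp (a * Z s) - (1 - b1) ^ N s)
     + (1 - w ^ (t - k) * (1 - b) ^ N s) / (1 - w ^ t)) + B s"
  using assms
proof (induction k arbitrary: s)
  case 0
  have e: "1 \<le> exp (a * Z s)" using a_nonneg Z_nonneg[OF 0(1)] by simp
  have u: "(1 - b1) ^ N s \<le> 1" "(1 - b) ^ N s \<le> 1" using b b1 by (auto intro!: power_le_one)
  have w: "w ^ t < 1" using w_bounds by simp
  have 1: "1 \<le> (1 - w ^ t * (1 - b) ^ N s) / (1 - w ^ t)"
    using w mult_left_mono[OF u(2), of "w ^ t"] w_bounds by (simp add: divide_simps)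
  have "P t s \<le> exp (- g) ^ t * exp (a * Z s) + B s"
    using 0 late_survival by simp
  also have "\<dots> \<le> exp (- g) ^ t * (exp (a * Z s) - (1 - b1) ^ N s
     + (1 - w ^ t * (1 - b) ^ N s) / (1 - w ^ t)) + B s"
    using 1 u by (intro add_right_mono mult_left_mono) auto
  finally show ?case by simp
next
  case (Suc k)
  have e: "1 \<le> exp (a * Z s)" using a_nonneg Z_nonneg[OF Suc.prems(1)] by simp
  have u: "(1 - b1) ^ N s \<le> 1" "(1 - b) ^ N s \<le> 1" "0 \<le> (1 - b) ^ N s" using b b1 by (auto intro!: power_le_one)
  have w: "w ^ t < 1" using w_bounds by simp
  show ?case
  proof (cases "N s = 0")
    case True
    have "w ^ (t - Suc k) * (1 - b) ^ N s \<le> 1"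
      using w_bounds u by (intro mult_le_one[OF power_le_one u(3,2)]) auto
    then have "0 \<le> (1 - w ^ (t - Suc k) * (1 - b) ^ N s) / (1 - w ^ t)" using w by simp
    moreover have "0 \<le> exp (a * Z s) - (1 - b1) ^ N s" using e u by linarith
    then have "0 \<le> exp d ^ Suc k * (exp (a * Z s) - (1 - b1) ^ N s)" by simp
    ultimately have "0 \<le> exp (- g) ^ t * (exp d ^ Suc k * (exp (a * Z s) - (1 - b1) ^ N s)
       + (1 - w ^ (t - Suc k) * (1 - b) ^ N s) / (1 - w ^ t))" by (intro mult_nonneg_nonneg[OF _ add_nonneg_nonneg] zero_le_power exp_ge_zero)
    then show ?thesis
      using P_dead[OF Suc.prems(1) True, of "t + Suc k"] B_nonneg[OF Suc.prems(1)] by linarith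
  next
    case False
    then have s: "inv s" "0 < N s" using Suc.prems by auto
    note fin = finite_K[OF s(1)]
    let ?E1 = "expect (K s) (\<lambda>s'. exp (a * Z s'))" and ?E2 = "expect (K s) (\<lambda>s'. (1 - b1) ^ N s')"
      and ?E3 = "expect (K s) (\<lambda>s'. (1 - b) ^ N s')"
    have "P (t + Suc k) s \<le> expect (K s) (P (t + k))" using P_step s by simp
    also have "\<dots> \<le> expect (K s) (\<lambda>s'. exp (- g) ^ t * (exp d ^ k * (exp (a * Z s') - (1 - b1) ^ N s')
     + (1 - w ^ (t - k) * (1 - b) ^ N s') / (1 - w ^ t)) + B s')"
      using inv_step[OF s] Suc.prems by (intro expect_mono[OF fin] Suc.IH) auto
    also have "\<dots> = exp (- g) ^ t * (exp d ^ k * (?E1 - ?E2) + (1 - w ^ (t - k) * ?E3) / (1 - w ^ t)) + expect (K s) B"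
      by (simp add: expect_add[OF fin] expect_diff[OF fin])
    also have "\<dots> \<le> exp (- g) ^ t * (exp d ^ k * (exp d * (exp (a * Z s) - (1 - b1) ^ N s))
        + (1 - w ^ (t - Suc k) * (1 - b) ^ N s) / (1 - w ^ t)) + B s"
    proof (intro add_mono mult_left_mono divide_right_mono)
      have "exp d * (1 - b1) ^ N s \<le> (1 + b1\<^sup>2 / 4 - 2 * lam * b1) * (1 - b1) ^ N s"
        using b1 by (intro mult_right_mono) auto
      also have "\<dots> \<le> ?E2" using N_step[OF s b1(1,2)] by (simp add: mult.commute)
      finally show "?E1 - ?E2 \<le> exp d * (exp (a * Z s) - (1 - b1) ^ N s)"
        using Z_step[OF s] by (simp add: right_diff_distrib)
      have "t - k = Suc (t - Suc k)" using Suc.prems by simp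
      then have "w ^ (t - k) * ?E3 = w ^ (t - Suc k) * (w * ?E3)" by simp
      moreover have "w ^ (t - Suc k) * (1 - b) ^ N s \<le> w ^ (t - Suc k) * (w * ?E3)"
        using w_bounds N_step_discounted[OF s] by (intro mult_left_mono) auto
      ultimately show "1 - w ^ (t - k) * ?E3 \<le> 1 - w ^ (t - Suc k) * (1 - b) ^ N s" by linarith
    qed (use w B_step[OF s] in auto)
    finally show ?thesis by (simp only: power_Suc2 mult.assoc)
  qed
qed

text \<open>The first \<open>t\<close> steps have to be survived without help of the drift, which
  yields the prefactor linear in \<open>N s\<close>, and the next \<open>t\<close> steps yield
  \<open>exp (- g * t)\<close>. The constant 9 is \<open>1 / (1 - 8 / 9)\<close>.\<close>

theorem survival_bound:
  assumes "inv s" "0 \<le> d"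
  shows "P (2 * t) s \<le> exp (- (g - d) * t) * (exp (a * Z s) - 1 + (b1 + 9 * b) * N s) + B s"
proof -
  have bern: "1 - x * N s \<le> (1 - x) ^ N s" if "x \<le> 1/2" for x :: real
    using Bernoulli_inequality[of "-x" "N s"] that by (simp add: mult.commute)
  have w: "w ^ t < 1" using w_bounds by simp
  define X where "X = exp (a * Z s) - (1 - b1) ^ N s"
  define Y where "Y = (1 - (1 - b) ^ N s) / (1 - w ^ t)"
  have Y0: "0 \<le> Y" unfolding Y_def using w b by (auto intro!: divide_nonneg_nonneg power_le_one)
  have "Y \<le> (1 - (1 - b) ^ N s) / (1 / 9)"
    unfolding Y_def using w w_bounds b by (intro divide_left_mono) (auto intro!: power_le_one)
  also have "\<dots> \<le> 9 * (b * N s)" using bern[OF b(3)] by simp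
  finally have Y: "Y \<le> 9 * (b * N s)" .
  have X: "X \<le> exp (a * Z s) - 1 + b1 * N s" using bern[OF b1(2)] by (simp add: X_def)
  have d1: "1 \<le> exp d ^ t" using assms(2) by (simp add: one_le_power)
  have "P (2 * t) s \<le> exp (- g) ^ t * (exp d ^ t * X + Y) + B s"
    using early_survival[OF assms(1), of t] by (simp add: mult_2 X_def Y_def)
  also have "\<dots> \<le> exp (- g) ^ t * (exp d ^ t * X + exp d ^ t * Y) + B s"
    using mult_right_mono[OF d1 Y0] by (intro add_right_mono mult_left_mono) auto
  also have "\<dots> = (exp (- g) * exp d) ^ t * (X + Y) + B s"
    by (simp only: power_mult_distrib distrib_left mult.assoc)
  also have "(exp (- g) * exp d) ^ t = exp (- (g - d) * t)"
    by (simp add: mult_exp_exp flip: exp_of_nat2_mult)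
  also have "exp (- (g - d) * t) * (X + Y) \<le> exp (- (g - d) * t) * (exp (a * Z s) - 1 + (b1 + 9 * b) * N s)"
    using X Y by (intro mult_left_mono) (auto simp: algebra_simps)
  finally show ?thesis by simp
qed

end

subsection \<open>The complete graph\<close>

text \<open>Each step processes exactly one active vertex, so the running time measures the volume.
  \<open>Min\<close> is an arbitrary deterministic choice, which makes the next vertex a function of
  the state.\<close>

fun alive :: "nat \<Rightarrow> 'a::linorder set set \<Rightarrow> 'a set \<Rightarrow> bool" where
  "alive 0 H Q \<longleftrightarrow> Q \<noteq> {}"
| "alive (Suc k) H Q \<longleftrightarrow>
     Q \<noteq> {} \<and> alive k (strip H {Min Q}) (Q - {Min Q} \<union> nxt H {Min Q})"

lemma not_alive_empty [simp]: "\<not> alive k H {}"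
  by (cases k) auto

text \<open>A path through \<open>v\<close> may be cut at its last visit to \<open>v\<close>: what
  follows starts at a neighbour of \<open>v\<close>, which is now active, and avoids the removed
  edges.\<close>

lemma reach_explore:
  assumes "v \<in> Q"
  shows "reach H Q \<subseteq> insert v (reach (strip H {v}) (Q - {v} \<union> nxt H {v}))"
proof
  fix x assume "x \<in> reach H Q"
  then obtain q where "(q, x) \<in> (adj H)\<^sup>*" "q \<in> Q" by (auto simp: reach_def)
  let ?R = "reach (strip H {v}) (Q - {v} \<union> nxt H {v})"
  have sup: "z \<in> ?R" if "z \<in> Q - {v} \<union> nxt H {v}" for z
    using that by (rule set_mp[OF reach_superset])
  from \<open>(q, x) \<in> (adj H)\<^sup>*\<close> \<open>q \<in> Q\<close> show "x \<in> insert v ?R"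
  proof (induction rule: rtrancl_induct)
    case base
    then show ?case using sup[of q] by blast
  next
    case (step x y)
    then have "x \<in> insert v ?R" by blast
    then consider "x = v" | "x \<noteq> v" "x \<in> ?R" by blast
    then show ?case
    proof cases
      case 1
      then have "y = v \<or> y \<in> nxt H {v}" using step by (auto simp: nxt_def)
      then show ?thesis using sup[of y] by blast
    next
      case 2
      have "y = v \<or> (x, y) \<in> adj (strip H {v})" using 2 step by (auto simp: strip_def)
      moreover obtain z where z: "z \<in> Q - {v} \<union> nxt H {v}" "(z, x) \<in> (adj (strip H {v}))\<^sup>*"
        using 2(2) unfolding reach_def by blast
      ultimately have "y = v \<or> (z, y) \<in> (adj (strip H {v}))\<^sup>*" using rtrancl_into_rtrancl by metis
      then show ?thesis using z(1) unfolding reach_def by blast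
    qed
  qed
qed

lemma alive_of_card_reach:
  assumes "k < card (reach H Q)" "finite Q" "finite H" "\<And>e. e \<in> H \<Longrightarrow> finite e"
  shows "alive k H Q"
  using assms
proof (induction k arbitrary: H Q)
  case 0
  then show ?case by (auto simp: reach_def)
next
  case (Suc k)
  have Q: "Q \<noteq> {}" using Suc.prems(1) by (auto simp: reach_def)
  define v where "v = Min Q"
  have v: "v \<in> Q" using Q Suc.prems by (simp add: v_def)
  let ?H = "strip H {v}" and ?Q = "Q - {v} \<union> nxt H {v}"
  have fin: "finite ?Q" "finite ?H" "\<And>e. e \<in> ?H \<Longrightarrow> finite e"
    using Suc.prems by (auto simp: nxt_card finite_touch_strip strip_def)
  note finR = finite_reach[OF fin]
  have "card (reach H Q) \<le> card (insert v (reach ?H ?Q))"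
    using finR by (intro card_mono reach_explore v) auto
  also have "\<dots> \<le> Suc (card (reach ?H ?Q))" by (rule card_insert_le_m1) auto
  finally have "alive k ?H ?Q" using Suc.prems(1) fin by (intro Suc.IH) auto
  then show ?case using Q by (simp add: v_def)
qed

lemma prob_alive_Suc:
  assumes "finite E" "Q \<noteq> {}"
  shows "measure_pmf.prob (percolation p E) {H. alive (Suc k) H Q} =
    expect (percolation p (touch E {Min Q})) (\<lambda>R.
      measure_pmf.prob (percolation p (strip E {Min Q})) {H. alive k H (Q - {Min Q} \<union> nxt R {Min Q})})"
  using expect_percolation_split[OF assms(1), of p "\<lambda>N S. of_bool (alive k S (Q - {Min Q} \<union> N))" "{Min Q}"]
  by (simp add: prob_eq_expect_of_bool assms(2))

lemma card_explore_le:
  assumes "finite Q" "v \<in> Q" "finite R"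
  shows "card (Q - {v} \<union> nxt R {v}) \<le> card Q - 1 + card R"
proof -
  have "card (Q - {v} \<union> nxt R {v}) \<le> card (Q - {v}) + card (nxt R {v})" by (rule card_Un_le)
  then show ?thesis using assms nxt_card(2)[OF assms(3), of "{v}"] by simp
qed

text \<open>The processed vertex contributes the factor \<open>1 / (1 - x)\<close> and its children
  the generating function. The comparison has the slack
  \<open>lam * x * (1 - 2 * x) + x^3 / 4\<close>, nonnegative for \<open>x\<close> up to
  1/2.\<close>

lemma expect_active_ge:
  assumes "2 \<le> D" "0 \<le> p" "p \<le> 1" "p * real D \<le> 1 + lam" "0 \<le> lam" "lam \<le> 1"
    and "finite F" "card F \<le> D" "0 < n" "0 \<le> x" "x \<le> 1/2"
    and N: "\<And>R. R \<subseteq> F \<Longrightarrow> N R \<le> n - 1 + card R"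
  shows "(1 - x) ^ n * (1 + x\<^sup>2 / 4 - 2 * lam * x) \<le> expect (percolation p F) (\<lambda>R. (1 - x) ^ N R)"
proof -
  have n: "n = Suc (n - 1)" using assms by simp
  have "(1 - x) * (1 + x\<^sup>2 / 4 - 2 * lam * x) \<le> 1 - (1 + lam) * x + x\<^sup>2 / 4"
  proof -
    have "0 \<le> lam * x * (1 - 2 * x) + x ^ 3 / 4" using assms by simp
    then show ?thesis by (simp add: field_simps power2_eq_square power3_eq_cube)
  qed
  also have "\<dots> \<le> (1 - p * x) ^ D" using assms by (intro offspring_gf_ge) auto
  also have "\<dots> \<le> (1 - p * x) ^ card F"
    using assms mult_le_one[of p x] by (intro power_decreasing) auto
  finally have *: "(1 - x) * (1 + x\<^sup>2 / 4 - 2 * lam * x) \<le> (1 - p * x) ^ card F" .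
  have "(1 - x) ^ n * (1 + x\<^sup>2 / 4 - 2 * lam * x) = (1 - x) ^ (n - 1) * ((1 - x) * (1 + x\<^sup>2 / 4 - 2 * lam * x))"
    by (subst n) (simp only: power_Suc mult_ac)
  also have "\<dots> \<le> (1 - x) ^ (n - 1) * (1 - p * x) ^ card F"
    using * assms by (intro mult_left_mono) auto
  also have "(1 - p * x) ^ card F = expect (percolation p F) (\<lambda>R. (1 - x) ^ card R)"
    using assms by (simp add: expect_percolation_power_card algebra_simps)
  also have "(1 - x) ^ (n - 1) * \<dots> = expect (percolation p F) (\<lambda>R. (1 - x) ^ (n - 1 + card R))"
    by (simp add: power_add)
  also have "\<dots> \<le> expect (percolation p F) (\<lambda>R. (1 - x) ^ N R)"
  proof (rule expect_mono[OF set_percolation(2)[OF \<open>finite F\<close>]])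
    fix R assume "R \<in> set_pmf (percolation p F)"
    then have "R \<subseteq> F" using set_percolation(1)[OF \<open>finite F\<close>, of p] by auto
    then show "(1 - x) ^ (n - 1 + card R) \<le> (1 - x) ^ N R"
      using N assms by (intro power_decreasing) auto
  qed
  finally show ?thesis .
qed

lemma exp_le_one_plus_square: "exp x \<le> 1 + x + x\<^sup>2" if "x \<le> 1" for x :: real
proof (cases "0 \<le> x")
  case True
  then show ?thesis using that by (rule exp_bound)
next
  case False
  define z where "z = - x"
  have z: "0 \<le> z" using False by (simp add: z_def)
  have "0 \<le> (z - 1/2)\<^sup>2 + 3/4" by simp
  then have q: "0 \<le> 1 - z + z\<^sup>2" by (simp add: power2_eq_square algebra_simps)
  \<comment> \<open>For a negative argument \<open>- z\<close> the bound follows from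
    \<open>1 + z \<le> exp z\<close> and the factorisation
    \<open>1 + z^3 = (1 + z) (1 - z + z^2)\<close>.\<close>
  have "1 \<le> 1 + z ^ 3" using z by simp
  also have "\<dots> = (1 + z) * (1 - z + z\<^sup>2)" by (simp add: algebra_simps power2_eq_square power3_eq_cube)
  also have "\<dots> \<le> exp z * (1 - z + z\<^sup>2)"
    using q by (intro mult_right_mono) (auto simp: add.commute)
  finally have "exp (- z) * 1 \<le> exp (- z) * (exp z * (1 - z + z\<^sup>2))" by (intro mult_left_mono) auto
  also have "\<dots> = 1 - z + z\<^sup>2" by (simp add: exp_minus)
  finally show ?thesis by (simp add: z_def)
qed

lemma strip_all_edges: "strip (all_edges U) {v} = all_edges (U - {v})"
  by (auto simp: strip_def all_edges_def)

lemma card_touch_all_edges: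
  assumes "finite U" "v \<in> U"
  shows "card (touch (all_edges U) {v}) \<le> card U - 1"
proof -
  have "touch (all_edges U) {v} \<subseteq> (\<lambda>w. {v, w}) ` (U - {v})"
    by (auto simp: touch_def all_edges_def card_2_iff doubleton_eq_iff)
  then have "card (touch (all_edges U) {v}) \<le> card ((\<lambda>w. {v, w}) ` (U - {v}))"
    using assms by (intro card_mono) auto
  also have "\<dots> \<le> card (U - {v})" by (rule card_image_le) (use assms in auto)
  finally show ?thesis using assms by simp
qed

definition complete_kernel :: "real \<Rightarrow> 'a::linorder set \<times> 'a set \<Rightarrow> ('a set \<times> 'a set) pmf" where
  "complete_kernel p = (\<lambda>(U, Q). map_pmf (\<lambda>R. (U - {Min Q}, Q - {Min Q} \<union> nxt R {Min Q}))
     (percolation p (touch (all_edges U) {Min Q})))"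

definition complete_alive :: "real \<Rightarrow> nat \<Rightarrow> 'a::linorder set \<times> 'a set \<Rightarrow> real" where
  "complete_alive p k = (\<lambda>(U, Q). measure_pmf.prob (percolation p (all_edges U)) {H. alive k H Q})"

text \<open>The percolation on the unexplored vertex set \<open>U\<close> stays fresh, and the size
  of \<open>U\<close> is determined by time. So all states are \<open>good\<close> and
  \<open>B\<close> is 0: after \<open>t\<close> steps at most \<open>(1 - y) n\<close> vertices are
  left, which lowers the mean number of children by the proportion \<open>y\<close>.\<close>

lemma complete_exploration:
  fixes n t :: nat and lam p b :: real
  defines "y \<equiv> real t / real n"
  assumes "2 \<le> n" "0 \<le> p" "p \<le> 1" "p * real n \<le> 1 + lam" "0 \<le> lam" "lam \<le> y / 8" "y \<le> 1/4"
    and "32 * lam \<le> b" "0 < b" "b \<le> 1/2" "1 \<le> real t * b\<^sup>2"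
  shows "exploration (complete_kernel p) (complete_alive p)
    (\<lambda>(U, Q). finite U \<and> Q \<subseteq> U \<and> card U \<le> n) (\<lambda>_. True)
    (\<lambda>(U, Q). card Q) (\<lambda>(U, Q :: 'a::linorder set). n - card U) (\<lambda>(U, Q). real (card Q)) (\<lambda>_. 0)
    (y / 8) (3 * (y / 8)\<^sup>2) (4 * (y / 8)\<^sup>2) lam b (2 * y) t"
proof -
  define a where "a = y / 8"
  have y: "0 \<le> y" by (simp add: y_def)
  have a: "0 \<le> a" "a \<le> 1/32" "lam \<le> a" "y = 8 * a" using assms y by (auto simp: a_def)
  have n: "real n > 0" using assms by simp
  have step: "0 \<le> u \<Longrightarrow> finite U \<Longrightarrow> Q \<subseteq> U \<Longrightarrow> card U \<le> n \<Longrightarrow> 0 < card Q \<Longrightarrow> u \<le> real (n - card U) / real n \<Longrightarrow>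
     expect (complete_kernel p (U, Q)) (\<lambda>s'. exp (a * real (card (snd s'))))
     \<le> exp (a * lam + 2 * a\<^sup>2 - a * u) * exp (a * real (card Q))" for u and U Q :: "'a set"
  proof -
    assume s: "0 \<le> u" "finite U" "Q \<subseteq> U" "card U \<le> n" "0 < card Q" and u: "u \<le> real (n - card U) / real n"
    define v where "v = Min Q"
    have finQ: "finite Q" using s finite_subset by auto
    have v: "v \<in> Q" using s finQ by (auto simp: v_def card_gt_0_iff)
    then have vU: "v \<in> U" using s by blast
    let ?F = "touch (all_edges U) {v}"
    have finF: "finite ?F" using s finite_all_edges finite_touch_strip by metis
    have ea: "0 \<le> exp a - 1" "exp a - 1 \<le> a + a\<^sup>2" using a exp_le_one_plus_square[of a] by auto
    have "real (card ?F) \<le> real (card U)" using card_touch_all_edges[OF s(2) vU] by linarith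
    also have "\<dots> \<le> (1 - u) * real n" using u n s by (simp add: field_simps of_nat_diff)
    finally have F: "real (card ?F) \<le> (1 - u) * real n" .
    then have u1: "u \<le> 1" using n by (smt (verit) of_nat_0_le_iff zero_less_mult_iff mult_nonneg_nonneg mult_less_0_iff)
    have "expect (complete_kernel p (U, Q)) (\<lambda>s'. exp (a * real (card (snd s')))) =
       expect (percolation p ?F) (\<lambda>R. exp (a * real (card (Q - {v} \<union> nxt R {v}))))"
      by (simp add: complete_kernel_def v_def)
    also have "\<dots> \<le> expect (percolation p ?F) (\<lambda>R. exp (a * (real (card Q) - 1)) * exp a ^ card R)"
    proof (rule expect_mono[OF set_percolation(2)[OF finF]])
      fix R assume "R \<in> set_pmf (percolation p ?F)"
      then have "finite R" using set_percolation(1)[OF finF, of p] finF by (meson PowD finite_subset subsetD)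
      then have "real (card (Q - {v} \<union> nxt R {v})) \<le> real (card Q) - 1 + real (card R)"
        using card_explore_le[OF finQ v, of R] s(5) by linarith
      then have "exp (a * real (card (Q - {v} \<union> nxt R {v}))) \<le> exp (a * (real (card Q) - 1 + real (card R)))"
        using a by (simp add: mult_left_mono)
      also have "\<dots> = exp (a * (real (card Q) - 1)) * exp a ^ card R"
        by (simp add: distrib_left exp_add mult.commute flip: exp_of_nat_mult)
      finally show "exp (a * real (card (Q - {v} \<union> nxt R {v}))) \<le> exp (a * (real (card Q) - 1)) * exp a ^ card R" .
    qed
    also have "\<dots> = exp (a * (real (card Q) - 1)) * (1 + p * (exp a - 1)) ^ card ?F"
      using assms finF by (simp add: expect_percolation_power_card algebra_simps)
    also have "\<dots> \<le> exp (a * (real (card Q) - 1)) * exp (a + a * lam + 2 * a\<^sup>2 - a * u)"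
    proof (intro mult_left_mono)
      have pe: "0 \<le> p * (exp a - 1)" using ea assms by simp
      have "(1 + p * (exp a - 1)) ^ card ?F \<le> exp (p * (exp a - 1)) ^ card ?F"
        using pe by (intro power_mono exp_ge_add_one_self) auto
      also have "\<dots> = exp (real (card ?F) * (p * (exp a - 1)))" by (simp add: exp_of_nat_mult)
      also have "\<dots> \<le> exp (a + a * lam + 2 * a\<^sup>2 - a * u)"
      proof (subst exp_le_cancel_iff)
        have "real (card ?F) * (p * (exp a - 1)) \<le> ((1 - u) * real n) * (p * (exp a - 1))"
          using F pe by (rule mult_right_mono)
        also have "\<dots> = (p * real n) * ((1 - u) * (exp a - 1))" by (simp only: mult_ac)
        also have "\<dots> \<le> (1 + lam) * ((1 - u) * (exp a - 1))"
          using assms u1 ea by (intro mult_right_mono) auto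
        also have "\<dots> \<le> (1 + lam) * ((1 - u) * (a + a\<^sup>2))"
          using assms u1 ea by (intro mult_left_mono) auto
        also have "\<dots> \<le> a + a * lam + 2 * a\<^sup>2 - a * u"
        proof -
          have "0 \<le> lam * a * u + (1 - lam) * a\<^sup>2 + (1 + lam) * (u * a\<^sup>2)"
            using a assms s(1) by simp
          then show ?thesis by (simp add: algebra_simps)
        qed
        finally show "real (card ?F) * (p * (exp a - 1)) \<le> a + a * lam + 2 * a\<^sup>2 - a * u" .
      qed
      finally show "(1 + p * (exp a - 1)) ^ card ?F \<le> exp (a + a * lam + 2 * a\<^sup>2 - a * u)" .
    qed simp
    also have "\<dots> = exp (a * lam + 2 * a\<^sup>2 - a * u) * exp (a * real (card Q))"
      by (simp add: algebra_simps mult_exp_exp)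
    finally show ?thesis .
  qed
  have laa: "a * lam \<le> a\<^sup>2" using a mult_left_mono[OF a(3,1)] by (simp add: power2_eq_square)
  show ?thesis unfolding a_def[symmetric]
  proof (unfold_locales, goal_cases)
    case (1 s)
    then show ?case
      by (auto simp: complete_kernel_def intro!: set_percolation finite_touch_strip finite_all_edges)
  next
    case (2 s s')
    obtain U Q where s: "s = (U, Q)" by (cases s)
    have fin: "finite U" "finite Q" and Q: "Q \<noteq> {}" "Q \<subseteq> U" "card U \<le> n" using 2 s finite_subset by auto
    have v: "Min Q \<in> Q" "Min Q \<in> U" using Min_in[OF fin(2) Q(1)] Q(2) by blast+
    have U: "0 < card U" using v fin by (auto simp: card_gt_0_iff)
    let ?F = "touch (all_edges U) {Min Q}"
    have finF: "finite ?F" using fin finite_all_edges finite_touch_strip by metis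
    obtain R where R: "R \<in> set_pmf (percolation p ?F)" "s' = (U - {Min Q}, Q - {Min Q} \<union> nxt R {Min Q})"
      using 2(3) s by (auto simp: complete_kernel_def)
    then have "R \<subseteq> all_edges U" using set_percolation(1)[OF finF, of p] by (auto simp: touch_def)
    then have "nxt R {Min Q} \<subseteq> U - {Min Q}" by (auto simp: nxt_def all_edges_def)
    then show ?case using R s fin Q v U by auto
  next
    case (4 s k)
    obtain U Q where s: "s = (U, Q)" by (cases s)
    then have "Q = {}" using 4 finite_subset by fastforce
    then show ?case by (simp add: s complete_alive_def)
  next
    case (5 s k)
    obtain U Q where s: "s = (U, Q)" by (cases s)
    have fin: "finite U" "finite Q" and Q: "Q \<noteq> {}" using 5 s finite_subset by auto
    then show ?case using prob_alive_Suc[of "all_edges U" Q p k]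
      by (simp add: s complete_alive_def complete_kernel_def finite_all_edges strip_all_edges)
  next
    case (8 s x)
    obtain U Q where s: "s = (U, Q)" by (cases s)
    have fin: "finite U" "finite Q" and Q: "Q \<noteq> {}" "Q \<subseteq> U" "card U \<le> n" using 8 s finite_subset by auto
    have v: "Min Q \<in> Q" "Min Q \<in> U" using Min_in[OF fin(2) Q(1)] Q(2) by blast+
    let ?F = "touch (all_edges U) {Min Q}"
    have finF: "finite ?F" using fin finite_all_edges finite_touch_strip by metis
    have "(1 - x) ^ card Q * (1 + x\<^sup>2 / 4 - 2 * lam * x) \<le>
        expect (percolation p ?F) (\<lambda>R. (1 - x) ^ card (Q - {Min Q} \<union> nxt R {Min Q}))"
    proof (rule expect_active_ge[of n])
      show "card ?F \<le> n" using card_touch_all_edges[OF fin(1) v(2)] Q by linarith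
      show "card (Q - {Min Q} \<union> nxt R {Min Q}) \<le> card Q - 1 + card R" if "R \<subseteq> ?F" for R
        using card_explore_le[OF fin(2) v(1) finite_subset[OF that finF]] .
    qed (use assms finF 8 a s in auto)
    then show ?case by (simp add: s complete_kernel_def)
  next
    case (9 s)
    obtain U Q where s: "s = (U, Q)" by (cases s)
    have "expect (complete_kernel p (U, Q)) (\<lambda>s'. exp (a * real (card (snd s'))))
       \<le> exp (a * lam + 2 * a\<^sup>2 - a * 0) * exp (a * real (card Q))"
      using 9 s by (intro step) auto
    also have "\<dots> \<le> exp (3 * a\<^sup>2) * exp (a * real (card Q))"
      using laa by (intro mult_right_mono) auto
    finally show ?case by (simp add: s case_prod_unfold)
  next
    case (10 s)
    obtain U Q where s: "s = (U, Q)" by (cases s)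
    have "t \<le> n - card U" using 10 s by simp
    then have "real t \<le> real (n - card U)" by (rule of_nat_mono)
    then have "y \<le> real (n - card U) / real n" unfolding y_def by (rule divide_right_mono) simp
    then have "expect (complete_kernel p (U, Q)) (\<lambda>s'. exp (a * real (card (snd s'))))
       \<le> exp (a * lam + 2 * a\<^sup>2 - a * y) * exp (a * real (card Q))"
      using 10 s y by (intro step) auto
    also have "\<dots> \<le> exp (- (4 * a\<^sup>2)) * exp (a * real (card Q))"
    proof (intro mult_right_mono)
      \<comment> \<open>The choice \<open>a = y / 8\<close> makes the late drift
        \<open>- 8 a^2\<close>, against a second-order term \<open>2 a^2\<close> and a growth term
        of at most \<open>a^2\<close>.\<close>
      have "a * y = 8 * a\<^sup>2" by (simp add: a(4) power2_eq_square)
      then have "a * lam + 2 * a\<^sup>2 - a * y \<le> - (4 * a\<^sup>2)" using laa zero_le_power2[of a] by linarith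
      then show "exp (a * lam + 2 * a\<^sup>2 - a * y) \<le> exp (- (4 * a\<^sup>2))" by simp
    qed simp
    finally show ?case by (simp add: s case_prod_unfold)
  next
    case 16
    have "3 * a\<^sup>2 \<le> 1"
    proof -
      have "a\<^sup>2 \<le> (1/32)\<^sup>2" using a by (intro power_mono) auto
      then show ?thesis by (simp add: power2_eq_square)
    qed
    then have "exp (3 * a\<^sup>2) \<le> 1 + 3 * a\<^sup>2 + (3 * a\<^sup>2)\<^sup>2" by (rule exp_le_one_plus_square)
    also have "(3 * a\<^sup>2)\<^sup>2 \<le> 1 * (3 * a\<^sup>2)"
      using \<open>3 * a\<^sup>2 \<le> 1\<close> by (subst power2_eq_square) (intro mult_right_mono, auto)
    \<comment> \<open>\<open>b1 = 2 y = 16 a\<close>, so its variance gain \<open>64 a^2\<close>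
      covers \<open>6 a^2\<close> for \<open>exp d\<close> and at most \<open>32 a^2\<close> for the
      growth.\<close>
    also have "1 + 3 * a\<^sup>2 + 1 * (3 * a\<^sup>2) \<le> 1 + (2 * y)\<^sup>2 / 4 - 2 * lam * (2 * y)"
    proof -
      have "(2 * y)\<^sup>2 / 4 = 64 * a\<^sup>2" "2 * lam * (2 * y) = 32 * (a * lam)"
        by (simp_all add: a(4) power2_eq_square)
      then show ?thesis using laa zero_le_power2[of a] by linarith
    qed
    finally show ?case by simp
  qed (use assms a y in \<open>auto simp: complete_alive_def\<close>)
qed

text \<open>The rate is \<open>g - d = (4 - 3) (y / 8)^2\<close>. The prefactor adds at most
  \<open>y\<close> from the exponential of a single active vertex to \<open>b1 + 9 b\<close> with
  \<open>b1 = 2 y\<close>.\<close>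

lemma complete_volume_bound:
  fixes n t :: nat and lam p b :: real
  defines "y \<equiv> real t / real n"
  assumes "2 \<le> n" "0 \<le> p" "p \<le> 1" "p * real n \<le> 1 + lam" "0 \<le> lam" "lam \<le> y / 8" "y \<le> 1/4"
    and "32 * lam \<le> b" "0 < b" "b \<le> 1/2" "1 \<le> real t * b\<^sup>2"
    and V: "finite V" "card V = n" "v \<in> (V :: 'a::linorder set)"
  shows "measure_pmf.prob (percolation p (all_edges V)) {H. alive (2 * t) H {v}}
    \<le> exp (- (y\<^sup>2 / 64) * t) * (3 * y + 9 * b)"
proof -
  interpret exploration "complete_kernel p" "complete_alive p"
    "\<lambda>(U, Q). finite U \<and> Q \<subseteq> U \<and> card U \<le> n" "\<lambda>_. True"
    "\<lambda>(U, Q). card Q" "\<lambda>(U, Q :: 'a set). n - card U" "\<lambda>(U, Q). real (card Q)" "\<lambda>_. 0"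
    "y / 8" "3 * (y / 8)\<^sup>2" "4 * (y / 8)\<^sup>2" lam b "2 * y" t
    unfolding y_def by (rule complete_exploration) (use assms in auto)
  have y: "0 \<le> y" by (simp add: y_def)
  have "exp (y / 8) \<le> 1 + y / 8 + (y / 8)\<^sup>2" using assms by (intro exp_le_one_plus_square) auto
  also have "(y / 8)\<^sup>2 \<le> 1 * (y / 8)" unfolding power2_eq_square using assms y by (intro mult_right_mono) auto
  finally have e: "exp (y / 8) - 1 \<le> y" using y by simp
  have "measure_pmf.prob (percolation p (all_edges V)) {H. alive (2 * t) H {v}} = complete_alive p (2 * t) (V, {v})"
    by (simp add: complete_alive_def)
  also have "\<dots> \<le> exp (- (y\<^sup>2 / 64) * t) * (exp (y / 8) - 1 + (2 * y + 9 * b))"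
    using survival_bound[of "(V, {v})"] V by (simp add: power2_eq_square)
  also have "\<dots> \<le> exp (- (y\<^sup>2 / 64) * t) * (3 * y + 9 * b)"
    using e by (intro mult_left_mono) auto
  finally show ?thesis .
qed

subsection \<open>Uniform graphs with given degrees\<close>

text \<open>Arbitrary degree sequences are needed even for regular graphs: exposing the edges at a
  vertex lowers the remaining degrees of its neighbours.\<close>

definition degree_graphs :: "'a set \<Rightarrow> ('a \<Rightarrow> nat) \<Rightarrow> 'a set set set" where
  "degree_graphs U \<delta> = {E. E \<subseteq> all_edges U \<and> (\<forall>v\<in>U. vertex_degree E v = \<delta> v)}"

definition nb :: "'a set set \<Rightarrow> 'a \<Rightarrow> 'a set" where
  "nb E v = {w. {v, w} \<in> E}"

lemma nb_iff [simp]: "w \<in> nb E v \<longleftrightarrow> {v, w} \<in> E"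
  by (simp add: nb_def)

lemma finite_degree_graphs: "finite U \<Longrightarrow> finite (degree_graphs U \<delta>)"
  by (rule finite_subset[of _ "Pow (all_edges U)"]) (auto simp: degree_graphs_def finite_all_edges)

lemma all_edges_doubleton: "E \<subseteq> all_edges U \<Longrightarrow> {v, w} \<in> E \<Longrightarrow> v \<in> U \<and> w \<in> U \<and> v \<noteq> w"
  by (auto simp: all_edges_def card_2_iff)

lemma edges_at_eq:
  assumes "E \<subseteq> all_edges U"
  shows "{e \<in> E. v \<in> e} = (\<lambda>w. {v, w}) ` nb E v"
proof
  show "{e \<in> E. v \<in> e} \<subseteq> (\<lambda>w. {v, w}) ` nb E v"
  proof
    fix e assume e: "e \<in> {e \<in> E. v \<in> e}"
    then have "card e = 2" using assms by (auto simp: all_edges_def)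
    then obtain x y where "e = {x, y}" by (auto simp: card_2_iff)
    then have "e = {v, x} \<or> e = {v, y}" using e by auto
    then show "e \<in> (\<lambda>w. {v, w}) ` nb E v" using e by auto
  qed
qed auto

lemma card_nb:
  assumes "E \<subseteq> all_edges U"
  shows "card (nb E v) = vertex_degree E v"
proof -
  have "inj_on (\<lambda>w. {v, w}) (nb E v)" by (auto simp: inj_on_def doubleton_eq_iff)
  then show ?thesis unfolding vertex_degree_def edges_at_eq[OF assms] by (simp add: card_image)
qed

lemma finite_nb: "E \<subseteq> all_edges U \<Longrightarrow> finite U \<Longrightarrow> finite (nb E v)"
  by (rule finite_subset[of _ U]) (auto dest: all_edges_doubleton)

lemma vertex_degree_eq_sum:
  "finite E \<Longrightarrow> vertex_degree E x = (\<Sum>e\<in>E. of_bool (x \<in> e))"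
  by (simp add: vertex_degree_def Int_def)

lemma sum_exchange:
  fixes f :: "'b \<Rightarrow> nat"
  assumes "finite E" "a \<in> E" "b \<in> E" "a \<noteq> b" "c \<notin> E" "e \<notin> E" "c \<noteq> e"
  shows "sum f ((E - {a, b}) \<union> {c, e}) + (f a + f b) = sum f E + (f c + f e)"
proof -
  have "sum f E = sum f (E - {a, b}) + sum f {a, b}"
    using assms by (intro sum.subset_diff) auto
  moreover have "sum f ((E - {a, b}) \<union> {c, e}) = sum f (E - {a, b}) + sum f {c, e}"
    using assms by (intro sum.union_disjoint) auto
  ultimately show ?thesis using assms by simp
qed

definition switch :: "'a \<Rightarrow> 'a set set \<Rightarrow> 'a \<Rightarrow> 'a \<Rightarrow> 'a \<Rightarrow> 'a set set" where
  "switch v E w s t = (E - {{v, w}, {s, t}}) \<union> {{v, s}, {w, t}}"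

lemma switch_degree_graphs:
  assumes "finite U" "E \<in> degree_graphs U \<delta>" "{v, w} \<in> E" "{s, t} \<in> E" "{v, s} \<notin> E" "{w, t} \<notin> E"
    "v \<noteq> s" "w \<noteq> s" "w \<noteq> t"
  shows "switch v E w s t \<in> degree_graphs U \<delta>"
proof -
  have E: "E \<subseteq> all_edges U" using assms by (simp add: degree_graphs_def)
  have "v \<noteq> t" using assms by (auto simp: insert_commute)
  have dist: "v \<noteq> w" "s \<noteq> t" "v \<in> U" "w \<in> U" "s \<in> U" "t \<in> U"
    using all_edges_doubleton[OF E] assms by blast+
  have sub: "switch v E w s t \<subseteq> all_edges U"
    using E dist assms by (auto simp: switch_def all_edges_def)
  have finE: "finite E" using E assms finite_all_edges finite_subset by metis
  have "vertex_degree (switch v E w s t) x = vertex_degree E x" for x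
  proof -
    let ?f = "\<lambda>e. of_bool (x \<in> e) :: nat"
    have ne: "{v, w} \<noteq> {s, t}" "{v, s} \<noteq> {w, t}"
      using dist assms \<open>v \<noteq> t\<close> by (auto simp: doubleton_eq_iff)
    have 1: "sum ?f (switch v E w s t) + (?f {v, w} + ?f {s, t}) = sum ?f E + (?f {v, s} + ?f {w, t})"
      unfolding switch_def by (rule sum_exchange[OF finE assms(3,4) ne(1) assms(5,6) ne(2)])
    have 3: "?f {v, w} + ?f {s, t} = ?f {v, s} + ?f {w, t}"
      using dist assms \<open>v \<noteq> t\<close> by auto
    have "finite (switch v E w s t)" using finE by (simp add: switch_def)
    then show ?thesis using 1 3 finE by (simp only: vertex_degree_eq_sum)
  qed
  then show ?thesis using sub assms by (simp add: degree_graphs_def)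
qed

lemma switch_inverse:
  assumes "{v, w} \<in> E" "{s, t} \<in> E" "{v, s} \<notin> E" "{w, t} \<notin> E"
  shows "E = (switch v E w s t - {{v, s}, {w, t}}) \<union> {{v, w}, {s, t}}"
  using assms by (auto simp: switch_def)

lemma card_degree_sum_nb:
  assumes "finite U" "E \<in> degree_graphs U \<delta>" "S \<subseteq> U"
  shows "card (SIGMA s:S. nb E s) = (\<Sum>s\<in>S. \<delta> s)"
proof -
  have E: "E \<subseteq> all_edges U" using assms by (simp add: degree_graphs_def)
  have "card (SIGMA s:S. nb E s) = (\<Sum>s\<in>S. card (nb E s))"
    using assms finite_nb[OF E] finite_subset by (intro card_SigmaI) auto
  also have "\<dots> = (\<Sum>s\<in>S. \<delta> s)"
    using assms by (intro sum.cong refl) (auto simp: card_nb[OF E] degree_graphs_def)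
  finally show ?thesis .
qed

text \<open>A switch replaces an edge from \<open>v\<close> to the outside of \<open>S\<close> by an edge from \<open>v\<close> into \<open>S\<close>. All
  but \<open>3 d\<^sup>2\<close> of the pairs \<open>(s, t)\<close> with \<open>s \<in> S\<close> and \<open>{s, t} \<in> E\<close> can be used, and a switch is
  undone by naming one of at most \<open>d |U|\<close> oriented edges.\<close>

lemma switching_bound:
  assumes "finite U" "v \<in> U" "S \<subseteq> U - {v}" "\<And>u. u \<in> U \<Longrightarrow> \<delta> u \<le> d"
  shows "(\<Sum>E\<in>degree_graphs U \<delta>. card (nb E v - S) * ((\<Sum>s\<in>S. \<delta> s) - 3 * d\<^sup>2)) \<le>
    (\<Sum>E\<in>degree_graphs U \<delta>. card (nb E v \<inter> S) * (d * card U))"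
proof -
  let ?G = "degree_graphs U \<delta>"
  define A where "A E w = {(s, t). s \<in> S \<and> {s, t} \<in> E \<and> {v, s} \<notin> E \<and> {w, t} \<notin> E \<and> t \<noteq> w}" for E w
  define X where "X = (SIGMA E:?G. SIGMA w:nb E v - S. A E w)"
  define Y where "Y = (SIGMA E:?G. SIGMA s:nb E v \<inter> S. {(w, t). {w, t} \<in> E})"
  note finG = finite_degree_graphs[OF assms(1), of \<delta>]
  have sub: "E \<subseteq> all_edges U" if "E \<in> ?G" for E using that by (simp add: degree_graphs_def)
  have finnb: "finite (nb E u)" if "E \<in> ?G" for E u using finite_nb[OF sub[OF that] assms(1)] .
  have finp: "finite {(w, t). {w, t} \<in> E}" "card {(w, t). {w, t} \<in> E} \<le> d * card U" if E: "E \<in> ?G" for E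
  proof -
    have eq: "{(w, t). {w, t} \<in> E} = (SIGMA w:U. nb E w)"
      using all_edges_doubleton[OF sub[OF E]] by auto
    show "finite {(w, t). {w, t} \<in> E}" unfolding eq using assms(1) finnb[OF E] by blast
    have "card {(w, t). {w, t} \<in> E} = (\<Sum>s\<in>U. \<delta> s)" unfolding eq by (rule card_degree_sum_nb[OF assms(1) E order_refl])
    also have "\<dots> \<le> (\<Sum>s\<in>U. d)" by (intro sum_mono assms(4))
    finally show "card {(w, t). {w, t} \<in> E} \<le> d * card U" by (simp add: mult.commute)
  qed
  have finA: "finite (A E w)" if "E \<in> ?G" for E w
    by (rule finite_subset[OF _ finp(1)[OF that]]) (auto simp: A_def)
  have cardA: "(\<Sum>s\<in>S. \<delta> s) - 3 * d\<^sup>2 \<le> card (A E w)" if E: "E \<in> ?G" and w: "w \<in> nb E v - S" for E w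
  proof -
    have degle: "card (nb E u) \<le> d" if "u \<in> U" for u
      using card_nb[OF sub[OF E], of u] E assms(4)[OF that] that by (simp add: degree_graphs_def)
    have wU: "w \<in> U" using w all_edges_doubleton[OF sub[OF E]] by auto
    \<comment> \<open>The pairs that cannot be switched: \<open>s\<close> is already adjacent to
      \<open>v\<close> (\<open>?A1\<close>), or \<open>t\<close> equals or is adjacent to
      \<open>w\<close> (\<open>?A2\<close>, with the pair reversed). They number at most
      \<open>d^2\<close> and \<open>(d + 1) d\<close>, together at most
      \<open>3 d^2\<close>.\<close>
    let ?A1 = "SIGMA s:nb E v. nb E s" and ?A2 = "SIGMA t:insert w (nb E w). nb E t"
    have nbU: "nb E u \<subseteq> U" for u using all_edges_doubleton[OF sub[OF E]] by auto
    have "card ?A1 = (\<Sum>s\<in>nb E v. card (nb E s))" using finnb[OF E] by (intro card_SigmaI) auto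
    also have "\<dots> \<le> (\<Sum>s\<in>nb E v. d)" using nbU by (intro sum_mono degle) blast
    also have "\<dots> \<le> d * d" using degle[OF assms(2)] by simp
    finally have 1: "card ?A1 \<le> d * d" .
    have "card ?A2 = (\<Sum>t\<in>insert w (nb E w). card (nb E t))" using finnb[OF E] by (intro card_SigmaI) auto
    also have "\<dots> \<le> (\<Sum>t\<in>insert w (nb E w). d)" using nbU wU by (intro sum_mono degle) blast
    also have "\<dots> = card (insert w (nb E w)) * d" by simp
    also have "\<dots> \<le> (d + 1) * d"
      using degle[OF wU] card_insert_le_m1[of "d + 1" "nb E w" w] by (intro mult_right_mono) auto
    finally have 2: "card ?A2 \<le> (d + 1) * d" .
    have fin12: "finite ?A1" "finite ?A2" using finnb[OF E] by auto
    have "(SIGMA s:S. nb E s) \<subseteq> A E w \<union> (?A1 \<union> (\<lambda>(t, s). (s, t)) ` ?A2)"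
    proof
      fix x assume "x \<in> (SIGMA s:S. nb E s)"
      then obtain s t where x: "x = (s, t)" "s \<in> S" "{s, t} \<in> E" by auto
      have ts: "{t, s} \<in> E" using x(3) by (simp add: insert_commute)
      have "(s, t) \<in> (\<lambda>(t, s). (s, t)) ` ?A2" if "t = w \<or> {w, t} \<in> E"
        using that ts by (intro image_eqI[of _ _ "(t, s)"]) auto
      then show "x \<in> A E w \<union> (?A1 \<union> (\<lambda>(t, s). (s, t)) ` ?A2)"
        using x unfolding A_def by auto
    qed
    then have "card (SIGMA s:S. nb E s) \<le> card (A E w \<union> (?A1 \<union> (\<lambda>(t, s). (s, t)) ` ?A2))"
      using finA[OF E] fin12 by (intro card_mono) auto
    also have "\<dots> \<le> card (A E w) + (card ?A1 + card ((\<lambda>(t, s). (s, t)) ` ?A2))"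
      using card_Un_le le_trans add_left_mono by meson
    also have "\<dots> \<le> card (A E w) + (d * d + (d + 1) * d)"
      using 1 2 card_image_le[OF fin12(2), of "\<lambda>(t, s). (s, t)"] by linarith
    also have "\<dots> \<le> card (A E w) + 3 * d\<^sup>2"
      by (cases d) (auto simp: power2_eq_square)
    finally have "card (SIGMA s:S. nb E s) \<le> card (A E w) + 3 * d\<^sup>2" .
    moreover have "card (SIGMA s:S. nb E s) = (\<Sum>s\<in>S. \<delta> s)"
      using assms(3) by (intro card_degree_sum_nb[OF assms(1) E]) blast
    ultimately show ?thesis by linarith
  qed
  have finY: "finite Y" unfolding Y_def using finG finnb finp by (intro finite_SigmaI) auto
  define \<phi> where "\<phi> = (\<lambda>(E, w, s, t). (switch v E w s t, s, w, t))"
  have ok: "{v, w} \<in> E" "{s, t} \<in> E" "{v, s} \<notin> E" "{w, t} \<notin> E" "v \<noteq> s" "w \<noteq> s" "w \<noteq> t" "s \<in> S" "E \<in> ?G"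
    if "(E, w, s, t) \<in> X" for E w s t
    using that assms(3) by (auto simp: X_def A_def)
  have "inj_on \<phi> X"
  proof (rule inj_onI)
    fix x y assume xy: "x \<in> X" "y \<in> X" "\<phi> x = \<phi> y"
    obtain E w s t where x: "x = (E, w, s, t)" by (cases x)
    obtain E' w' s' t' where y: "y = (E', w', s', t')" by (cases y)
    have eq: "w' = w" "s' = s" "t' = t" "switch v E w s t = switch v E' w s t"
      using xy(3) by (auto simp: \<phi>_def x y)
    have "E = E'"
      using switch_inverse[of v w E s t] switch_inverse[of v w E' s t]
        ok(1-4)[of E w s t] ok(1-4)[of E' w s t] xy(1,2) eq unfolding x y by metis
    then show "x = y" using x y eq by simp
  qed
  moreover have "\<phi> ` X \<subseteq> Y"
  proof
    fix z assume "z \<in> \<phi> ` X"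
    then obtain E w s t where x: "(E, w, s, t) \<in> X" and z: "z = (switch v E w s t, s, w, t)"
      by (auto simp: \<phi>_def)
    have "switch v E w s t \<in> ?G"
      by (rule switch_degree_graphs[OF assms(1)]) (use ok[OF x] in auto)
    then show "z \<in> Y" using ok[OF x] by (auto simp: z Y_def switch_def)
  qed
  ultimately have "card X \<le> card Y" using finY card_inj_on_le by blast
  moreover have "(\<Sum>E\<in>?G. card (nb E v - S) * ((\<Sum>s\<in>S. \<delta> s) - 3 * d\<^sup>2)) \<le> card X"
  proof -
    have "card X = (\<Sum>E\<in>?G. \<Sum>w\<in>nb E v - S. card (A E w))"
      unfolding X_def using finG finnb finA by (subst card_SigmaI) (auto simp: card_SigmaI)
    moreover have "card (nb E v - S) * ((\<Sum>s\<in>S. \<delta> s) - 3 * d\<^sup>2) \<le> (\<Sum>w\<in>nb E v - S. card (A E w))"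
      if "E \<in> ?G" for E
      using sum_mono[of "nb E v - S" "\<lambda>_. (\<Sum>s\<in>S. \<delta> s) - 3 * d\<^sup>2" "\<lambda>w. card (A E w)"] cardA[OF that] by simp
    ultimately show ?thesis by (simp add: sum_mono)
  qed
  moreover have "card Y \<le> (\<Sum>E\<in>?G. card (nb E v \<inter> S) * (d * card U))"
  proof -
    have "card Y = (\<Sum>E\<in>?G. card (nb E v \<inter> S) * card {(w, t). {w, t} \<in> E})"
      unfolding Y_def using finG finnb finp by (subst card_SigmaI) (auto simp: card_SigmaI)
    also have "\<dots> \<le> (\<Sum>E\<in>?G. card (nb E v \<inter> S) * (d * card U))"
      using finp(2) by (intro sum_mono mult_left_mono) auto
    finally show ?thesis .
  qed
  ultimately show ?thesis by linarith
qed

section \<open>Exposing the edges at one vertex of a uniform graph\<close>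

lemma expect_pmf_of_set:
  assumes "finite A" "A \<noteq> {}"
  shows "expect (pmf_of_set A) f = (\<Sum>x\<in>A. f x) / card A"
  using assms by (simp add: integral_pmf_of_set)

text \<open>Tower property: a uniform element conditioned on its value under \<open>g\<close> is
  uniform on the fibre, so redrawing it inside the fibre leaves its law unchanged.\<close>

lemma expect_resample:
  assumes "finite A" "A \<noteq> {}"
  shows "expect (pmf_of_set A) f = expect (pmf_of_set A) (\<lambda>x. expect (pmf_of_set {y \<in> A. g y = g x}) f)"
proof -
  let ?C = "\<lambda>x. {y \<in> A. g y = g x}"
  have C: "finite (?C x)" for x using assms by simp
  have "(\<Sum>x\<in>A. expect (pmf_of_set (?C x)) f) = (\<Sum>x\<in>A. \<Sum>y\<in>A. if g y = g x then f y / card (?C y) else 0)"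
  proof (rule sum.cong[OF refl])
    fix x assume x: "x \<in> A"
    then have "expect (pmf_of_set (?C x)) f = (\<Sum>y\<in>?C x. f y) / card (?C x)"
      using C by (intro expect_pmf_of_set) auto
    also have "\<dots> = (\<Sum>y\<in>?C x. f y / card (?C y))" unfolding sum_divide_distrib
      by (intro sum.cong refl) auto
    also have "\<dots> = (\<Sum>y\<in>A. if g y = g x then f y / card (?C y) else 0)"
      using assms by (intro sum.mono_neutral_cong_left) auto
    finally show "expect (pmf_of_set (?C x)) f = \<dots>" .
  qed
  also have "\<dots> = (\<Sum>y\<in>A. \<Sum>x\<in>A. if g y = g x then f y / card (?C y) else 0)" by (rule sum.swap)
  also have "\<dots> = (\<Sum>y\<in>A. f y)"
  proof (rule sum.cong[OF refl])
    fix y assume y: "y \<in> A"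
    have "(\<Sum>x\<in>A. if g y = g x then f y / card (?C y) else 0) = (\<Sum>x\<in>?C y. f y / card (?C y))"
      using assms by (intro sum.mono_neutral_cong_right) auto
    also have "\<dots> = f y"
    proof -
      have "card (?C y) \<noteq> 0" using y C[of y] by auto
      then show ?thesis by simp
    qed
    finally show "(\<Sum>x\<in>A. if g y = g x then f y / card (?C y) else 0) = f y" .
  qed
  finally show ?thesis using assms by (simp add: expect_pmf_of_set)
qed

lemma nb_eq_nxt_touch: "nb E v = nxt (touch E {v}) {v}" if "E \<subseteq> all_edges U"
  using all_edges_doubleton[OF that, of v v] by (auto simp: nxt_def touch_def)

lemma strip_degree_graphs:
  assumes "finite U" "E \<in> degree_graphs U \<delta>" "v \<in> U"
  shows "strip E {v} \<in> degree_graphs (U - {v}) (\<lambda>u. \<delta> u - of_bool (u \<in> nb E v))"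
proof -
  have E: "E \<subseteq> all_edges U" using assms by (simp add: degree_graphs_def)
  then have sub: "strip E {v} \<subseteq> all_edges (U - {v})" by (auto simp: strip_def all_edges_def)
  have "vertex_degree (strip E {v}) u = \<delta> u - of_bool (u \<in> nb E v)" if u: "u \<in> U - {v}" for u
  proof -
    have "nb (strip E {v}) u = nb E u - {v}" using u by (auto simp: strip_def)
    then have "vertex_degree (strip E {v}) u = card (nb E u - {v})"
      using card_nb[OF sub, of u] by simp
    also have "\<dots> = card (nb E u) - of_bool (u \<in> nb E v)"
      using finite_nb[OF E assms(1), of u] by (auto simp: insert_commute)
    finally show ?thesis using card_nb[OF E, of u] assms u by (simp add: degree_graphs_def)
  qed
  then show ?thesis using sub by (simp add: degree_graphs_def)
qed

text \<open>Fixing the edges at \<open>v\<close> constrains the rest only through the degrees still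
  to be filled. Hence the rest is uniform among graphs with these degrees.\<close>

lemma fibre_degree_graphs:
  assumes "finite U" "E \<in> degree_graphs U \<delta>" "v \<in> U"
  shows "bij_betw (\<lambda>E'. strip E' {v}) {E' \<in> degree_graphs U \<delta>. touch E' {v} = touch E {v}}
    (degree_graphs (U - {v}) (\<lambda>u. \<delta> u - of_bool (u \<in> nb E v)))"
    (is "bij_betw _ ?A ?B")
proof (rule bij_betw_byWitness[where f' = "\<lambda>F. touch E {v} \<union> F"])
  have EU: "E \<subseteq> all_edges U" using assms by (simp add: degree_graphs_def)
  have stripF: "strip (touch E {v} \<union> F) {v} = F" "touch (touch E {v} \<union> F) {v} = touch E {v}"
    if "F \<in> ?B" for F
    using that by (auto simp: degree_graphs_def all_edges_def strip_def touch_def)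
  show "\<forall>E'\<in>?A. touch E {v} \<union> strip E' {v} = E'" using touch_strip(1) by blast
  show "\<forall>F\<in>?B. strip (touch E {v} \<union> F) {v} = F" using stripF by blast
  show "(\<lambda>E'. strip E' {v}) ` ?A \<subseteq> ?B"
  proof
    fix F assume "F \<in> (\<lambda>E'. strip E' {v}) ` ?A"
    then obtain E' where E': "E' \<in> degree_graphs U \<delta>" "touch E' {v} = touch E {v}" "F = strip E' {v}" by blast
    then have "nb E' v = nb E v" using nb_eq_nxt_touch EU by (metis (no_types, lifting) degree_graphs_def mem_Collect_eq)
    then show "F \<in> ?B" using strip_degree_graphs[OF assms(1) E'(1) assms(3)] E'(3) by simp
  qed
  show "(\<lambda>F. touch E {v} \<union> F) ` ?B \<subseteq> ?A"
  proof
    fix E' assume "E' \<in> (\<lambda>F. touch E {v} \<union> F) ` ?B"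
    then obtain F where F: "F \<in> ?B" "E' = touch E {v} \<union> F" by blast
    have FU: "F \<subseteq> all_edges (U - {v})" using F by (simp add: degree_graphs_def)
    have E'U: "E' \<subseteq> all_edges U" using EU FU F(2) by (auto simp: touch_def all_edges_def)
    have "vertex_degree E' u = \<delta> u" if u: "u \<in> U" for u
    proof (cases "u = v")
      case True
      have "nb E' v = nb E v" using F(2) FU by (auto simp: touch_def all_edges_def)
      then have "vertex_degree E' v = vertex_degree E v" using card_nb[OF E'U, of v] card_nb[OF EU, of v] by simp
      then show ?thesis using True assms by (simp add: degree_graphs_def)
    next
      case False
      have nbE': "nb E' u = nb F u \<union> (if u \<in> nb E v then {v} else {})"
        using F(2) FU False by (auto simp: touch_def insert_commute)
      have "v \<notin> nb F u" using FU by (auto simp: all_edges_def)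
      then have "card (nb E' u) = card (nb F u) + of_bool (u \<in> nb E v)"
        using finite_nb[OF FU, of u] assms(1) by (simp add: nbE')
      \<comment> \<open>A neighbour of \<open>v\<close> has positive degree, so the natural
        subtraction in the reduced degree is not truncated.\<close>
      moreover have "of_bool (u \<in> nb E v) \<le> \<delta> u"
      proof (cases "u \<in> nb E v")
        case True
        then have "v \<in> nb E u" by (simp add: insert_commute)
        then have "0 < card (nb E u)" using finite_nb[OF EU assms(1), of u] by (auto simp: card_gt_0_iff)
        then show ?thesis using card_nb[OF EU, of u] assms u by (simp add: degree_graphs_def)
      qed simp
      moreover have "card (nb F u) = \<delta> u - of_bool (u \<in> nb E v)"
        using F(1) u False card_nb[OF FU, of u] by (simp add: degree_graphs_def)
      ultimately show ?thesis using card_nb[OF E'U, of u] by linarith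
    qed
    then show "E' \<in> ?A" using E'U stripF(2)[OF F(1)] F(2) by (simp add: degree_graphs_def)
  qed
qed

lemma expect_pmf_of_set_bij:
  assumes "bij_betw h A B" "finite A" "A \<noteq> {}"
  shows "expect (pmf_of_set A) (\<lambda>x. f (h x)) = expect (pmf_of_set B) f"
proof -
  have B: "finite B" "B \<noteq> {}" "card A = card B"
    using bij_betw_finite[OF assms(1)] bij_betw_same_card[OF assms(1)]
      bij_betw_imp_surj_on[OF assms(1)] assms(2,3) by auto
  show ?thesis
    using assms B sum.reindex_bij_betw[OF assms(1), of f] by (simp add: expect_pmf_of_set)
qed

text \<open>The graph outside \<open>v\<close> may be redrawn independently once the edges at
  \<open>v\<close> are known; this is the Markov property of the exploration before percolation is
  taken into account.\<close>

lemma expect_degree_graphs_expose: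
  assumes "finite U" "degree_graphs U \<delta> \<noteq> {}" "v \<in> U"
  shows "expect (pmf_of_set (degree_graphs U \<delta>)) (\<lambda>E. f (touch E {v}) (strip E {v})) =
    expect (pmf_of_set (degree_graphs U \<delta>)) (\<lambda>E.
      expect (pmf_of_set (degree_graphs (U - {v}) (\<lambda>u. \<delta> u - of_bool (u \<in> nb E v)))) (f (touch E {v})))"
proof -
  let ?G = "degree_graphs U \<delta>"
  let ?C = "\<lambda>E. {E' \<in> ?G. touch E' {v} = touch E {v}}"
  note fin = finite_degree_graphs[OF assms(1), of \<delta>]
  have "expect (pmf_of_set ?G) (\<lambda>E. f (touch E {v}) (strip E {v})) =
    expect (pmf_of_set ?G) (\<lambda>E. expect (pmf_of_set (?C E)) (\<lambda>E. f (touch E {v}) (strip E {v})))"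
    by (rule expect_resample[OF fin assms(2)])
  also have "\<dots> = expect (pmf_of_set ?G) (\<lambda>E.
      expect (pmf_of_set (degree_graphs (U - {v}) (\<lambda>u. \<delta> u - of_bool (u \<in> nb E v)))) (f (touch E {v})))"
  proof (rule expect_cong)
    fix E assume "E \<in> set_pmf (pmf_of_set ?G)"
    then have E: "E \<in> ?G" using fin assms by simp
    then have C: "finite (?C E)" "?C E \<noteq> {}" using fin by auto
    have "expect (pmf_of_set (?C E)) (\<lambda>E. f (touch E {v}) (strip E {v})) =
      expect (pmf_of_set (?C E)) (\<lambda>E'. f (touch E {v}) (strip E' {v}))"
      by (rule expect_cong) (use C in auto)
    also have "\<dots> = expect (pmf_of_set (degree_graphs (U - {v}) (\<lambda>u. \<delta> u - of_bool (u \<in> nb E v)))) (f (touch E {v}))"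
      by (rule expect_pmf_of_set_bij[OF fibre_degree_graphs[OF assms(1) E assms(3)] C])
    finally show "expect (pmf_of_set (?C E)) (\<lambda>E. f (touch E {v}) (strip E {v})) = \<dots>" .
  qed
  finally show ?thesis .
qed

subsection \<open>The exploration of a random regular graph\<close>

text \<open>Expansion to second order: the bound on \<open>f\<close> turns the quadratic term into
  the constant \<open>m^2\<close>, which later has to be paid by the drift.\<close>

lemma expect_exp_le:
  assumes "finite (set_pmf M)" "\<And>x. x \<in> set_pmf M \<Longrightarrow> \<bar>f x\<bar> \<le> m" "m \<le> 1"
  shows "expect M (\<lambda>x. exp (f x)) \<le> exp (expect M f + m\<^sup>2)"
proof -
  have "expect M (\<lambda>x. exp (f x)) \<le> expect M (\<lambda>x. (1 + m\<^sup>2) + f x)"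
  proof (rule expect_mono[OF assms(1)])
    fix x assume x: "x \<in> set_pmf M"
    have "exp (f x) \<le> 1 + f x + (f x)\<^sup>2"
      using assms(2)[OF x] assms(3) by (intro exp_le_one_plus_square) linarith
    also have "(f x)\<^sup>2 \<le> m\<^sup>2" using assms(2)[OF x] by (simp add: abs_le_square_iff[symmetric])
    finally show "exp (f x) \<le> (1 + m\<^sup>2) + f x" by simp
  qed
  also have "\<dots> = 1 + (expect M f + m\<^sup>2)" using assms by (simp add: expect_add)
  also have "\<dots> \<le> exp (expect M f + m\<^sup>2)" by (rule exp_ge_add_one_self)
  finally show ?thesis .
qed

lemma edges_star_nxt:
  assumes "E \<subseteq> all_edges U" "R \<subseteq> touch E {v}"
  shows "R = (\<lambda>w. {v, w}) ` nxt R {v}" "nxt R {v} \<subseteq> nb E v"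
proof -
  have sub: "R \<subseteq> all_edges U" using assms by (auto simp: touch_def)
  have "R = {e \<in> R. v \<in> e}" using assms(2) by (auto simp: touch_def)
  moreover have "nb R v = nxt R {v}" using all_edges_doubleton[OF sub, of v v] by (auto simp: nxt_def)
  ultimately show "R = (\<lambda>w. {v, w}) ` nxt R {v}" using edges_at_eq[OF sub, of v] by simp
  show "nxt R {v} \<subseteq> nb E v" using assms(2) by (auto simp: nxt_def touch_def)
qed

lemma expect_sum_nxt:
  fixes c :: "'a \<Rightarrow> real"
  assumes "finite U" "E \<subseteq> all_edges U" "0 \<le> p" "p \<le> 1"
  shows "expect (percolation p (touch E {v})) (\<lambda>R. \<Sum>w\<in>nxt R {v}. c w) = p * (\<Sum>w\<in>nb E v. c w)"
proof -
  let ?F = "touch E {v}"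
  have finF: "finite ?F" using assms finite_all_edges finite_touch_strip finite_subset by metis
  \<comment> \<open>Each edge at \<open>v\<close> carries the value of its other end, so that a sum
    over children becomes a sum over independent edges.\<close>
  define c' where "c' e = c (THE w. e = {v, w})" for e
  have c': "c' {v, w} = c w" for w
  proof -
    have "(THE w'. {v, w} = {v, w'}) = w" by (rule the_equality) (auto simp: doubleton_eq_iff)
    then show ?thesis by (simp add: c'_def)
  qed
  have eq: "(\<Sum>e\<in>R. c' e) = (\<Sum>w\<in>nxt R {v}. c w)" if "R \<subseteq> ?F" for R
  proof -
    have "inj_on (\<lambda>w. {v, w}) (nxt R {v})" by (auto simp: inj_on_def doubleton_eq_iff)
    then have "(\<Sum>e\<in>(\<lambda>w. {v, w}) ` nxt R {v}. c' e) = (\<Sum>w\<in>nxt R {v}. c w)"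
      by (simp add: sum.reindex c')
    then show ?thesis using edges_star_nxt(1)[OF assms(2) that] by simp
  qed
  have "expect (percolation p ?F) (\<lambda>R. \<Sum>w\<in>nxt R {v}. c w) = expect (percolation p ?F) (\<lambda>R. \<Sum>e\<in>R. c' e)"
    by (rule expect_cong) (use eq set_percolation(1)[OF finF, of p] in auto)
  also have "\<dots> = p * (\<Sum>e\<in>?F. c' e)" by (rule expect_percolation_sum[OF assms(3,4) finF])
  also have "\<dots> = p * (\<Sum>w\<in>nb E v. c w)" using eq[of ?F] nb_eq_nxt_touch[OF assms(2)] by simp
  finally show ?thesis .
qed

section \<open>Weight of the active vertices and edges back to explored territory\<close>

definition reduce :: "('a \<Rightarrow> nat) \<Rightarrow> 'a set set \<Rightarrow> 'a \<Rightarrow> 'a \<Rightarrow> nat" where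
  "reduce \<delta> E v = (\<lambda>u. \<delta> u - of_bool (u \<in> nb E v))"

text \<open>The weight of an active vertex is chosen such that a vertex with all \<open>d - 1\<close> remaining edges is
  critical for \<open>p = 1 / (d - 1)\<close>, while each reduction of a degree, and each edge to a vertex of reduced
  degree, causes negative drift.\<close>

definition weight :: "('a \<Rightarrow> nat) \<Rightarrow> 'a set \<Rightarrow> nat" where
  "weight \<delta> Q = (\<Sum>u\<in>Q. \<delta> u + 1)"

text \<open>The free edge ends at unprocessed vertices that have already lost an edge. The loss may
  be due to an erased edge, so such vertices need not be active.\<close>

definition seen :: "nat \<Rightarrow> 'a set \<Rightarrow> ('a \<Rightarrow> nat) \<Rightarrow> nat" where
  "seen d U \<delta> = (\<Sum>u\<in>U. if \<delta> u < d then \<delta> u else 0)"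

definition hits :: "nat \<Rightarrow> ('a \<Rightarrow> nat) \<Rightarrow> 'a set set \<Rightarrow> 'a \<Rightarrow> nat" where
  "hits d \<delta> E v = card {w \<in> nb E v. \<delta> w < d}"

text \<open>A child \<open>w\<close> uses up one edge and enters with weight at most
  \<open>\<delta> w\<close>, that is, at most \<open>d\<close>, and at most \<open>d - 1\<close> if
  its degree was reduced before. The processed vertex takes its weight \<open>\<delta> v + 1\<close>
  away.\<close>

definition weight_change :: "nat \<Rightarrow> ('a \<Rightarrow> nat) \<Rightarrow> 'a \<Rightarrow> 'a set set \<Rightarrow> real" where
  "weight_change d \<delta> v R = (\<Sum>w\<in>nxt R {v}. real d - of_bool (\<delta> w < d)) - (real (\<delta> v) + 1)"

context
  fixes U :: "'a set" and \<delta> :: "'a \<Rightarrow> nat" and d :: nat and E :: "'a set set" and v :: 'a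
  assumes U: "finite U" and E: "E \<in> degree_graphs U \<delta>" and v: "v \<in> U" "\<delta> v < d"
    and \<delta>: "\<And>u. u \<in> U \<Longrightarrow> \<delta> u \<le> d"
begin

lemma sub_all_edges: "E \<subseteq> all_edges U"
  using E by (simp add: degree_graphs_def)

lemma nb_props: "nb E v \<subseteq> U - {v}" "card (nb E v) = \<delta> v" "finite (nb E v)"
  "u \<in> nb E v \<Longrightarrow> 1 \<le> \<delta> u"
proof -
  show sub: "nb E v \<subseteq> U - {v}" 
  proof
    fix u assume "u \<in> nb E v"
    then show "u \<in> U - {v}" using all_edges_doubleton[OF sub_all_edges, of v u] by auto
  qed
  show "card (nb E v) = \<delta> v" using card_nb[OF sub_all_edges] E v by (simp add: degree_graphs_def)
  show "finite (nb E v)" using finite_nb[OF sub_all_edges U] .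
  assume u: "u \<in> nb E v"
  then have "v \<in> nb E u" by (simp add: insert_commute)
  then have "0 < card (nb E u)" using finite_nb[OF sub_all_edges U, of u] by (auto simp: card_gt_0_iff)
  then show "1 \<le> \<delta> u" using card_nb[OF sub_all_edges, of u] E u sub by (auto simp: degree_graphs_def)
qed

lemma hits_le: "hits d \<delta> E v \<le> \<delta> v"
  unfolding hits_def nb_props(2)[symmetric] by (intro card_mono nb_props) auto

lemma sum_nb_eq: "(\<Sum>w\<in>nb E v. real d - of_bool (\<delta> w < d)) = real d * \<delta> v - hits d \<delta> E v"
  using nb_props(2,3) by (simp add: sum_subtractf hits_def Int_def mult.commute)

lemma weight_change_bounds:
  assumes "R \<subseteq> touch E {v}"
  shows "\<bar>weight_change d \<delta> v R\<bar> \<le> real d ^ 2"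
proof -
  have n: "nxt R {v} \<subseteq> nb E v" using edges_star_nxt(2)[OF sub_all_edges assms] .
  let ?s = "\<Sum>w\<in>nxt R {v}. real d - of_bool (\<delta> w < d)"
  have d1: "1 \<le> d" using v by simp
  have "0 \<le> ?s" using d1 by (intro sum_nonneg) auto
  moreover have "?s \<le> (\<Sum>w\<in>nb E v. real d - of_bool (\<delta> w < d))"
    using d1 nb_props n by (intro sum_mono2) auto
  moreover have "(\<Sum>w\<in>nb E v. real d - of_bool (\<delta> w < d)) \<le> real d * \<delta> v" using sum_nb_eq by simp
  moreover have "real d * \<delta> v \<le> real d * real d" using v by (intro mult_left_mono) auto
  moreover have "real (\<delta> v) + 1 \<le> real d * 1" using v by simp
  moreover have "real d * 1 \<le> real d * real d" using d1 by (intro mult_left_mono) auto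
  ultimately show ?thesis unfolding weight_change_def power2_eq_square by linarith
qed

text \<open>Only an inequality, since a child may have been active already and other active vertices
  may lose an edge; both effects lower the weight.\<close>

lemma weight_step:
  assumes "R \<subseteq> touch E {v}" "v \<in> Q" "Q \<subseteq> U"
  shows "real (weight (reduce \<delta> E v) (Q - {v} \<union> nxt R {v})) \<le> real (weight \<delta> Q) + weight_change d \<delta> v R"
proof -
  have n: "nxt R {v} \<subseteq> nb E v" using edges_star_nxt(2)[OF sub_all_edges assms(1)] .
  have fin: "finite Q" "finite (nxt R {v})" using assms U n nb_props(3) finite_subset by metis+
  let ?w = "\<lambda>u. real (reduce \<delta> E v u + 1)"
  have "real (weight (reduce \<delta> E v) (Q - {v} \<union> nxt R {v})) = (\<Sum>u\<in>Q - {v} \<union> nxt R {v}. ?w u)"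
    by (simp add: weight_def)
  also have "\<dots> \<le> (\<Sum>u\<in>Q - {v}. ?w u) + (\<Sum>u\<in>nxt R {v}. ?w u)"
    using fin sum_nonneg[of "(Q - {v}) \<inter> nxt R {v}" ?w] by (simp add: sum_Un)
  also have "(\<Sum>u\<in>Q - {v}. ?w u) \<le> (\<Sum>u\<in>Q - {v}. real (\<delta> u + 1))"
    by (intro sum_mono) (auto simp: reduce_def)
  also have "(\<Sum>u\<in>nxt R {v}. ?w u) \<le> (\<Sum>u\<in>nxt R {v}. real d - of_bool (\<delta> u < d))"
  proof (rule sum_mono)
    fix u assume "u \<in> nxt R {v}"
    then have u: "u \<in> nb E v" using n by blast
    have "\<delta> u \<le> d" "1 \<le> \<delta> u" using \<delta> nb_props u by blast+
    then show "?w u \<le> real d - of_bool (\<delta> u < d)" using u by (auto simp: reduce_def)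
  qed
  also have "(\<Sum>u\<in>Q - {v}. real (\<delta> u + 1)) = real (weight \<delta> Q) - (real (\<delta> v) + 1)"
    using fin assms(2) by (simp add: weight_def sum.remove)
  finally show ?thesis by (simp add: weight_change_def)
qed

text \<open>Removing \<open>v\<close> costs its \<open>\<delta> v\<close> edge ends. A fresh
  neighbour brings \<open>d - 1\<close> new ones, a neighbour of reduced degree loses one, so each
  hit costs \<open>d\<close> in comparison with a fresh neighbour.\<close>

lemma seen_step:
  "real (seen d (U - {v}) (reduce \<delta> E v)) = real (seen d U \<delta>) + ((real d - 2) * \<delta> v - real d * hits d \<delta> E v)"
proof -
  let ?g = "\<lambda>x. if x < d then real x else 0"
  have d1: "1 \<le> d" using v by simp
  have pt: "?g (reduce \<delta> E v u) = ?g (\<delta> u) + (if u \<in> nb E v then (if \<delta> u < d then - 1 else real d - 1) else 0)"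
    if "u \<in> U - {v}" for u
  proof (cases "u \<in> nb E v")
    case True
    have "\<delta> u \<le> d" "1 \<le> \<delta> u" using \<delta> that nb_props True by blast+
    then show ?thesis using True by (auto simp: reduce_def of_nat_diff)
  qed (simp add: reduce_def)
  have "real (seen d (U - {v}) (reduce \<delta> E v)) = (\<Sum>u\<in>U - {v}. ?g (reduce \<delta> E v u))"
    by (simp add: seen_def if_distrib cong: if_cong)
  also have "\<dots> = (\<Sum>u\<in>U - {v}. ?g (\<delta> u)) + (\<Sum>u\<in>U - {v}. if u \<in> nb E v then (if \<delta> u < d then - 1 else real d - 1) else 0)"
    by (simp only: sum.cong[OF refl pt] sum.distrib)
  also have "(\<Sum>u\<in>U - {v}. ?g (\<delta> u)) = real (seen d U \<delta>) - \<delta> v"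
    using U v by (simp add: seen_def sum.remove if_distrib cong: if_cong)
  also have "(\<Sum>u\<in>U - {v}. if u \<in> nb E v then (if \<delta> u < d then - 1 else real d - 1) else 0) =
      (\<Sum>u\<in>nb E v. if \<delta> u < d then - 1 else real d - 1)"
    using U nb_props(1) by (intro sum.mono_neutral_cong_right) auto
  also have "\<dots> = (\<Sum>u\<in>nb E v. (real d - 1) - real d * of_bool (\<delta> u < d))"
    by (intro sum.cong refl) auto
  also have "\<dots> = (real d - 1) * \<delta> v - real d * hits d \<delta> E v"
    using nb_props(2,3) by (simp add: sum_subtractf hits_def Int_def mult.commute flip: sum_distrib_left)
  finally show ?thesis by (simp add: algebra_simps)
qed

end

text \<open>At \<open>p = 1 / (d - 1)\<close> and without hits the drift is
  \<open>x / (d - 1) - 1\<close>: zero for \<open>x = d - 1\<close>, at most \<open>- 1 / d\<close>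
  below. A hit counts only with the factor \<open>p\<close>, which is too weak if
  \<open>2 * d * p < 1\<close>; but then the drift is at most \<open>- x / 2 - 1\<close> anyway, and
  this pays for all terms because \<open>h\<close> is at most \<open>x\<close>.\<close>

lemma drift_le:
  fixes p lam h x d :: real
  assumes "3 \<le> d" "0 \<le> p" "p * (d - 1) \<le> 1 + lam" "0 \<le> lam" "0 \<le> h" "h \<le> x" "x \<le> d - 2 \<or> x = d - 1"
  shows "p * (d * x - h) - (x + 1) \<le> d * lam - h / (2 * d) - (if x \<le> d - 2 then 1 / d else 0)"
proof (cases "2 * d * p < 1")
  case True
  have dl: "0 \<le> d * lam" using assms by simp
  have "(2 * d * p) * x \<le> 1 * x" using True assms by (intro mult_right_mono) auto
  then have "p * (d * x) \<le> x / 2" by (simp add: mult_ac)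
  moreover have "0 \<le> p * h" using assms by simp
  moreover have "h / (2 * d) \<le> h / 2" using assms by (intro divide_left_mono) auto
  moreover have "(if x \<le> d - 2 then 1 / d else 0) \<le> 1" using assms by simp
  ultimately show ?thesis using assms(5,6) dl unfolding right_diff_distrib by linarith
next
  case False
  have "1 / (2 * d) \<le> p" using False assms by (simp add: field_simps)
  then have "1 / (2 * d) * h \<le> p * h" using assms by (intro mult_right_mono) auto
  then have ph: "h / (2 * d) \<le> p * h" by simp
  have "p * (d * x) - (x + 1) \<le> d * lam - (if x \<le> d - 2 then 1 / d else 0)"
  proof (cases "x \<le> d - 2")
    case True
    show ?thesis
    proof (cases "p * d \<le> 1")
      case True
      have "(p * d) * x \<le> 1 * x" using True assms by (intro mult_right_mono) auto
      moreover have "1 / d \<le> 1" "0 \<le> d * lam" using assms by auto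
      ultimately show ?thesis using \<open>x \<le> d - 2\<close> by (simp add: mult.assoc)
    next
      case False
      have "(p * d - 1) * x \<le> (p * d - 1) * (d - 2)" using False True by (intro mult_left_mono) auto
      also have "\<dots> \<le> d * lam + 1 - 1 / d"
      proof -
        have "(p * d - 1) * (d - 1) = p * (d - 1) * d - (d - 1)" by (simp add: algebra_simps)
        also have "\<dots> \<le> (1 + lam) * d - (d - 1)" using assms by (intro diff_right_mono mult_right_mono) auto
        finally have "p * d - 1 \<le> (1 + lam * d) / (d - 1)" using assms by (simp add: field_simps)
        then have "(p * d - 1) * (d - 2) \<le> (1 + lam * d) / (d - 1) * (d - 2)"
          using assms by (intro mult_right_mono) auto
        also have "\<dots> = (1 + lam * d) * (1 - 1 / (d - 1))" using assms by (simp add: field_simps)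
        also have "\<dots> \<le> d * lam + 1 - 1 / (d - 1)"
        proof -
          define c where "c = 1 / (d - 1)"
          have "0 \<le> lam * d * c" using assms by (simp add: c_def)
          then show ?thesis unfolding c_def[symmetric] by (simp add: algebra_simps)
        qed
        also have "\<dots> \<le> d * lam + 1 - 1 / d"
          using assms divide_left_mono[of "d - 1" d 1] by simp
        finally show ?thesis .
      qed
      finally show ?thesis using \<open>x \<le> d - 2\<close> by (simp add: algebra_simps)
    qed
  next
    case False
    then have x: "x = d - 1" using assms by auto
    have "p * (d - 1) * d \<le> (1 + lam) * d" using assms by (intro mult_right_mono) auto
    then show ?thesis using False by (simp add: x algebra_simps)
  qed
  then show ?thesis using ph by (simp add: right_diff_distrib)
qed

text \<open>A whole graph is recorded although the exploration reads only its edges at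
  \<open>v\<close>; averages over these edges thus remain uniform averages over graphs, to which
  switching applies.\<close>

definition exposure :: "real \<Rightarrow> 'a set \<Rightarrow> ('a \<Rightarrow> nat) \<Rightarrow> 'a \<Rightarrow> ('a set set \<times> 'a set set) pmf" where
  "exposure p U \<delta> v = bind_pmf (pmf_of_set (degree_graphs U \<delta>))
     (\<lambda>E. map_pmf (Pair E) (percolation p (touch E {v})))"

lemma exposure_facts:
  assumes "finite U" "degree_graphs U \<delta> \<noteq> {}"
  shows "finite (set_pmf (exposure p U \<delta> v))"
    "(E, R) \<in> set_pmf (exposure p U \<delta> v) \<Longrightarrow> E \<in> degree_graphs U \<delta> \<and> R \<subseteq> touch E {v}"
    "expect (exposure p U \<delta> v) f =
       expect (pmf_of_set (degree_graphs U \<delta>)) (\<lambda>E. expect (percolation p (touch E {v})) (\<lambda>R. f (E, R)))"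
proof -
  have finG: "finite (degree_graphs U \<delta>)" by (rule finite_degree_graphs[OF assms(1)])
  have fin: "finite (touch E {v})" if "E \<in> degree_graphs U \<delta>" for E
    using that assms finite_all_edges finite_touch_strip finite_subset
    by (metis (no_types, lifting) degree_graphs_def mem_Collect_eq)
  show "finite (set_pmf (exposure p U \<delta> v))"
    unfolding exposure_def using finG assms(2) set_percolation(2)[OF fin] by auto
  show "E \<in> degree_graphs U \<delta> \<and> R \<subseteq> touch E {v}" if "(E, R) \<in> set_pmf (exposure p U \<delta> v)"
    using that set_percolation(1)[OF fin] finG assms(2) by (auto simp: exposure_def)
  show "expect (exposure p U \<delta> v) f =
       expect (pmf_of_set (degree_graphs U \<delta>)) (\<lambda>E. expect (percolation p (touch E {v})) (\<lambda>R. f (E, R)))"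
    unfolding exposure_def using finG assms(2) set_percolation(2)[OF fin]
    by (subst expect_bind) (auto simp: o_def)
qed

definition mean_hits :: "nat \<Rightarrow> 'a set \<Rightarrow> ('a \<Rightarrow> nat) \<Rightarrow> 'a \<Rightarrow> real" where
  "mean_hits d U \<delta> v = expect (pmf_of_set (degree_graphs U \<delta>)) (\<lambda>E. real (hits d \<delta> E v))"

text \<open>The switching inequality averages to \<open>(\<delta> v - H) m \<le> H d |U|\<close>
  with \<open>H\<close> the mean number of hits and \<open>m\<close> the usable edge ends. Moving
  \<open>H m\<close> to the right and bounding \<open>m\<close> and \<open>d |U|\<close> by
  \<open>d n\<close> gives the claim, given that \<open>m\<close> is at least
  \<open>T / 4\<close>.\<close>

lemma mean_hits_ge:
  assumes "finite U" "degree_graphs U \<delta> \<noteq> {}" "v \<in> U" "\<delta> v < d" "\<And>u. u \<in> U \<Longrightarrow> \<delta> u \<le> d"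
    and "card U \<le> n" "real T / 2 \<le> real (seen d U \<delta>)" "16 * d\<^sup>2 \<le> T"
  shows "real (\<delta> v) * real T \<le> mean_hits d U \<delta> v * (8 * real d * real n)"
proof -
  let ?G = "degree_graphs U \<delta>"
  note finG = finite_degree_graphs[OF assms(1), of \<delta>]
  define S where "S = {u \<in> U - {v}. \<delta> u < d}"
  define m where "m = (\<Sum>s\<in>S. \<delta> s) - 3 * d\<^sup>2"
  define H where "H = mean_hits d U \<delta> v"
  have cG: "0 < real (card ?G)" using finG assms by (simp add: card_gt_0_iff)
  have HG: "(\<Sum>E\<in>?G. real (hits d \<delta> E v)) = H * card ?G"
    using cG finG assms by (simp add: H_def mean_hits_def expect_pmf_of_set)
  have hit: "card (nb E v \<inter> S) = hits d \<delta> E v" "card (nb E v - S) = \<delta> v - hits d \<delta> E v"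
    "hits d \<delta> E v \<le> \<delta> v" if E: "E \<in> ?G" for E
  proof -
    note p = nb_props[OF assms(1) E assms(3-5)]
    have "nb E v \<inter> S = {w \<in> nb E v. \<delta> w < d}" using p(1) unfolding S_def by blast
    then show 1: "card (nb E v \<inter> S) = hits d \<delta> E v" by (simp add: hits_def)
    show "card (nb E v - S) = \<delta> v - hits d \<delta> E v" using 1 p(2,3) card_Diff_subset_Int[of "nb E v" S] by simp
    show "hits d \<delta> E v \<le> \<delta> v" using hits_le[OF assms(1) E assms(3-5)] .
  qed
  have "(\<Sum>E\<in>?G. card (nb E v - S) * m) \<le> (\<Sum>E\<in>?G. card (nb E v \<inter> S) * (d * card U))"
    unfolding m_def by (rule switching_bound) (use assms in \<open>auto simp: S_def\<close>)
  then have "(\<Sum>E\<in>?G. (\<delta> v - hits d \<delta> E v) * m) \<le> (\<Sum>E\<in>?G. hits d \<delta> E v * (d * card U))"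
    using hit by simp
  then have "real (\<Sum>E\<in>?G. (\<delta> v - hits d \<delta> E v) * m) \<le> real (\<Sum>E\<in>?G. hits d \<delta> E v * (d * card U))"
    by (rule of_nat_mono)
  then have "(\<Sum>E\<in>?G. (real (\<delta> v) - hits d \<delta> E v) * m) \<le> (\<Sum>E\<in>?G. real (hits d \<delta> E v) * (real d * card U))"
    using hit(3) by (simp add: of_nat_diff)
  then have "(real (\<delta> v) - H) * m * card ?G \<le> H * (real d * card U) * card ?G"
    using HG by (simp add: left_diff_distrib sum_subtractf mult_ac flip: sum_distrib_left sum_distrib_right)
  then have sw: "(real (\<delta> v) - H) * m \<le> H * (real d * card U)" using cG by simp
  have H0: "0 \<le> H" unfolding H_def mean_hits_def by (intro expect_nonneg) auto
  have d1: "1 \<le> d" using assms by simp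
  have "seen d U \<delta> = \<delta> v + (\<Sum>u\<in>U - {v}. if \<delta> u < d then \<delta> u else 0)"
    using assms by (simp add: seen_def sum.remove)
  also have "(\<Sum>u\<in>U - {v}. if \<delta> u < d then \<delta> u else 0) = (\<Sum>s\<in>S. \<delta> s)"
    unfolding S_def using assms(1) by (intro sum.mono_neutral_cong_right) auto
  finally have seen: "seen d U \<delta> = \<delta> v + (\<Sum>s\<in>S. \<delta> s)" .
  \<comment> \<open>From \<open>seen\<close>, which is at least \<open>T / 2\<close>, the ends at
    \<open>v\<close> itself cost at most \<open>d^2\<close> and the forbidden switches
    \<open>3 d^2\<close>. As \<open>T\<close> is at least \<open>16 d^2\<close>, at least
    \<open>T / 4\<close> remains.\<close>
  have "real d \<le> real d * real d" using d1 by simp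
  then have "real T / 2 \<le> real (\<Sum>s\<in>S. \<delta> s) + real d * real d" using seen assms(4,7) by linarith
  moreover have "16 * (real d * real d) \<le> real T"
    using assms(8) by (metis of_nat_le_iff of_nat_mult of_nat_numeral power2_eq_square)
  moreover have "real (\<Sum>s\<in>S. \<delta> s) \<le> real m + real (3 * d\<^sup>2)"
    unfolding m_def of_nat_add[symmetric] by (intro of_nat_mono) simp
  moreover have "real (3 * d\<^sup>2) = 3 * (real d * real d)" by (simp add: power2_eq_square)
  ultimately have mT: "real T / 4 \<le> real m" by linarith
  have "(\<Sum>s\<in>S. \<delta> s) \<le> (\<Sum>s\<in>U. d)"
    using assms(1,5) by (intro order_trans[OF sum_mono2[of U S \<delta>] sum_mono]) (auto simp: S_def)
  also have "\<dots> \<le> d * n" using assms(6) by simp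
  finally have "m \<le> d * n" by (simp add: m_def)
  then have mn: "real m \<le> real d * real n" by (metis of_nat_le_iff of_nat_mult)
  have Un: "real d * card U \<le> real d * real n" using assms(6) by (intro mult_left_mono) auto
  have "real (\<delta> v) * (real T / 4) \<le> real (\<delta> v) * m" using mT by (intro mult_left_mono) auto
  also have "\<dots> \<le> H * (real d * card U) + H * m" using sw by (simp add: left_diff_distrib)
  also have "\<dots> \<le> H * (real d * real n) + H * (real d * real n)"
    by (rule add_mono[OF mult_left_mono[OF Un H0] mult_left_mono[OF mn H0]])
  finally show ?thesis by (simp add: H_def mult_ac)
qed

lemma expect_weight_change:
  assumes "finite U" "degree_graphs U \<delta> \<noteq> {}" "v \<in> U" "\<delta> v < d" "\<And>u. u \<in> U \<Longrightarrow> \<delta> u \<le> d"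
    and "3 \<le> d" "0 \<le> p" "p \<le> 1" "p * (real d - 1) \<le> 1 + lam" "0 \<le> lam"
  shows "expect (exposure p U \<delta> v) (\<lambda>(E, R). weight_change d \<delta> v R) \<le>
     real d * lam - mean_hits d U \<delta> v / (2 * real d) - (if \<delta> v \<le> d - 2 then 1 / real d else 0)"
    and "0 \<le> mean_hits d U \<delta> v" "mean_hits d U \<delta> v \<le> \<delta> v"
proof -
  let ?G = "degree_graphs U \<delta>"
  note finG = finite_degree_graphs[OF assms(1), of \<delta>]
  define H where "H = mean_hits d U \<delta> v"
  show H0: "0 \<le> mean_hits d U \<delta> v" unfolding mean_hits_def by (intro expect_nonneg) auto
  have setG: "set_pmf (pmf_of_set ?G) = ?G" using finG assms(2) by simp
  have "mean_hits d U \<delta> v \<le> expect (pmf_of_set ?G) (\<lambda>_. real (\<delta> v))" unfolding mean_hits_def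
  proof (rule expect_mono)
    fix E assume "E \<in> set_pmf (pmf_of_set ?G)"
    then have "E \<in> ?G" using setG by auto
    from hits_le[OF assms(1) this assms(3-5)]
    show "real (hits d \<delta> E v) \<le> real (\<delta> v)" by simp
  qed (use setG finG in auto)
  then show H1: "mean_hits d U \<delta> v \<le> \<delta> v" by simp
  have "expect (exposure p U \<delta> v) (\<lambda>(E, R). weight_change d \<delta> v R) =
    expect (pmf_of_set ?G) (\<lambda>E. expect (percolation p (touch E {v})) (\<lambda>R. weight_change d \<delta> v R))"
    by (simp add: exposure_facts(3)[OF assms(1,2)])
  also have "\<dots> = expect (pmf_of_set ?G) (\<lambda>E. p * (real d * \<delta> v - hits d \<delta> E v) - (real (\<delta> v) + 1))"
  proof (rule expect_cong)
    fix E assume "E \<in> set_pmf (pmf_of_set ?G)"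
    then have E: "E \<in> ?G" using setG by auto
    then have EU: "E \<subseteq> all_edges U" by (simp add: degree_graphs_def)
    then have "finite (touch E {v})" using assms(1) finite_all_edges finite_touch_strip finite_subset by metis
    then show "expect (percolation p (touch E {v})) (\<lambda>R. weight_change d \<delta> v R) = p * (real d * \<delta> v - hits d \<delta> E v) - (real (\<delta> v) + 1)"
      unfolding weight_change_def
      by (subst expect_diff) (auto simp: set_percolation(2) expect_sum_nxt[OF assms(1) EU assms(7,8)] sum_nb_eq[OF assms(1) E assms(3-5)])
  qed
  also have "\<dots> = p * (real d * \<delta> v - H) - (real (\<delta> v) + 1)"
    using finG setG by (simp add: expect_diff H_def mean_hits_def)
  also have "\<dots> \<le> real d * lam - H / (2 * real d) - (if real (\<delta> v) \<le> real d - 2 then 1 / real d else 0)"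
  proof (rule drift_le)
    show "real (\<delta> v) \<le> real d - 2 \<or> real (\<delta> v) = real d - 1"
    proof -
      have "\<delta> v \<le> d - 2 \<or> \<delta> v = d - 1" using assms(4,6) by linarith
      then show ?thesis using assms(6) by (auto simp: of_nat_diff)
    qed
  qed (use assms H0 H1 in \<open>auto simp: H_def\<close>)
  also have "real (\<delta> v) \<le> real d - 2 \<longleftrightarrow> \<delta> v \<le> d - 2"
    using assms(6) by (metis of_nat_diff of_nat_le_iff of_nat_numeral add_leE numeral_3_eq_3 numeral_2_eq_2 Suc_leD)
  finally show "expect (exposure p U \<delta> v) (\<lambda>(E, R). weight_change d \<delta> v R) \<le>
     real d * lam - mean_hits d U \<delta> v / (2 * real d) - (if \<delta> v \<le> d - 2 then 1 / real d else 0)"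
    by (simp add: H_def)
qed

section \<open>The exploration of the random regular graph as a Markov chain\<close>

definition regular_kernel :: "real \<Rightarrow> 'a::linorder set \<times> ('a \<Rightarrow> nat) \<times> 'a set \<Rightarrow> ('a set \<times> ('a \<Rightarrow> nat) \<times> 'a set) pmf" where
  "regular_kernel p = (\<lambda>(U, \<delta>, Q). map_pmf (\<lambda>(E, R).
     (U - {Min Q}, reduce \<delta> E (Min Q), Q - {Min Q} \<union> nxt R {Min Q})) (exposure p U \<delta> (Min Q)))"

definition regular_alive :: "real \<Rightarrow> nat \<Rightarrow> 'a::linorder set \<times> ('a \<Rightarrow> nat) \<times> 'a set \<Rightarrow> real" where
  "regular_alive p k = (\<lambda>(U, \<delta>, Q). expect (pmf_of_set (degree_graphs U \<delta>))
     (\<lambda>E. measure_pmf.prob (percolation p E) {H. alive k H Q}))"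

definition regular_inv :: "nat \<Rightarrow> nat \<Rightarrow> 'a set \<times> ('a \<Rightarrow> nat) \<times> 'a set \<Rightarrow> bool" where
  "regular_inv n d = (\<lambda>(U, \<delta>, Q). finite U \<and> card U \<le> n \<and> degree_graphs U \<delta> \<noteq> {} \<and> Q \<subseteq> U \<and>
     (\<forall>u\<in>U. \<delta> u \<le> d) \<and> (\<forall>u\<in>Q. \<delta> u < d))"

lemma expect_swap:
  assumes "finite (set_pmf M)" "finite (set_pmf N)"
  shows "expect M (\<lambda>x. expect N (\<lambda>y. f x y)) = expect N (\<lambda>y. expect M (\<lambda>x. f x y))"
  using expect_pair[OF assms, of "\<lambda>(x, y). f x y"] expect_pair[OF assms(2,1), of "\<lambda>(y, x). f x y"]
  by (subst (asm) pair_commute_pmf) (simp add: case_prod_unfold)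

text \<open>The edges at the processed vertex are exposed, the rest of the graph is redrawn, and the
  percolation of the exposed edges is interchanged with the choice of the rest.\<close>

lemma regular_alive_Suc:
  assumes "finite U" "degree_graphs U \<delta> \<noteq> {}" "Q \<noteq> {}" "Q \<subseteq> U"
  shows "regular_alive p (Suc k) (U, \<delta>, Q) = expect (regular_kernel p (U, \<delta>, Q)) (regular_alive p k)"
proof -
  define v where "v = Min Q"
  have v: "v \<in> U" using Min_in[of Q] assms finite_subset unfolding v_def by blast
  let ?G = "degree_graphs U \<delta>"
  let ?G' = "\<lambda>E. degree_graphs (U - {v}) (reduce \<delta> E v)"
  let ?f = "\<lambda>A E. expect (percolation p A) (\<lambda>R. measure_pmf.prob (percolation p E) {H. alive k H (Q - {v} \<union> nxt R {v})})"
  have finG: "finite ?G" by (rule finite_degree_graphs[OF assms(1)])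
  have fin: "finite E" if "E \<in> ?G" for E
    using that assms finite_all_edges finite_subset by (metis (no_types, lifting) degree_graphs_def mem_Collect_eq)
  have "regular_alive p (Suc k) (U, \<delta>, Q) = expect (pmf_of_set ?G) (\<lambda>E. ?f (touch E {v}) (strip E {v}))"
    unfolding regular_alive_def prod.case
  proof (rule expect_cong)
    fix E assume "E \<in> set_pmf (pmf_of_set ?G)"
    then have "finite E" using fin finG assms(2) by simp
    then show "measure_pmf.prob (percolation p E) {H. alive (Suc k) H Q} = ?f (touch E {v}) (strip E {v})"
      unfolding v_def by (rule prob_alive_Suc[OF _ assms(3)])
  qed
  also have "\<dots> = expect (pmf_of_set ?G) (\<lambda>E. expect (pmf_of_set (?G' E)) (?f (touch E {v})))"
    unfolding reduce_def by (rule expect_degree_graphs_expose[OF assms(1,2) v])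
  also have "\<dots> = expect (pmf_of_set ?G) (\<lambda>E. expect (percolation p (touch E {v}))
      (\<lambda>R. regular_alive p k (U - {v}, reduce \<delta> E v, Q - {v} \<union> nxt R {v})))"
  proof (rule expect_cong)
    fix E assume "E \<in> set_pmf (pmf_of_set ?G)"
    then have E: "E \<in> ?G" using finG assms(2) by simp
    have "strip E {v} \<in> ?G' E" using strip_degree_graphs[OF assms(1) E v] by (simp add: reduce_def)
    then have "finite (set_pmf (pmf_of_set (?G' E)))"
      using finite_degree_graphs[of "U - {v}" "reduce \<delta> E v"] assms(1) by (subst set_pmf_of_set) auto
    moreover have "finite (set_pmf (percolation p (touch E {v})))"
      using set_percolation(2) finite_touch_strip(1) fin[OF E] by metis
    ultimately show "expect (pmf_of_set (?G' E)) (?f (touch E {v})) = expect (percolation p (touch E {v}))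
      (\<lambda>R. regular_alive p k (U - {v}, reduce \<delta> E v, Q - {v} \<union> nxt R {v}))"
      unfolding regular_alive_def prod.case by (rule expect_swap)
  qed
  also have "\<dots> = expect (regular_kernel p (U, \<delta>, Q)) (regular_alive p k)"
    by (simp add: regular_kernel_def v_def[symmetric] exposure_facts(3)[OF assms(1,2)] case_prod_unfold)
  finally show ?thesis .
qed

text \<open>Reduced degree is demanded of the active vertices other than \<open>Min Q\<close> only,
  so that the step from a root of full degree \<open>d\<close> also leads into
  \<open>regular_inv\<close>.\<close>

lemma regular_kernel_step:
  assumes "finite U" "card U \<le> n" "degree_graphs U \<delta> \<noteq> {}" "Q \<noteq> {}" "Q \<subseteq> U"
    "\<forall>u\<in>U. \<delta> u \<le> d" "\<forall>u\<in>Q - {Min Q}. \<delta> u < d" "0 < d" "s' \<in> set_pmf (regular_kernel p (U, \<delta>, Q))"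
  shows "regular_inv n d s'" "card (fst s') = card U - 1" "0 < card U"
    "card (snd (snd s')) \<le> card Q - 1 + \<delta> (Min Q)"
proof -
  define v where "v = Min Q"
  have finQ: "finite Q" using assms finite_subset by metis
  have vQ: "v \<in> Q" unfolding v_def using Min_in[OF finQ assms(4)] .
  have v: "v \<in> U" using vQ assms by blast
  then show cU: "0 < card U" using assms(1) by (auto simp: card_gt_0_iff)
  obtain E R where ER: "E \<in> degree_graphs U \<delta>" "R \<subseteq> touch E {v}"
    and s': "s' = (U - {v}, reduce \<delta> E v, Q - {v} \<union> nxt R {v})"
  proof -
    obtain E R where "(E, R) \<in> set_pmf (exposure p U \<delta> v)"
      and "s' = (U - {v}, reduce \<delta> E v, Q - {v} \<union> nxt R {v})"
      using assms(9) by (auto simp: regular_kernel_def v_def)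
    then show ?thesis using exposure_facts(2)[OF assms(1,3)] that by blast
  qed
  have EU: "E \<subseteq> all_edges U" using ER by (simp add: degree_graphs_def)
  have n: "nxt R {v} \<subseteq> nb E v" using edges_star_nxt(2)[OF EU ER(2)] .
  have nU: "nb E v \<subseteq> U - {v}"
  proof
    fix u assume "u \<in> nb E v"
    then show "u \<in> U - {v}" using all_edges_doubleton[OF EU, of v u] by auto
  qed
  have pos: "1 \<le> \<delta> u" if u: "u \<in> nb E v" for u
  proof -
    have "v \<in> nb E u" using u by (simp add: insert_commute)
    then have "0 < card (nb E u)" using finite_nb[OF EU assms(1), of u] by (auto simp: card_gt_0_iff)
    then show ?thesis using card_nb[OF EU, of u] ER(1) u nU by (auto simp: degree_graphs_def)
  qed
  have "\<forall>u\<in>Q - {v} \<union> nxt R {v}. reduce \<delta> E v u < d"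
  proof
    fix u assume u: "u \<in> Q - {v} \<union> nxt R {v}"
    show "reduce \<delta> E v u < d"
    proof (cases "u \<in> nb E v")
      case True
      then have "1 \<le> \<delta> u" "\<delta> u \<le> d" using pos nU assms(6) by blast+
      then show ?thesis using True by (auto simp: reduce_def)
    next
      case False
      then have "\<delta> u < d" using u n assms(7) v_def by blast
      then show ?thesis by (simp add: reduce_def less_imp_diff_less)
    qed
  qed
  moreover have "strip E {v} \<in> degree_graphs (U - {v}) (reduce \<delta> E v)"
    using strip_degree_graphs[OF assms(1) ER(1) v] by (simp add: reduce_def)
  moreover have "\<forall>u\<in>U - {v}. reduce \<delta> E v u \<le> d" using assms(6) by (auto simp: reduce_def intro: le_trans)
  ultimately show "regular_inv n d s'"
    unfolding s' regular_inv_def using n nU assms(1,2,5) v by (auto simp: card_Diff_singleton_if)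
  show "card (fst s') = card U - 1" using v assms(1) by (simp add: s')
  have "card (nxt R {v}) \<le> card (nb E v)" using n finite_nb[OF EU assms(1)] by (intro card_mono) auto
  also have "\<dots> = \<delta> v" using card_nb[OF EU] ER(1) v by (simp add: degree_graphs_def)
  finally have "card (nxt R {v}) \<le> \<delta> v" .
  moreover have "card (Q - {v} \<union> nxt R {v}) \<le> card (Q - {v}) + card (nxt R {v})" by (rule card_Un_le)
  ultimately show "card (snd (snd s')) \<le> card Q - 1 + \<delta> (Min Q)"
    using vQ finQ by (simp add: s' v_def)
qed

text \<open>Without hits \<open>seen\<close> grows at least as fast as time, apart from steps at
  vertices with few remaining edges; a shortage at time \<open>T\<close> thus needs hits or such
  steps, and both decrease the weight. The ratio \<open>2 d^2\<close> of the two coefficients makes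
  the effect of a hit on the weight cancel its effect on \<open>seen\<close>. If
  \<open>T \<ge> t\<close> and \<open>seen < T / 2\<close>, the exponent is nonnegative, so the
  value is at least 1.\<close>

definition regular_bad :: "nat \<Rightarrow> nat \<Rightarrow> nat \<Rightarrow> 'a set \<times> ('a \<Rightarrow> nat) \<times> 'a set \<Rightarrow> real" where
  "regular_bad n d t = (\<lambda>(U, \<delta>, Q). exp ((1 / (16 * real d ^ 6)) * weight \<delta> Q
     + (1 / (32 * real d ^ 8)) * (real (n - card U) - real t / 2 - seen d U \<delta>)))"

lemma expect_regular_kernel_N:
  assumes "regular_inv n d (U, \<delta>, Q)" "Q \<noteq> {}" "3 \<le> d" "0 \<le> p" "p \<le> 1" "p * (real d - 1) \<le> 1 + lam"
    "0 \<le> lam" "lam \<le> 1" "0 \<le> x" "x \<le> 1/2"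
  shows "(1 - x) ^ card Q * (1 + x\<^sup>2 / 4 - 2 * lam * x) \<le>
     expect (regular_kernel p (U, \<delta>, Q)) (\<lambda>(U, \<delta>, Q). (1 - x) ^ card Q)"
proof -
  define v where "v = Min Q"
  have I: "finite U" "degree_graphs U \<delta> \<noteq> {}" "Q \<subseteq> U" "finite Q"
    and \<delta>: "\<And>u. u \<in> U \<Longrightarrow> \<delta> u \<le> d" "\<And>u. u \<in> Q \<Longrightarrow> \<delta> u < d"
    using assms(1) finite_subset by (auto simp: regular_inv_def)
  have vQ: "v \<in> Q" unfolding v_def using Min_in[OF I(4) assms(2)] .
  have v: "v \<in> U" using vQ I by blast
  have finG: "finite (degree_graphs U \<delta>)" by (rule finite_degree_graphs[OF I(1)])
  let ?A = "(1 - x) ^ card Q * (1 + x\<^sup>2 / 4 - 2 * lam * x)"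
  have "?A = expect (pmf_of_set (degree_graphs U \<delta>)) (\<lambda>_. ?A)" by simp
  also have "\<dots> \<le> expect (pmf_of_set (degree_graphs U \<delta>)) (\<lambda>E. expect (percolation p (touch E {v}))
      (\<lambda>R. (1 - x) ^ card (Q - {v} \<union> nxt R {v})))"
  proof (rule expect_mono)
    fix E assume "E \<in> set_pmf (pmf_of_set (degree_graphs U \<delta>))"
    then have E: "E \<in> degree_graphs U \<delta>" using finG I by simp
    then have EU: "E \<subseteq> all_edges U" by (simp add: degree_graphs_def)
    have finE: "finite E" using EU I(1) finite_all_edges finite_subset by metis
    note finF = finite_touch_strip(1)[OF finE, of "{v}"]
    show "?A \<le> expect (percolation p (touch E {v})) (\<lambda>R. (1 - x) ^ card (Q - {v} \<union> nxt R {v}))"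
    proof (rule expect_active_ge[of "d - 1"])
      have "card (touch E {v}) \<le> vertex_degree E v * card {v}"
        using finE by (intro card_touch_le) auto
      also have "\<dots> = \<delta> v" using E v by (simp add: degree_graphs_def)
      finally show "card (touch E {v}) \<le> d - 1" using \<delta>(2)[OF vQ] by linarith
      show "card (Q - {v} \<union> nxt R {v}) \<le> card Q - 1 + card R" if "R \<subseteq> touch E {v}" for R
        using card_explore_le[OF I(4) vQ finite_subset[OF that finF]] .
      show "p * real (d - 1) \<le> 1 + lam" using assms by (simp add: of_nat_diff)
    qed (use assms finF I in \<open>auto simp: card_gt_0_iff\<close>)
  qed (use finG I in auto)
  also have "\<dots> = expect (regular_kernel p (U, \<delta>, Q)) (\<lambda>(U, \<delta>, Q). (1 - x) ^ card Q)"
    by (simp add: regular_kernel_def v_def[symmetric] exposure_facts(3)[OF I(1,2)] case_prod_unfold)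
  finally show ?thesis .
qed

lemma expect_regular_kernel_weight:
  assumes "regular_inv n d (U, \<delta>, Q)" "Q \<noteq> {}" "0 \<le> a" "a * real d ^ 2 \<le> 1"
  shows "expect (regular_kernel p (U, \<delta>, Q)) (\<lambda>(U, \<delta>, Q). exp (a * weight \<delta> Q)) \<le>
     exp (a * expect (exposure p U \<delta> (Min Q)) (\<lambda>(E, R). weight_change d \<delta> (Min Q) R) + a\<^sup>2 * real d ^ 4)
       * exp (a * weight \<delta> Q)"
proof -
  define v where "v = Min Q"
  have I: "finite U" "degree_graphs U \<delta> \<noteq> {}" "Q \<subseteq> U" "finite Q"
    and \<delta>: "\<And>u. u \<in> U \<Longrightarrow> \<delta> u \<le> d" "\<And>u. u \<in> Q \<Longrightarrow> \<delta> u < d"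
    using assms(1) finite_subset by (auto simp: regular_inv_def)
  have vQ: "v \<in> Q" unfolding v_def using Min_in[OF I(4) assms(2)] .
  have v: "v \<in> U" using vQ I by blast
  note ef = exposure_facts[OF I(1,2), where p = p and v = v]
  let ?c = "\<lambda>(E :: 'a set set, R). weight_change d \<delta> v R"
  have "expect (regular_kernel p (U, \<delta>, Q)) (\<lambda>(U, \<delta>, Q). exp (a * weight \<delta> Q)) =
    expect (exposure p U \<delta> v) (\<lambda>(E, R). exp (a * weight (reduce \<delta> E v) (Q - {v} \<union> nxt R {v})))"
    by (simp add: regular_kernel_def v_def[symmetric] case_prod_unfold)
  also have "\<dots> \<le> expect (exposure p U \<delta> v) (\<lambda>x. exp (a * weight \<delta> Q) * exp (a * ?c x))"
  proof (rule expect_mono[OF ef(1)])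
    fix x assume x: "x \<in> set_pmf (exposure p U \<delta> v)"
    obtain E R where [simp]: "x = (E, R)" by (cases x)
    have ER: "E \<in> degree_graphs U \<delta>" "R \<subseteq> touch E {v}" using ef(2)[of E R] x by auto
    have "a * real (weight (reduce \<delta> E v) (Q - {v} \<union> nxt R {v})) \<le> a * (real (weight \<delta> Q) + weight_change d \<delta> v R)"
      using weight_step[OF I(1) ER(1) v \<delta>(2)[OF vQ] \<delta>(1) ER(2) vQ I(3)] assms(3) by (intro mult_left_mono) auto
    then show "(\<lambda>(E, R). exp (a * real (weight (reduce \<delta> E v) (Q - {v} \<union> nxt R {v})))) x \<le> exp (a * weight \<delta> Q) * exp (a * ?c x)"
      by (simp add: mult_exp_exp distrib_left)
  qed
  also have "\<dots> = exp (a * weight \<delta> Q) * expect (exposure p U \<delta> v) (\<lambda>x. exp (a * ?c x))" by simp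
  also have "\<dots> \<le> exp (a * weight \<delta> Q) * exp (expect (exposure p U \<delta> v) (\<lambda>x. a * ?c x) + (a * real d ^ 2)\<^sup>2)"
  proof (intro mult_left_mono expect_exp_le[OF ef(1) _ assms(4)])
    fix x assume x: "x \<in> set_pmf (exposure p U \<delta> v)"
    obtain E R where [simp]: "x = (E, R)" by (cases x)
    have ER: "E \<in> degree_graphs U \<delta>" "R \<subseteq> touch E {v}" using ef(2)[of E R] x by auto
    show "\<bar>a * ?c x\<bar> \<le> a * real d ^ 2"
      using weight_change_bounds[OF I(1) ER(1) v \<delta>(2)[OF vQ] \<delta>(1) ER(2)] assms(3)
      by (simp add: abs_mult mult_left_mono)
  qed auto
  finally show ?thesis by (simp add: v_def mult.commute power_mult_distrib flip: power_mult)
qed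

lemma expect_regular_kernel_bad:
  assumes "regular_inv n d (U, \<delta>, Q)" "Q \<noteq> {}" "3 \<le> d" "0 \<le> p" "p \<le> 1" "p * (real d - 1) \<le> 1 + lam"
    "0 \<le> lam" "lam \<le> 1 / (4 * real d ^ 3)"
  shows "expect (regular_kernel p (U, \<delta>, Q)) (regular_bad n d t) \<le> regular_bad n d t (U, \<delta>, Q)"
proof -
  define v where "v = Min Q"
  define a where "a = 1 / (16 * real d ^ 6)"
  define b where "b = 1 / (32 * real d ^ 8)"
  have d: "3 \<le> real d" using assms by simp
  have ab: "a = 2 * real d ^ 2 * b" "0 < a" "0 < b" using d by (auto simp: a_def b_def eval_nat_numeral)
  have I: "finite U" "card U \<le> n" "degree_graphs U \<delta> \<noteq> {}" "Q \<subseteq> U" "finite Q"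
    and \<delta>: "\<And>u. u \<in> U \<Longrightarrow> \<delta> u \<le> d" "\<And>u. u \<in> Q \<Longrightarrow> \<delta> u < d"
    using assms(1) finite_subset by (auto simp: regular_inv_def)
  have vQ: "v \<in> Q" unfolding v_def using Min_in[OF I(5) assms(2)] .
  have v: "v \<in> U" using vQ I by blast
  have vd: "\<delta> v < d" using \<delta>(2)[OF vQ] .
  note ef = exposure_facts[OF I(1,3), where p = p and v = v]
  have cU: "0 < card U" using v I(1) by (auto simp: card_gt_0_iff)
  have nU: "real (n - card (U - {v})) = real (n - card U) + 1"
    using v I(1,2) cU by (simp add: of_nat_diff)
  define c where "c = (\<lambda>(E :: 'a set set, R). a * weight_change d \<delta> v R
     + (b - b * ((real d - 2) * \<delta> v) + b * real d * hits d \<delta> E v))"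
  have "expect (regular_kernel p (U, \<delta>, Q)) (regular_bad n d t) =
    expect (exposure p U \<delta> v) (\<lambda>(E, R). regular_bad n d t (U - {v}, reduce \<delta> E v, Q - {v} \<union> nxt R {v}))"
    by (simp add: regular_kernel_def v_def[symmetric] case_prod_unfold)
  also have "\<dots> \<le> expect (exposure p U \<delta> v) (\<lambda>x. regular_bad n d t (U, \<delta>, Q) * exp (c x))"
  proof (rule expect_mono[OF ef(1)])
    fix x assume x: "x \<in> set_pmf (exposure p U \<delta> v)"
    obtain E R where [simp]: "x = (E, R)" by (cases x)
    have ER: "E \<in> degree_graphs U \<delta>" "R \<subseteq> touch E {v}" using ef(2)[of E R] x by auto
    have w: "a * real (weight (reduce \<delta> E v) (Q - {v} \<union> nxt R {v})) \<le> a * (real (weight \<delta> Q) + weight_change d \<delta> v R)"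
      using weight_step[OF I(1) ER(1) v vd \<delta>(1) ER(2) vQ I(4)] ab by (intro mult_left_mono) auto
    have s: "real (seen d (U - {v}) (reduce \<delta> E v)) =
        real (seen d U \<delta>) + ((real d - 2) * \<delta> v - real d * hits d \<delta> E v)"
      by (rule seen_step[OF I(1) ER(1) v vd \<delta>(1)])
    have "a * real (weight (reduce \<delta> E v) (Q - {v} \<union> nxt R {v}))
        + b * (real (n - card (U - {v})) - real t / 2 - seen d (U - {v}) (reduce \<delta> E v))
      \<le> a * weight \<delta> Q + b * (real (n - card U) - real t / 2 - seen d U \<delta>) + c x"
      using w unfolding nU s c_def by (simp add: algebra_simps)
    then show "(\<lambda>(E, R). regular_bad n d t (U - {v}, reduce \<delta> E v, Q - {v} \<union> nxt R {v})) x
       \<le> regular_bad n d t (U, \<delta>, Q) * exp (c x)"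
      unfolding regular_bad_def a_def[symmetric] b_def[symmetric] by (simp add: mult_exp_exp)
  qed
  also have "\<dots> = regular_bad n d t (U, \<delta>, Q) * expect (exposure p U \<delta> v) (\<lambda>x. exp (c x))" by simp
  also have "\<dots> \<le> regular_bad n d t (U, \<delta>, Q) * 1"
  proof (rule mult_left_mono)
    \<comment> \<open>The increments of both summands of the exponent are at most
      \<open>a d^2\<close>. The powers of \<open>d\<close> in the coefficients are such that the
      second-order cost \<open>m^2\<close> equals \<open>b / 2\<close>.\<close>
    define m where "m = 2 * a * real d ^ 2"
    have d2: "9 \<le> real d ^ 2" using power_mono[OF d, of 2] by simp
    have bnd: "\<bar>c x\<bar> \<le> m" if x: "x \<in> set_pmf (exposure p U \<delta> v)" for x
    proof -
      obtain E R where [simp]: "x = (E, R)" by (cases x)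
      have ER: "E \<in> degree_graphs U \<delta>" "R \<subseteq> touch E {v}" using ef(2)[of E R] x by auto
      have 1: "\<bar>a * weight_change d \<delta> v R\<bar> \<le> a * real d ^ 2"
        using weight_change_bounds[OF I(1) ER(1) v vd \<delta>(1) ER(2)] ab by (simp add: abs_mult mult_left_mono)
      have h: "real (hits d \<delta> E v) \<le> real d" using hits_le[OF I(1) ER(1) v vd \<delta>(1)] vd by simp
      have "real d * hits d \<delta> E v \<le> real d * real d" using h by (intro mult_left_mono) auto
      then have 2: "real d * hits d \<delta> E v \<le> real d ^ 2" by (simp add: power2_eq_square)
      have "(real d - 2) * \<delta> v \<le> real d * real d" using vd d by (intro mult_mono) auto
      then have 3: "(real d - 2) * \<delta> v \<le> real d ^ 2" by (simp add: power2_eq_square)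
      have 4: "0 \<le> (real d - 2) * \<delta> v" using d by simp
      have "\<bar>1 - (real d - 2) * \<delta> v + real d * hits d \<delta> E v\<bar> \<le> 1 + real d ^ 2"
        using 2 3 4 by (simp add: abs_le_iff) (smt (verit) of_nat_0_le_iff mult_nonneg_nonneg)
      then have "\<bar>b * (1 - (real d - 2) * \<delta> v + real d * hits d \<delta> E v)\<bar> \<le> b * (1 + real d ^ 2)"
        using ab by (simp add: abs_mult)
      also have "\<dots> \<le> b * (2 * real d ^ 2 * real d ^ 2)"
      proof (rule mult_left_mono)
        have "1 * real d ^ 2 \<le> real d ^ 2 * real d ^ 2" using d2 by (intro mult_right_mono) auto
        then show "1 + real d ^ 2 \<le> 2 * real d ^ 2 * real d ^ 2" using d2 by linarith
      qed (use ab in simp)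
      also have "\<dots> = a * real d ^ 2" by (simp add: ab(1))
      finally have 5: "\<bar>b - b * ((real d - 2) * \<delta> v) + b * real d * hits d \<delta> E v\<bar> \<le> a * real d ^ 2"
        by (simp add: algebra_simps)
      show ?thesis using abs_triangle_ineq[of "a * weight_change d \<delta> v R" "b - b * ((real d - 2) * \<delta> v) + b * real d * hits d \<delta> E v"] 1 5
        by (simp add: c_def m_def)
    qed
    have m2: "m\<^sup>2 = b / 2"
      using d by (simp add: m_def a_def b_def power2_eq_square field_simps eval_nat_numeral)
    have m1: "m \<le> 1"
    proof -
      have "1 \<le> real d ^ 4" using d by (simp add: one_le_power)
      then show ?thesis using d by (simp add: m_def a_def divide_simps eval_nat_numeral)
    qed
    note ec = expect_weight_change[OF I(1,3) v vd \<delta>(1) assms(3-7)]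
    let ?W = "expect (exposure p U \<delta> v) (\<lambda>(E, R). weight_change d \<delta> v R)"
    define H where "H = mean_hits d U \<delta> v"
    have "expect (exposure p U \<delta> v) c = a * ?W + (b - b * ((real d - 2) * \<delta> v) + b * real d * H)"
    proof -
      have "expect (exposure p U \<delta> v) (\<lambda>(E, R). real (hits d \<delta> E v)) = H"
        unfolding H_def mean_hits_def ef(3) by simp
      then show ?thesis unfolding c_def case_prod_unfold
        by (simp add: expect_add[OF ef(1)] expect_diff[OF ef(1)])
    qed
    \<comment> \<open>The hits cancel. Time adds \<open>b\<close> and the growth at most
      \<open>b / 2\<close>, while at least \<open>2 b\<close> is gained: through \<open>seen\<close>
      if \<open>v\<close> has its \<open>d - 1\<close> edges, through the weight otherwise. The
      surplus \<open>b / 2\<close> pays exactly for \<open>m^2\<close>.\<close>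
    also have "\<dots> \<le> - b / 2"
    proof -
      have "a * ?W \<le> a * (real d * lam - H / (2 * real d) - (if \<delta> v \<le> d - 2 then 1 / real d else 0))"
        using ec(1) ab unfolding H_def by (intro mult_left_mono) auto
      also have "\<dots> = a * real d * lam - b * real d * H - (if \<delta> v \<le> d - 2 then 2 * real d * b else 0)"
        using d by (simp add: ab(1) field_simps power2_eq_square)
      finally have 1: "a * ?W \<le> \<dots>" .
      have "a * real d * lam \<le> a * real d * (1 / (4 * real d ^ 3))"
        using assms(8) ab d by (intro mult_left_mono) auto
      also have "\<dots> = b / 2" using d by (simp add: ab(1) field_simps eval_nat_numeral)
      finally have 2: "a * real d * lam \<le> b / 2" .
      have 3: "2 * b \<le> b * ((real d - 2) * \<delta> v) + (if \<delta> v \<le> d - 2 then 2 * real d * b else 0)"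
      proof (cases "\<delta> v \<le> d - 2")
        case True
        have "1 * b \<le> real d * b" using d ab by (intro mult_right_mono) auto
        moreover have "0 \<le> b * ((real d - 2) * \<delta> v)" using d ab by simp
        ultimately show ?thesis using True by simp
      next
        case False
        have "2 \<le> real (\<delta> v)" using False assms(3) by linarith
        then have "1 * 2 \<le> (real d - 2) * \<delta> v" using d by (intro mult_mono) auto
        then have "b * 2 \<le> b * ((real d - 2) * \<delta> v)" using ab by (intro mult_left_mono) auto
        then show ?thesis using False by simp
      qed
      show ?thesis using 1 2 3 by linarith
    qed
    finally have "expect (exposure p U \<delta> v) c + m\<^sup>2 \<le> 0" using m2 by simp
    then have "exp (expect (exposure p U \<delta> v) c + m\<^sup>2) \<le> 1" by simp
    then show "expect (exposure p U \<delta> v) (\<lambda>x. exp (c x)) \<le> 1"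
      using expect_exp_le[of "exposure p U \<delta> v" c m, OF ef(1) bnd m1] by linarith
  qed (simp add: regular_bad_def case_prod_unfold)
  finally show ?thesis by simp
qed

text \<open>In a good state a vertex with \<open>d - 1\<close> edges has on average of order
  \<open>y\<close> hits by switching, and one with fewer edges has negative drift anyway.
  \<open>regular_bad\<close> plays the part of \<open>B\<close> for the states in which switching is
  not effective.\<close>

lemma regular_exploration:
  fixes n d t :: nat and lam p b :: real
  defines "y \<equiv> real t / real n"
  defines "a \<equiv> y / (64 * real d ^ 6)"
  assumes d: "3 \<le> d" and p: "0 \<le> p" "p \<le> 1" "p * (real d - 1) \<le> 1 + lam"
    and lam: "0 \<le> lam" "lam \<le> a" "lam \<le> 1 / (4 * real d ^ 3)"
    and y: "y \<le> 1" and t: "16 * d\<^sup>2 \<le> t"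
    and b: "32 * lam \<le> b" "0 < b" "b \<le> 1/2" "1 \<le> real t * b\<^sup>2"
  shows "exploration (regular_kernel p) (regular_alive p :: nat \<Rightarrow> 'a::linorder set \<times> _ \<Rightarrow> real) (regular_inv n d)
    (\<lambda>(U, \<delta>, Q). real (n - card U) / 2 \<le> real (seen d U \<delta>))
    (\<lambda>(U, \<delta>, Q). card Q) (\<lambda>(U, \<delta>, Q). n - card U) (\<lambda>(U, \<delta>, Q). real (weight \<delta> Q)) (regular_bad n d t)
    a (2 * a\<^sup>2 * real d ^ 4) (6 * a\<^sup>2 * real d ^ 4) lam b (16 * a * real d ^ 2) t"
proof -
  have dr: "3 \<le> real d" using d by simp
  have d1: "1 \<le> real d ^ k" for k using dr by (simp add: one_le_power)
  have y0: "0 \<le> y" by (simp add: y_def)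
  have a0: "0 \<le> a" using y0 by (simp add: a_def)
  have ya: "y = 64 * a * real d ^ 6" using dr by (simp add: a_def)
  have ad: "a * real d ^ 2 \<le> 1 / 64"
  proof -
    have "a * real d ^ 2 * 1 \<le> a * real d ^ 2 * real d ^ 4" using d1 a0 by (intro mult_left_mono) auto
    also have "\<dots> = y / 64" by (simp add: ya flip: power_add)
    finally show ?thesis using y by simp
  qed
  have a1: "a * real d ^ 2 \<le> 1" using ad by simp
  have lam1: "lam \<le> 1"
  proof -
    have "a * 1 \<le> a * real d ^ 2" using d1[of 2] a0 by (intro mult_left_mono) auto
    then show ?thesis using lam(2) a1 by linarith
  qed
  have dd: "real d \<le> real d ^ 4" using power_increasing[of 1 4 "real d"] dr by simp
  have alam: "a * (real d * lam) \<le> a\<^sup>2 * real d ^ 4"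
  proof -
    have "a * (real d * lam) \<le> a * (real d ^ 4 * a)" using lam dd a0 by (intro mult_left_mono mult_mono) auto
    then show ?thesis by (simp add: power2_eq_square mult_ac)
  qed
  have weight: "expect (regular_kernel p (U, \<delta>, Q)) (\<lambda>(U, \<delta>, Q). exp (a * weight \<delta> Q)) \<le>
     exp (a * (real d * lam - mean_hits d U \<delta> (Min Q) / (2 * real d) - (if \<delta> (Min Q) \<le> d - 2 then 1 / real d else 0)) + a\<^sup>2 * real d ^ 4)
       * exp (a * weight \<delta> Q)"
    "0 \<le> mean_hits d U \<delta> (Min Q)" "Min Q \<in> U" "\<delta> (Min Q) < d"
    if I: "regular_inv n d (U, \<delta>, Q)" and Q: "Q \<noteq> {}" for U and \<delta> :: "'a \<Rightarrow> nat" and Q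
  proof -
    have J: "finite U" "degree_graphs U \<delta> \<noteq> {}" "Q \<subseteq> U" "finite Q" "\<And>u. u \<in> U \<Longrightarrow> \<delta> u \<le> d" "\<And>u. u \<in> Q \<Longrightarrow> \<delta> u < d"
      using I finite_subset by (auto simp: regular_inv_def)
    have vQ: "Min Q \<in> Q" using Min_in[OF J(4) Q] .
    then show v: "Min Q \<in> U" "\<delta> (Min Q) < d" using J by blast+
    note ec = expect_weight_change[OF J(1,2) v J(5) d p lam(1)]
    show "0 \<le> mean_hits d U \<delta> (Min Q)" by (rule ec(2))
    have "expect (regular_kernel p (U, \<delta>, Q)) (\<lambda>(U, \<delta>, Q). exp (a * weight \<delta> Q)) \<le>
      exp (a * expect (exposure p U \<delta> (Min Q)) (\<lambda>(E, R). weight_change d \<delta> (Min Q) R) + a\<^sup>2 * real d ^ 4)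
       * exp (a * weight \<delta> Q)"
      by (rule expect_regular_kernel_weight[OF I Q a0 a1])
    also have "\<dots> \<le> exp (a * (real d * lam - mean_hits d U \<delta> (Min Q) / (2 * real d) - (if \<delta> (Min Q) \<le> d - 2 then 1 / real d else 0)) + a\<^sup>2 * real d ^ 4)
       * exp (a * weight \<delta> Q)"
      by (intro mult_right_mono iffD2[OF exp_le_cancel_iff] add_right_mono mult_left_mono ec(1) a0) auto
    finally show "expect (regular_kernel p (U, \<delta>, Q)) (\<lambda>(U, \<delta>, Q). exp (a * weight \<delta> Q)) \<le> \<dots>" .
  qed
  show ?thesis
  proof (unfold_locales, goal_cases)
    case (1 s)
    then show ?case
      by (cases s) (auto simp: regular_kernel_def regular_inv_def exposure_facts(1))
  next
    case (2 s s')
    obtain U \<delta> Q where s: "s = (U, \<delta>, Q)" by (cases s)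
    have I: "regular_inv n d (U, \<delta>, Q)" "Q \<noteq> {}" using 2 s by auto
    then have J: "finite U" "card U \<le> n" "degree_graphs U \<delta> \<noteq> {}" "Q \<subseteq> U"
      "\<forall>u\<in>U. \<delta> u \<le> d" "\<forall>u\<in>Q - {Min Q}. \<delta> u < d"
      by (auto simp: regular_inv_def)
    have "0 < d" using d by simp
    from regular_kernel_step(1-3)[OF J(1-3) I(2) J(4-6) this 2(3)[unfolded s]]
    show ?case using J(2) by (auto simp: s case_prod_unfold)
  next
    case (3 s k)
    obtain U \<delta> Q where s: "s = (U, \<delta>, Q)" by (cases s)
    have "expect (pmf_of_set (degree_graphs U \<delta>)) (\<lambda>E. measure_pmf.prob (percolation p E) {H. alive k H Q})
      \<le> expect (pmf_of_set (degree_graphs U \<delta>)) (\<lambda>_. 1)"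
      using 3 finite_degree_graphs[of U \<delta>] by (intro expect_mono) (auto simp: s regular_inv_def)
    then show ?case by (simp add: s regular_alive_def)
  next
    case (4 s k)
    obtain U \<delta> Q where s: "s = (U, \<delta>, Q)" by (cases s)
    then have "Q = {}" using 4 finite_subset by (fastforce simp: regular_inv_def)
    then show ?case by (simp add: s regular_alive_def)
  next
    case (5 s k)
    obtain U \<delta> Q where s: "s = (U, \<delta>, Q)" by (cases s)
    have "finite U" "degree_graphs U \<delta> \<noteq> {}" "Q \<noteq> {}" "Q \<subseteq> U" using 5 by (auto simp: s regular_inv_def)
    from regular_alive_Suc[OF this, of p k] show ?case by (simp add: s)
  next
    case (7 s)
    then show ?case by (simp add: regular_bad_def case_prod_unfold)
  next
    case (8 s x)
    obtain U \<delta> Q where s: "s = (U, \<delta>, Q)" by (cases s)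
    have I: "regular_inv n d (U, \<delta>, Q)" "Q \<noteq> {}" using 8 s by auto
    from expect_regular_kernel_N[OF I d p lam(1) lam1 8(3,4)]
    show ?case by (simp add: s case_prod_unfold)
  next
    case (9 s)
    obtain U \<delta> Q where s: "s = (U, \<delta>, Q)" by (cases s)
    have I: "regular_inv n d (U, \<delta>, Q)" "Q \<noteq> {}" using 9 s by auto
    note w = weight[OF I]
    have "expect (regular_kernel p (U, \<delta>, Q)) (\<lambda>(U, \<delta>, Q). exp (a * weight \<delta> Q)) \<le>
      exp (2 * a\<^sup>2 * real d ^ 4) * exp (a * weight \<delta> Q)"
    proof (rule order_trans[OF w(1)], intro mult_right_mono iffD2[OF exp_le_cancel_iff])
      have "0 \<le> mean_hits d U \<delta> (Min Q) / (2 * real d)" "0 \<le> (if \<delta> (Min Q) \<le> d - 2 then 1 / real d else 0)"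
        using w(2) by auto
      then have "a * (real d * lam - mean_hits d U \<delta> (Min Q) / (2 * real d) - (if \<delta> (Min Q) \<le> d - 2 then 1 / real d else 0)) \<le> a * (real d * lam)"
        by (intro mult_left_mono[OF _ a0]) linarith
      then show "a * (real d * lam - mean_hits d U \<delta> (Min Q) / (2 * real d) - (if \<delta> (Min Q) \<le> d - 2 then 1 / real d else 0)) + a\<^sup>2 * real d ^ 4
          \<le> 2 * a\<^sup>2 * real d ^ 4" using alam by linarith
    qed simp
    then show ?case by (simp add: s case_prod_unfold)
  next
    case (10 s)
    obtain U \<delta> Q where s: "s = (U, \<delta>, Q)" by (cases s)
    have I: "regular_inv n d (U, \<delta>, Q)" "Q \<noteq> {}" using 10 s by auto
    have J: "finite U" "degree_graphs U \<delta> \<noteq> {}" "\<And>u. u \<in> U \<Longrightarrow> \<delta> u \<le> d" "card U \<le> n"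
      using I by (auto simp: regular_inv_def)
    define T where "T = n - card U"
    have T: "t \<le> T" "real T / 2 \<le> real (seen d U \<delta>)" "T \<le> n" using 10 by (auto simp: s T_def)
    note w = weight[OF I]
    have dp: "0 < d" using d by simp
    have "0 < t" using t d by (metis dp less_le_trans nat_0_less_mult_iff zero_less_numeral zero_less_power)
    then have n: "0 < real n" using T by simp
    have H: "real (\<delta> (Min Q)) * real T \<le> mean_hits d U \<delta> (Min Q) * (8 * real d * real n)"
      using mean_hits_ge[OF J(1,2) w(3,4) J(3,4) T(2)] t T(1) by linarith
    have yT: "y \<le> real T / real n" using T n by (simp add: y_def divide_right_mono)
    \<comment> \<open>For \<open>\<delta> = d - 1\<close>, which is at least 2, the mean number of
      hits is at least \<open>2 T / (8 d n)\<close>, and each hit is worth \<open>1 / (2 d)\<close>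
      in the drift.\<close>
    have *: "y / (8 * real d ^ 2) \<le> mean_hits d U \<delta> (Min Q) / (2 * real d) + (if \<delta> (Min Q) \<le> d - 2 then 1 / real d else 0)"
    proof (cases "\<delta> (Min Q) \<le> d - 2")
      case True
      have "y * real d \<le> 1 * real d" using y by (intro mult_right_mono) auto
      also have "\<dots> \<le> 8 * real d ^ 2" using dr by (simp add: power2_eq_square)
      finally have "y / (8 * real d ^ 2) \<le> 1 / real d" using dr by (simp add: divide_simps)
      moreover have "0 \<le> mean_hits d U \<delta> (Min Q) / (2 * real d)" using w(2) by simp
      ultimately show ?thesis using True by simp
    next
      case False
      have "2 \<le> real (\<delta> (Min Q))" using False d by linarith
      then have "2 * real T \<le> real (\<delta> (Min Q)) * real T" by (intro mult_right_mono) auto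
      then have "2 * real T \<le> mean_hits d U \<delta> (Min Q) * (8 * real d * real n)" using H by linarith
      then have "real T / real n \<le> 4 * real d * mean_hits d U \<delta> (Min Q)"
        using n by (simp add: divide_simps mult_ac)
      then have "y \<le> 4 * real d * mean_hits d U \<delta> (Min Q)" using yT by linarith
      then have "y / (8 * real d ^ 2) \<le> (4 * real d * mean_hits d U \<delta> (Min Q)) / (8 * real d ^ 2)"
        by (rule divide_right_mono) simp
      also have "\<dots> = mean_hits d U \<delta> (Min Q) / (2 * real d)" using dr by (simp add: power2_eq_square)
      finally show ?thesis using False by simp
    qed
    have "expect (regular_kernel p (U, \<delta>, Q)) (\<lambda>(U, \<delta>, Q). exp (a * weight \<delta> Q)) \<le>
      exp (- (6 * a\<^sup>2 * real d ^ 4)) * exp (a * weight \<delta> Q)"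
    proof (rule order_trans[OF w(1)], intro mult_right_mono iffD2[OF exp_le_cancel_iff])
      have "a * (real d * lam - mean_hits d U \<delta> (Min Q) / (2 * real d) - (if \<delta> (Min Q) \<le> d - 2 then 1 / real d else 0))
         \<le> a * (real d * lam - y / (8 * real d ^ 2))"
        using * by (intro mult_left_mono[OF _ a0]) linarith
      also have "\<dots> = a * (real d * lam) - a * (y / (8 * real d ^ 2))" by (rule right_diff_distrib)
      \<comment> \<open>Here the factor \<open>64 d^6\<close> in the choice of \<open>a\<close> is
        used: the drift \<open>8 a^2 d^4\<close> exceeds by \<open>6 a^2 d^4\<close> the
        second-order and growth terms, each at most \<open>a^2 d^4\<close>.\<close>
      also have "a * (y / (8 * real d ^ 2)) = 8 * (a\<^sup>2 * real d ^ 4)"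
        using dr by (simp add: ya power2_eq_square field_simps eval_nat_numeral)
      finally show "a * (real d * lam - mean_hits d U \<delta> (Min Q) / (2 * real d) - (if \<delta> (Min Q) \<le> d - 2 then 1 / real d else 0)) + a\<^sup>2 * real d ^ 4
          \<le> - (6 * a\<^sup>2 * real d ^ 4)" using alam by linarith
    qed simp
    then show ?case by (simp add: s case_prod_unfold)
  next
    case (11 s)
    obtain U \<delta> Q where s: "s = (U, \<delta>, Q)" by (cases s)
    have I: "regular_inv n d (U, \<delta>, Q)" "Q \<noteq> {}" using 11 s by auto
    show ?case unfolding s by (rule expect_regular_kernel_bad[OF I d p lam(1,3)])
  next
    case (12 s)
    obtain U \<delta> Q where s: "s = (U, \<delta>, Q)" by (cases s)
    have T: "real t \<le> real (n - card U)" "real (seen d U \<delta>) \<le> real (n - card U) / 2"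
      using 12 by (simp_all add: s of_nat_mono)
    have "0 \<le> (1 / (32 * real d ^ 8)) * (real (n - card U) - real t / 2 - seen d U \<delta>)"
      using T by (intro mult_nonneg_nonneg) auto
    then show ?case by (simp add: s regular_bad_def)
  next
    case 15
    have "16 * a * real d ^ 2 \<le> 16 * (1 / 64)" using ad by linarith
    then show ?case by simp
  next
    case 16
    define x where "x = a\<^sup>2 * real d ^ 4"
    have xx: "x = (a * real d ^ 2)\<^sup>2" by (simp add: x_def power_mult_distrib flip: power_mult)
    have x0: "0 \<le> x" by (simp add: x_def)
    have "x \<le> (1 / 64)\<^sup>2" unfolding xx using ad a0 by (intro power_mono) auto
    then have x1: "2 * x \<le> 1" by (simp add: power2_eq_square)
    have "exp (2 * x) \<le> 1 + 2 * x + (2 * x)\<^sup>2" using x1 by (rule exp_le_one_plus_square)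
    also have "(2 * x)\<^sup>2 \<le> 1 * (2 * x)" unfolding power2_eq_square using x1 x0 by (intro mult_right_mono) auto
    \<comment> \<open>The variance gain \<open>64 x\<close> of \<open>b1 = 16 a d^2\<close> covers
      \<open>4 x\<close> for \<open>exp d\<close> and at most \<open>32 x\<close> for the
      growth.\<close>
    also have "1 + 2 * x + 1 * (2 * x) \<le> 1 + (16 * a * real d ^ 2)\<^sup>2 / 4 - 2 * lam * (16 * a * real d ^ 2)"
    proof -
      have "(16 * a * real d ^ 2)\<^sup>2 / 4 = 64 * x"
        by (simp add: xx power_mult_distrib)
      moreover have "2 * lam * (16 * a * real d ^ 2) \<le> 2 * a * (16 * a * real d ^ 2)"
        using lam a0 by (intro mult_right_mono) auto
      moreover have "2 * a * (16 * a * real d ^ 2) = 32 * (a\<^sup>2 * real d ^ 2)" by (simp add: power2_eq_square)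
      moreover have "a\<^sup>2 * real d ^ 2 \<le> x" unfolding x_def
        using power_increasing[of 2 4 "real d"] dr by (intro mult_left_mono) auto
      ultimately show ?thesis using x0 by linarith
    qed
    finally show ?case by (simp add: x_def mult.assoc)
  qed (use a0 b in \<open>auto simp: case_prod_unfold\<close>)
qed

text \<open>The root still has full degree and violates \<open>regular_inv\<close>, so the first
  step is made separately, whence \<open>Suc (2 * t)\<close>. It leaves at most \<open>d\<close>
  active vertices of total weight at most \<open>d^2\<close>. The rate of the first term is
  \<open>g - d = 4 a^2 d^4\<close>, and the last term is the value of \<open>regular_bad\<close>
  with one vertex processed.\<close>

lemma regular_volume_bound:
  fixes n d t :: nat and lam p b :: real
  defines "y \<equiv> real t / real n"
  assumes d: "3 \<le> d" and p: "0 \<le> p" "p \<le> 1" "p * (real d - 1) \<le> 1 + lam"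
    and lam: "0 \<le> lam" "lam \<le> y / (64 * real d ^ 6)" "lam \<le> 1 / (4 * real d ^ 3)"
    and y: "y \<le> 1" and t: "16 * d\<^sup>2 \<le> t"
    and b: "32 * lam \<le> b" "0 < b" "b \<le> 1/2" "1 \<le> real t * b\<^sup>2"
    and V: "finite V" "card V = n" "v \<in> (V :: 'a::linorder set)" "degree_graphs V (\<lambda>_. d) \<noteq> {}"
  shows "regular_alive p (Suc (2 * t)) (V, \<lambda>_. d, {v}) \<le>
    exp (- (y\<^sup>2 / (1024 * real d ^ 8)) * t) * (real d * (3 * y + 9 * b)) + exp (1 - real t / (64 * real d ^ 8))"
proof -
  define a where "a = y / (64 * real d ^ 6)"
  interpret exploration "regular_kernel p" "regular_alive p :: nat \<Rightarrow> 'a set \<times> _ \<Rightarrow> real" "regular_inv n d"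
    "\<lambda>(U, \<delta>, Q). real (n - card U) / 2 \<le> real (seen d U \<delta>)"
    "\<lambda>(U, \<delta>, Q). card Q" "\<lambda>(U, \<delta>, Q). n - card U" "\<lambda>(U, \<delta>, Q). real (weight \<delta> Q)" "regular_bad n d t"
    a "2 * a\<^sup>2 * real d ^ 4" "6 * a\<^sup>2 * real d ^ 4" lam b "16 * a * real d ^ 2" t
    unfolding a_def y_def by (rule regular_exploration) (use assms in auto)
  have dr: "3 \<le> real d" using d by simp
  have d1: "1 \<le> real d ^ k" for k using dr by (simp add: one_le_power)
  have y0: "0 \<le> y" by (simp add: y_def)
  have ad: "a * real d ^ 2 = y / (64 * real d ^ 4)" using dr by (simp add: a_def field_simps eval_nat_numeral)
  have ady: "a * real d ^ 2 \<le> y / 64"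
    unfolding ad using d1[of 4] y0 dr by (intro divide_left_mono) auto
  let ?e = "exp (- (y\<^sup>2 / (1024 * real d ^ 8)) * t)"
  have eq: "6 * a\<^sup>2 * real d ^ 4 - 2 * a\<^sup>2 * real d ^ 4 = y\<^sup>2 / (1024 * real d ^ 8)"
  proof -
    have "6 * a\<^sup>2 * real d ^ 4 - 2 * a\<^sup>2 * real d ^ 4 = 4 * (a * real d ^ 2)\<^sup>2"
      by (simp add: power_mult_distrib flip: power_mult)
    also have "\<dots> = y\<^sup>2 / (1024 * real d ^ 8)" unfolding ad by (simp add: power_divide power_mult_distrib flip: power_mult)
    finally show ?thesis .
  qed
  have fin: "finite (set_pmf (regular_kernel p (V, \<lambda>_. d, {v})))"
    by (simp add: regular_kernel_def exposure_facts(1)[OF V(1,4)])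
  have "regular_alive p (Suc (2 * t)) (V, \<lambda>_. d, {v}) =
      expect (regular_kernel p (V, \<lambda>_. d, {v})) (regular_alive p (2 * t))"
    using V by (intro regular_alive_Suc) auto
  also have "\<dots> \<le> expect (regular_kernel p (V, \<lambda>_. d, {v}))
     (\<lambda>_. ?e * (real d * (3 * y + 9 * b)) + exp (1 - real t / (64 * real d ^ 8)))"
  proof (rule expect_mono[OF fin])
    fix s' assume s': "s' \<in> set_pmf (regular_kernel p (V, \<lambda>_. d, {v}))"
    obtain U \<delta> Q where s: "s' = (U, \<delta>, Q)" by (cases s')
    have st: "regular_inv n d (U, \<delta>, Q)" "card U = n - 1" "0 < n" "card Q \<le> d"
      using regular_kernel_step[of V n "\<lambda>_. d" "{v}" d s' p] V s' d by (auto simp: s)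
    have "weight \<delta> Q \<le> (\<Sum>u\<in>Q. d)" unfolding weight_def
      using st(1) by (intro sum_mono) (auto simp: regular_inv_def Suc_le_eq)
    also have "\<dots> \<le> d * d" using st(4) by simp
    finally have w: "real (weight \<delta> Q) \<le> real d ^ 2"
      by (metis of_nat_le_iff of_nat_mult power2_eq_square)
    have a0: "0 \<le> a" using y0 by (simp add: a_def)
    have aw: "a * real (weight \<delta> Q) \<le> y / 64" using mult_left_mono[OF w a0] ady by linarith
    have "exp (a * real (weight \<delta> Q)) \<le> exp (y / 64)" using aw by simp
    also have "\<dots> \<le> 1 + y / 64 + (y / 64)\<^sup>2" using y by (intro exp_le_one_plus_square) auto
    also have "(y / 64)\<^sup>2 \<le> 1 * (y / 64)" unfolding power2_eq_square using y y0 by (intro mult_right_mono) auto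
    finally have e: "exp (a * real (weight \<delta> Q)) - 1 \<le> y" using y0 by linarith
    have "(16 * a * real d ^ 2 + 9 * b) * card Q \<le> (y + 9 * b) * real d"
      using ady st(4) y0 a0 b by (intro mult_mono) auto
    moreover have "1 * y \<le> real d * y" using dr y0 by (intro mult_right_mono) auto
    ultimately have 1: "exp (a * real (weight \<delta> Q)) - 1 + (16 * a * real d ^ 2 + 9 * b) * card Q \<le> real d * (3 * y + 9 * b)"
      using e y0 mult_nonneg_nonneg[of "real d" y] by (simp add: algebra_simps)
    have 2: "regular_bad n d t (U, \<delta>, Q) \<le> exp (1 - real t / (64 * real d ^ 8))"
    proof -
      have "1 / (16 * real d ^ 6) * weight \<delta> Q \<le> 1 / (16 * real d ^ 6) * real d ^ 2"
        using w by (intro mult_left_mono) auto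
      also have "\<dots> = 1 / (16 * real d ^ 4)" using dr by (simp add: field_simps eval_nat_numeral)
      also have "\<dots> \<le> 1 / (16 * 1)" using d1[of 4] dr by (intro divide_left_mono) auto
      finally have 3: "1 / (16 * real d ^ 6) * weight \<delta> Q \<le> 1 / 2" by simp
      have "n - card U = 1" using st by simp
      then have "(1 / (32 * real d ^ 8)) * (real (n - card U) - real t / 2 - seen d U \<delta>)
          \<le> (1 / (32 * real d ^ 8)) * (1 - real t / 2)"
        by (intro mult_left_mono) auto
      also have "\<dots> = 1 / (32 * real d ^ 8) - real t / (64 * real d ^ 8)" by (simp add: right_diff_distrib)
      also have "1 / (32 * real d ^ 8) \<le> 1 / (32 * 1)" using d1[of 8] dr by (intro divide_left_mono) auto
      finally have "(1 / (32 * real d ^ 8)) * (real (n - card U) - real t / 2 - seen d U \<delta>) \<le> 1 / 2 - real t / (64 * real d ^ 8)"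
        by simp
      with 3 show ?thesis unfolding regular_bad_def prod.case by (subst exp_le_cancel_iff) linarith
    qed
    have "regular_alive p (2 * t) (U, \<delta>, Q) \<le> ?e * (exp (a * real (weight \<delta> Q)) - 1 + (16 * a * real d ^ 2 + 9 * b) * card Q)
       + regular_bad n d t (U, \<delta>, Q)"
      using survival_bound[OF st(1)] unfolding eq by simp
    also have "\<dots> \<le> ?e * (real d * (3 * y + 9 * b)) + exp (1 - real t / (64 * real d ^ 8))"
      using 1 2 by (intro add_mono mult_left_mono) auto
    finally show "regular_alive p (2 * t) s' \<le> \<dots>" by (simp add: s)
  qed
  finally show ?thesis by simp
qed

subsection \<open>The critical window\<close>

lemma prob_union_le:
  "measure_pmf.prob M {H. P H} \<le> measure_pmf.prob M {H. Q H} + measure_pmf.prob M {H. R H}"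
  if "\<And>H. H \<in> set_pmf M \<Longrightarrow> P H \<Longrightarrow> Q H \<or> R H"
proof -
  have "measure_pmf.prob M {H. P H} = measure_pmf.prob M ({H. P H} \<inter> set_pmf M)"
    by (simp add: measure_Int_set_pmf)
  also have "\<dots> \<le> measure_pmf.prob M ({H. Q H} \<union> {H. R H})"
    using that by (intro measure_pmf.finite_measure_mono) auto
  also have "\<dots> \<le> measure_pmf.prob M {H. Q H} + measure_pmf.prob M {H. R H}"
    by (rule measure_Un_le) auto
  finally show ?thesis .
qed

lemma set_percolation_all_edges:
  assumes "finite V" "E \<subseteq> all_edges V" "H \<in> set_pmf (percolation p E)"
  shows "H \<subseteq> all_edges V"
  using assms set_percolation(1) finite_all_edges finite_subset by (metis PowD subset_trans subsetD)

lemma alive_of_component: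
  assumes "finite V" "H \<subseteq> all_edges V" "C \<in> graph_components V H" "x \<in> C" "k < card C"
  shows "alive k H {x}"
proof -
  have "finite H" "\<And>e. e \<in> H \<Longrightarrow> finite e"
    using assms finite_all_edges finite_subset finite_edge by metis+
  then show ?thesis
    using component_eq_reach(1)[OF assms(2,3,4)] assms(5) by (intro alive_of_card_reach) auto
qed

lemma prob_large_component_le:
  fixes M :: "'a::linorder set set pmf"
  assumes "finite V" "finite (set_pmf M)" "\<And>H. H \<in> set_pmf M \<Longrightarrow> H \<subseteq> all_edges V"
    and "0 < m" "real k \<le> m" "\<And>v. v \<in> V \<Longrightarrow> measure_pmf.prob M {H. alive k H {v}} \<le> q"
  shows "measure_pmf.prob M {H. \<exists>C\<in>graph_components V H. m < real (card C)} \<le> card V / m * q"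
proof -
  have "measure_pmf.prob M {H. \<exists>C\<in>graph_components V H. m < real (card C)} \<le>
     (1 / m) * (\<Sum>v\<in>V. measure_pmf.prob M {H. alive k H {v}})"
  proof (rule prob_component_le[OF assms(1,2,4)])
    fix H C assume H: "H \<in> set_pmf M" "C \<in> graph_components V H" "m < real (card C)"
    have "k < card C" using H assms(5) by linarith
    then show "C \<subseteq> V \<and> m \<le> real (card C) \<and> (\<forall>x\<in>C. alive k H {x})"
      using alive_of_component[OF assms(1) assms(3)[OF H(1)] H(2)]
        component_eq_reach(2)[OF assms(3)[OF H(1)] H(2)] H(3) by auto
  qed
  also have "\<dots> \<le> (1 / m) * (\<Sum>v\<in>V. q)" using assms by (intro mult_left_mono sum_mono) auto
  finally show ?thesis by simp
qed

text \<open>The window in the scaling \<open>n = x\<^sup>3\<close>, \<open>A = s\<^sup>2\<close>: the diameter threshold is \<open>s\<^sup>2 x\<close> and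
  components are split at volume \<open>s x\<^sup>2\<close>.\<close>

locale window =
  fixes n :: nat and x s L :: real
  assumes x3: "x ^ 3 = real n" and x1: "1 \<le> x" and sx: "s < x" and s: "6144 \<le> s" "512 * (L + 1) \<le> s"
    and L: "0 \<le> L"
begin

text \<open>Both phases of the exploration together take \<open>2 t\<close> steps, about half of the
  volume threshold, which leaves room for the extra first step of the regular case.\<close>

definition t :: nat where "t = nat \<lfloor>s * x\<^sup>2 / 4\<rfloor>"

definition y :: real where "y = real t / real n"

text \<open>The multiple 32 meets \<open>32 * lam \<le> b\<close> for \<open>lam = L / x\<close>.
  Adding 1 to \<open>L\<close> keeps \<open>b\<close> of order \<open>1 / x\<close> even for
  \<open>L = 0\<close>, as \<open>t * b^2 \<ge> 1\<close> requires.\<close>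

definition b :: real where "b = 32 * (L + 1) / x"

lemma x_pos: "0 < x" "6144 \<le> x" using x1 s sx by auto

lemma x_sq: "x \<le> x\<^sup>2" "1 \<le> x\<^sup>2"
proof -
  have "x * 1 \<le> x * x" using x1 by (intro mult_left_mono) auto
  then show "x \<le> x\<^sup>2" by (simp add: power2_eq_square)
  then show "1 \<le> x\<^sup>2" using x1 by linarith
qed

lemma t_bounds: "s * x\<^sup>2 / 8 \<le> real t" "real t \<le> s * x\<^sup>2 / 4"
proof -
  have "6144 * 1 \<le> s * x\<^sup>2" using s x_sq by (intro mult_mono) auto
  then show "s * x\<^sup>2 / 8 \<le> real t" "real t \<le> s * x\<^sup>2 / 4" unfolding t_def by linarith+
qed

lemma y_bounds: "s / (8 * x) \<le> y" "y \<le> s / (4 * x)" "y \<le> 1 / 4" "0 \<le> y"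
proof -
  have 1: "s / (8 * x) = s * x\<^sup>2 / 8 / x ^ 3" "s / (4 * x) = s * x\<^sup>2 / 4 / x ^ 3"
    using x_pos by (simp_all add: power2_eq_square power3_eq_cube)
  show 2: "s / (8 * x) \<le> y" "y \<le> s / (4 * x)" unfolding 1 y_def x3[symmetric]
    using t_bounds x_pos by (intro divide_right_mono; simp)+
  have "s / (4 * x) \<le> 1 / 4" using sx x_pos by (simp add: divide_simps)
  with 2(2) show "y \<le> 1 / 4" by linarith
  show "0 \<le> y" by (simp add: y_def)
qed

lemma b_bounds: "32 * (L / x) \<le> b" "0 < b" "b \<le> 1 / 2" "1 \<le> real t * b\<^sup>2" "3 * y + 9 * b \<le> 2 * s / x"
proof -
  show "32 * (L / x) \<le> b" "0 < b" using x_pos L by (auto simp: b_def divide_right_mono)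
  show "b \<le> 1 / 2" using x_pos s sx by (simp add: b_def divide_simps)
  have "1 \<le> s / 8 * (32 * (L + 1))\<^sup>2"
  proof -
    have "1 * 1 \<le> s / 8 * (32 * (L + 1))\<^sup>2" using s L by (intro mult_mono) (auto simp: one_le_power)
    then show ?thesis by simp
  qed
  also have "\<dots> = s * x\<^sup>2 / 8 * b\<^sup>2" using x_pos by (simp add: b_def power_divide)
  also have "\<dots> \<le> real t * b\<^sup>2" using t_bounds by (intro mult_right_mono) auto
  finally show "1 \<le> real t * b\<^sup>2" .
  have "9 * b \<le> s / x" unfolding b_def using s x_pos by (simp add: divide_right_mono)
  moreover have "3 * y \<le> s / x" using y_bounds(2) x_pos s by (simp add: divide_simps)
  ultimately show "3 * y + 9 * b \<le> 2 * s / x" by simp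
qed

text \<open>With \<open>y\<close> of order \<open>s / x\<close> and \<open>t\<close> of order
  \<open>s x^2\<close> the powers of \<open>x\<close> cancel: this is the exponent
  \<open>t^3 / n^2\<close>.\<close>

lemma y2t: "s ^ 3 / 512 \<le> y\<^sup>2 * real t"
proof -
  have "(s / (8 * x))\<^sup>2 * (s * x\<^sup>2 / 8) \<le> y\<^sup>2 * real t"
    using y_bounds t_bounds s x_pos by (intro mult_mono power_mono) auto
  moreover have "(s / (8 * x))\<^sup>2 * (s * x\<^sup>2 / 8) = s ^ 3 / 512"
    using x_pos by (simp add: power2_eq_square power3_eq_cube)
  ultimately show ?thesis by linarith
qed

lemma prob_thin_component_le:
  assumes "2 \<le> D" "0 \<le> p" "p \<le> 1" "p * real D \<le> 1 + L / x"
    and V: "finite V" "card V = n" "E \<subseteq> all_edges V" "\<And>v. vertex_degree E v \<le> D + 1"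
  shows "measure_pmf.prob (percolation p E) {H. \<exists>C\<in>graph_components V H.
      s\<^sup>2 * x < real (graph_diam H C) \<and> real (card C) \<le> s * x\<^sup>2} \<le> 2 * exp (- (s ^ 3) / 2048)"
proof -
  have s2: "s \<le> s\<^sup>2" using s by (simp add: power2_eq_square)
  have q: "(s\<^sup>2 * x)\<^sup>2 / (s * x\<^sup>2) = s ^ 3"
    using s x_pos by (simp add: power2_eq_square power3_eq_cube)
  have "measure_pmf.prob (percolation p E) {H. \<exists>C\<in>graph_components V H.
      s\<^sup>2 * x < real (graph_diam H C) \<and> real (card C) \<le> s * x\<^sup>2} \<le> 2 * exp (- ((s\<^sup>2 * x)\<^sup>2 / (s * x\<^sup>2)) / 2048)"
  proof (rule prob_tall_thin_component[OF assms(1-4) _ V(1,3,4)])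
    show "0 \<le> L / x" using L x_pos by simp
    have "6144 * 1 \<le> s\<^sup>2 * x" using s s2 x1 by (intro mult_mono) auto
    then show "24 \<le> s\<^sup>2 * x" by simp
    show "0 < s * x\<^sup>2" using s x_pos by simp
    show "6144 ^ 3 \<le> (s\<^sup>2 * x)\<^sup>2 / (s * x\<^sup>2)" unfolding q using s by (intro power_mono) auto
    have "s\<^sup>2 * x / (16 * (s * x\<^sup>2)) = s / 16 / x" using s x_pos by (simp add: power2_eq_square)
    moreover have "32 * (L / x) \<le> s / 16 / x" using s x_pos by (simp add: divide_simps)
    ultimately show "32 * (L / x) \<le> s\<^sup>2 * x / (16 * (s * x\<^sup>2))" by simp
    have "1 * x ^ 3 \<le> (s\<^sup>2) ^ 3 * x ^ 3" using s s2 x1 by (intro mult_right_mono one_le_power) auto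
    then show "real (card V) \<le> (s\<^sup>2 * x) ^ 3" by (simp add: V(2) x3 power_mult_distrib)
  qed
  then show ?thesis by (simp add: q)
qed

lemma complete_window:
  assumes "0 \<le> p" "p \<le> 1" "p * real n \<le> 1 + L / x" and V: "finite V" "card V = n"
  shows "measure_pmf.prob (percolation p (all_edges (V :: 'a::linorder set)))
     {H. \<exists>C\<in>graph_components V H. s\<^sup>2 * x < real (graph_diam H C)} \<le> exp (- (s ^ 3) / 65536)"
proof -
  have "6144 ^ 3 \<le> x ^ 3" using x_pos by (intro power_mono) auto
  then have n2: "2 \<le> n" unfolding x3 by simp
  let ?M = "percolation p (all_edges V)"
  note finE = finite_all_edges[OF V(1)]
  have deg: "vertex_degree (all_edges V) v \<le> n + 1" for v
  proof (cases "v \<in> V")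
    case True
    have "{e \<in> all_edges V. v \<in> e} = touch (all_edges V) {v}" by (auto simp: touch_def)
    then show ?thesis using card_touch_all_edges[OF V(1) True] V(2) by (simp add: vertex_degree_def)
  next
    case False
    then have "{e \<in> all_edges V. v \<in> e} = {}" by (auto simp: all_edges_def)
    then show ?thesis by (simp only: vertex_degree_def) simp
  qed
  let ?q = "exp (- (y\<^sup>2 / 64) * t) * (3 * y + 9 * b)"
  have "measure_pmf.prob ?M {H. \<exists>C\<in>graph_components V H. s * x\<^sup>2 < real (card C)} \<le> card V / (s * x\<^sup>2) * ?q"
  proof (rule prob_large_component_le[OF V(1) set_percolation(2)[OF finE], where k = "2 * t"])
    show "H \<subseteq> all_edges V" if "H \<in> set_pmf ?M" for H using set_percolation(1)[OF finE, of p] that by blast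
    show "0 < s * x\<^sup>2" using s x_pos by simp
    show "real (2 * t) \<le> s * x\<^sup>2" using t_bounds \<open>0 < s * x\<^sup>2\<close> by simp
    fix v assume v: "v \<in> V"
    show "measure_pmf.prob ?M {H. alive (2 * t) H {v}} \<le> ?q"
      unfolding y_def
    proof (rule complete_volume_bound[OF n2 assms(1-3), where b = b])
      have "L / x \<le> s / (8 * x) / 8" using s L x_pos by (simp add: divide_simps)
      then show "L / x \<le> real t / real n / 8" using y_bounds(1) by (simp add: y_def)
    qed (use y_bounds b_bounds L x_pos V v in \<open>auto simp: y_def\<close>)
  qed
  also have "\<dots> = x / s * ?q" using x_pos s by (simp add: V(2) x3[symmetric] power2_eq_square power3_eq_cube)
  \<comment> \<open>The factor \<open>x / s\<close> from averaging over the vertices cancels against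
    the prefactor \<open>2 s / x\<close>.\<close>
  also have "\<dots> \<le> x / s * (exp (- (s ^ 3) / 32768) * (2 * s / x))"
  proof (intro mult_left_mono mult_mono)
    show "exp (- (y\<^sup>2 / 64) * real t) \<le> exp (- (s ^ 3) / 32768)" using y2t by simp
  qed (use b_bounds y_bounds s x_pos in auto)
  also have "\<dots> = 2 * exp (- (s ^ 3) / 32768)" using s x_pos by simp
  finally have 1: "measure_pmf.prob ?M {H. \<exists>C\<in>graph_components V H. s * x\<^sup>2 < real (card C)} \<le> 2 * exp (- (s ^ 3) / 32768)" .
  have 2: "measure_pmf.prob ?M {H. \<exists>C\<in>graph_components V H. s\<^sup>2 * x < real (graph_diam H C)} \<le>
     measure_pmf.prob ?M {H. \<exists>C\<in>graph_components V H. s\<^sup>2 * x < real (graph_diam H C) \<and> real (card C) \<le> s * x\<^sup>2}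
     + measure_pmf.prob ?M {H. \<exists>C\<in>graph_components V H. s * x\<^sup>2 < real (card C)}"
    by (rule prob_union_le) (meson not_le)
  have 3: "measure_pmf.prob ?M {H. \<exists>C\<in>graph_components V H. s\<^sup>2 * x < real (graph_diam H C) \<and> real (card C) \<le> s * x\<^sup>2}
     \<le> 2 * exp (- (s ^ 3) / 2048)"
    using assms n2 deg by (intro prob_thin_component_le[of n]) auto
  define u where "u = s ^ 3 / 65536"
  have u: "4 \<le> u" using power_mono[OF s(1), of 3] by (simp add: u_def)
  have "exp (- (s ^ 3) / 2048) \<le> exp (- (2 * u))" using u s by (simp add: u_def)
  moreover have "exp (- (s ^ 3) / 32768) = exp (- (2 * u))" by (simp add: u_def)
  ultimately have "measure_pmf.prob ?M {H. \<exists>C\<in>graph_components V H. s\<^sup>2 * x < real (graph_diam H C)} \<le> 4 * exp (- (2 * u))"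
    using 1 2 3 by linarith
  \<comment> \<open>Half of the exponent is given up for the constant 4, so that the final bound has
    no prefactor.\<close>
  also have "\<dots> \<le> exp u * exp (- (2 * u))"
  proof (rule mult_right_mono)
    show "4 \<le> exp u" using u exp_ge_add_one_self[of u] by linarith
  qed simp
  also have "\<dots> = exp (- (s ^ 3) / 65536)" by (simp add: mult_exp_exp u_def)
  finally show ?thesis .
qed

lemma regular_window:
  fixes d :: nat
  assumes d: "3 \<le> d" and p: "0 \<le> p" "p \<le> 1" "p * (real d - 1) \<le> 1 + L / x"
    and sd: "1024 * real d ^ 6 * (L + 1) \<le> s" "2 ^ 20 * real d ^ 8 * (2 * real d + 5) \<le> s"
    and V: "finite V" "card V = n" "regular_graphs d (V :: 'a::linorder set) \<noteq> {}"
  shows "measure_pmf.prob (bind_pmf (pmf_of_set (regular_graphs d V)) (percolation p))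
     {H. \<exists>C\<in>graph_components V H. s\<^sup>2 * x < real (graph_diam H C)} \<le> exp (- (s ^ 3) / (2 ^ 20 * real d ^ 8))"
proof -
  have dr: "3 \<le> real d" using d by simp
  have d1: "1 \<le> real d ^ k" for k using dr by (simp add: one_le_power)
  have GG: "regular_graphs d V = degree_graphs V (\<lambda>_. d)" by (simp add: regular_graphs_def degree_graphs_def)
  let ?G = "degree_graphs V (\<lambda>_. d)"
  let ?M = "bind_pmf (pmf_of_set ?G) (percolation p)"
  have G: "finite ?G" "?G \<noteq> {}" using finite_degree_graphs[OF V(1)] V(3) GG by auto
  have GE: "E \<subseteq> all_edges V" "finite E" "vertex_degree E v \<le> d" if "E \<in> ?G" for E v
  proof -
    show E: "E \<subseteq> all_edges V" using that by (simp add: degree_graphs_def)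
    then show "finite E" using finite_all_edges[OF V(1)] finite_subset by metis
    show "vertex_degree E v \<le> d"
    proof (cases "v \<in> V")
      case False
      then have "{e \<in> E. v \<in> e} = {}" using E by (auto simp: all_edges_def)
      then show ?thesis by (simp only: vertex_degree_def) simp
    qed (use that in \<open>simp add: degree_graphs_def\<close>)
  qed
  have setM: "finite (set_pmf ?M)" "\<And>H. H \<in> set_pmf ?M \<Longrightarrow> H \<subseteq> all_edges V"
  proof -
    show "finite (set_pmf ?M)" using G set_percolation(2)[OF GE(2)] by auto
    fix H assume "H \<in> set_pmf ?M"
    then obtain E where "E \<in> ?G" "H \<in> set_pmf (percolation p E)" using G by auto
    then show "H \<subseteq> all_edges V" using set_percolation_all_edges[OF V(1) GE(1)] by blast
  qed
  have probM: "measure_pmf.prob ?M {H. P H} = expect (pmf_of_set ?G) (\<lambda>E. measure_pmf.prob (percolation p E) {H. P H})" for P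
    unfolding prob_eq_expect_of_bool using G set_percolation(2)[OF GE(2)] by (intro expect_bind) auto
  let ?q1 = "exp (- (y\<^sup>2 / (1024 * real d ^ 8)) * t) * (real d * (3 * y + 9 * b))"
  let ?q2 = "exp (1 - real t / (64 * real d ^ 8))"
  have sx2: "0 < s * x\<^sup>2" using s x_pos by simp
  have tlarge: "16 * real d ^ 2 \<le> real t"
  proof -
    have "1 * (128 * real d ^ 2) \<le> 2 ^ 20 * real d ^ 8 * (2 * real d + 5)"
    proof -
      have "real d ^ 2 \<le> real d ^ 8" using dr by (intro power_increasing) auto
      then have "128 * real d ^ 2 * 1 \<le> (2 ^ 20 * real d ^ 8) * (2 * real d + 5)" by (intro mult_mono) auto
      then show ?thesis by simp
    qed
    then have "128 * real d ^ 2 \<le> s" using sd by simp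
    moreover have "s * 1 \<le> s * x\<^sup>2" using s x_sq by (intro mult_left_mono) auto
    ultimately show ?thesis using t_bounds by linarith
  qed
  have lam: "L / x \<le> y / (64 * real d ^ 6)" "L / x \<le> 1 / (4 * real d ^ 3)"
  proof -
    have Ls: "1024 * real d ^ 6 * L \<le> s" using sd(1) d1[of 6] L by (simp add: distrib_left)
    define z where "z = real d ^ 6 * L"
    have "0 \<le> z" "1024 * z \<le> s" using L Ls by (simp_all add: z_def mult.assoc)
    then have "L * (512 * real d ^ 6) \<le> s" by (simp add: z_def mult_ac)
    then have "L \<le> s / (512 * real d ^ 6)" using dr by (simp add: pos_le_divide_eq)
    then have "L / x \<le> s / (512 * real d ^ 6) / x" using x_pos by (intro divide_right_mono) auto
    also have "\<dots> = s / (8 * x) / (64 * real d ^ 6)" by (simp add: mult_ac)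
    also have "\<dots> \<le> y / (64 * real d ^ 6)" using y_bounds by (intro divide_right_mono) auto
    finally show "L / x \<le> y / (64 * real d ^ 6)" .
    have "4 * real d ^ 3 * L \<le> 1024 * real d ^ 6 * L"
      using power_increasing[of 3 6 "real d"] dr L by (intro mult_right_mono mult_mono) auto
    then have "4 * real d ^ 3 * L \<le> x" using Ls sx by linarith
    then show "L / x \<le> 1 / (4 * real d ^ 3)" using x_pos dr by (simp add: divide_simps mult_ac)
  qed
  have "measure_pmf.prob ?M {H. \<exists>C\<in>graph_components V H. s * x\<^sup>2 < real (card C)} \<le> card V / (s * x\<^sup>2) * (?q1 + ?q2)"
  proof (rule prob_large_component_le[OF V(1) setM sx2, where k = "Suc (2 * t)"])
    have "1 \<le> real t" using tlarge d1[of 2] by linarith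
    then show "real (Suc (2 * t)) \<le> s * x\<^sup>2" using t_bounds by simp
    fix v assume v: "v \<in> V"
    have "measure_pmf.prob ?M {H. alive (Suc (2 * t)) H {v}} = regular_alive p (Suc (2 * t)) (V, \<lambda>_. d, {v})"
      by (simp only: probM regular_alive_def prod.case)
    also have "\<dots> \<le> ?q1 + ?q2" unfolding y_def
    proof (rule regular_volume_bound[OF d p, where b = b])
      show "16 * d\<^sup>2 \<le> t" using tlarge by (metis of_nat_le_iff of_nat_mult of_nat_numeral of_nat_power)
      show "real t / real n \<le> 1" using y_bounds(3) unfolding y_def by linarith
    qed (use y_bounds b_bounds L x_pos V v lam G in \<open>auto simp: y_def\<close>)
    finally show "measure_pmf.prob ?M {H. alive (Suc (2 * t)) H {v}} \<le> ?q1 + ?q2" .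
  qed auto
  also have "card V / (s * x\<^sup>2) = x / s" using x_pos s by (simp add: V(2) x3[symmetric] power2_eq_square power3_eq_cube)
  finally have 1: "measure_pmf.prob ?M {H. \<exists>C\<in>graph_components V H. s * x\<^sup>2 < real (card C)} \<le> x / s * ?q1 + x / s * ?q2"
    by (simp only: distrib_left)
  define u where "u = s ^ 3 / (2 ^ 20 * real d ^ 8)"
  have q1: "x / s * ?q1 \<le> 2 * real d * exp (- (2 * u))"
  proof -
    have "x / s * ?q1 \<le> x / s * (exp (- (2 * u)) * (real d * (2 * s / x)))"
    proof (intro mult_left_mono mult_mono)
      have "s ^ 3 / 512 / (1024 * real d ^ 8) \<le> y\<^sup>2 * real t / (1024 * real d ^ 8)"
        using y2t by (intro divide_right_mono) auto
      moreover have "s ^ 3 / 512 / (1024 * real d ^ 8) = 2 * u" by (simp add: u_def)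
      ultimately show "exp (- (y\<^sup>2 / (1024 * real d ^ 8)) * real t) \<le> exp (- (2 * u))" by simp
    qed (use b_bounds y_bounds s x_pos in auto)
    also have "\<dots> = 2 * real d * exp (- (2 * u))" using s x_pos by simp
    finally show ?thesis .
  qed
  \<comment> \<open>This term has no small prefactor, but its exponent is of order
    \<open>s x^2\<close>. Of its two halves, each at least \<open>w\<close>, one absorbs
    \<open>x / s \<le> exp x\<close>, the other yields \<open>2 u\<close> by
    \<open>s < x\<close>.\<close>
  have q2: "x / s * ?q2 \<le> 3 * exp (- (2 * u))"
  proof -
    define w where "w = s * x\<^sup>2 / (1024 * real d ^ 8)"
    have tw: "2 * w \<le> real t / (64 * real d ^ 8)"
    proof -
      have "2 * w = s * x\<^sup>2 / 8 / (64 * real d ^ 8)" by (simp add: w_def)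
      also have "\<dots> \<le> real t / (64 * real d ^ 8)" using t_bounds by (intro divide_right_mono) auto
      finally show ?thesis .
    qed
    have wx: "x \<le> w"
    proof -
      have "1024 * real d ^ 8 \<le> 2 ^ 20 * real d ^ 8 * (2 * real d + 5)"
      proof -
        have "(1024 * real d ^ 8) * 1 \<le> (2 ^ 20 * real d ^ 8) * (2 * real d + 5)" by (intro mult_mono) auto
        then show ?thesis by simp
      qed
      then have "1024 * real d ^ 8 \<le> s" using sd by linarith
      then have "1024 * real d ^ 8 * x \<le> s * x\<^sup>2" using x_sq s x_pos by (intro mult_mono) auto
      then show ?thesis using dr by (simp add: w_def pos_le_divide_eq mult.commute)
    qed
    have w2: "2 * u \<le> w"
    proof -
      have "s * s ^ 2 \<le> s * x\<^sup>2" using s sx by (intro mult_left_mono power_mono) auto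
      then have "s ^ 3 / (1024 * real d ^ 8) \<le> w" unfolding w_def by (intro divide_right_mono) (auto simp: power3_eq_cube power2_eq_square)
      moreover have "2 * u \<le> s ^ 3 / (1024 * real d ^ 8)"
        using s dr by (simp add: u_def divide_simps)
      ultimately show ?thesis by linarith
    qed
    have "x / s \<le> x / 1" using s x_pos by (intro divide_left_mono) auto
    also have "x \<le> exp x" using exp_ge_add_one_self[of x] by linarith
    finally have "x / s \<le> exp x" by simp
    then have "x / s * ?q2 \<le> exp x * exp (1 - 2 * w)" using tw by (intro mult_mono) auto
    also have "\<dots> = exp (1 + (x - 2 * w))" by (simp add: mult_exp_exp algebra_simps)
    also have "\<dots> \<le> exp (1 + (- (2 * u)))" using wx w2 by simp
    also have "\<dots> = exp 1 * exp (- (2 * u))" by (rule exp_add)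
    also have "\<dots> \<le> 3 * exp (- (2 * u))" using exp_le by (intro mult_right_mono) auto
    finally show ?thesis .
  qed
  have 2: "measure_pmf.prob ?M {H. \<exists>C\<in>graph_components V H. s\<^sup>2 * x < real (graph_diam H C)} \<le>
     measure_pmf.prob ?M {H. \<exists>C\<in>graph_components V H. s\<^sup>2 * x < real (graph_diam H C) \<and> real (card C) \<le> s * x\<^sup>2}
     + measure_pmf.prob ?M {H. \<exists>C\<in>graph_components V H. s * x\<^sup>2 < real (card C)}"
    by (rule prob_union_le) (meson not_le)
  have 3: "measure_pmf.prob ?M {H. \<exists>C\<in>graph_components V H. s\<^sup>2 * x < real (graph_diam H C) \<and> real (card C) \<le> s * x\<^sup>2}
     \<le> 2 * exp (- (s ^ 3) / 2048)"
  proof -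
    have "expect (pmf_of_set ?G) (\<lambda>E. measure_pmf.prob (percolation p E) {H. \<exists>C\<in>graph_components V H.
         s\<^sup>2 * x < real (graph_diam H C) \<and> real (card C) \<le> s * x\<^sup>2}) \<le> expect (pmf_of_set ?G) (\<lambda>_. 2 * exp (- (s ^ 3) / 2048))"
    proof (rule expect_mono)
      fix E assume "E \<in> set_pmf (pmf_of_set ?G)"
      then have E: "E \<in> ?G" using G by simp
      show "measure_pmf.prob (percolation p E) {H. \<exists>C\<in>graph_components V H.
         s\<^sup>2 * x < real (graph_diam H C) \<and> real (card C) \<le> s * x\<^sup>2} \<le> 2 * exp (- (s ^ 3) / 2048)"
        using GE[OF E] p d V by (intro prob_thin_component_le[of "d - 1"]) (auto simp: of_nat_diff)
    qed (use G in simp)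
    then show ?thesis by (simp only: probM expect_const)
  qed
  have "exp (- (s ^ 3) / 2048) \<le> exp (- (2 * u))"
  proof -
    have "2 * u \<le> s ^ 3 / 2048"
    proof -
      have "2 * 2048 * 1 \<le> 2 ^ 20 * real d ^ 8" using d1[of 8] by (intro mult_mono) auto
      then have "s ^ 3 * (2 * 2048) \<le> s ^ 3 * (2 ^ 20 * real d ^ 8)" using s by (intro mult_left_mono) auto
      then show ?thesis using dr by (simp add: u_def divide_simps)
    qed
    then show ?thesis by simp
  qed
  then have "measure_pmf.prob ?M {H. \<exists>C\<in>graph_components V H. s\<^sup>2 * x < real (graph_diam H C)}
      \<le> 2 * exp (- (2 * u)) + (2 * real d * exp (- (2 * u)) + 3 * exp (- (2 * u)))"
    using 1 2 3 q1 q2 by linarith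
  also have "\<dots> = (2 * real d + 5) * exp (- (2 * u))" by (simp add: algebra_simps)
  also have "\<dots> \<le> exp u * exp (- (2 * u))"
  proof (rule mult_right_mono)
    have "s * 1 \<le> s * s\<^sup>2" using s by (intro mult_left_mono one_le_power) auto
    then have "2 ^ 20 * real d ^ 8 * (2 * real d + 5) \<le> s ^ 3" using sd(2) by (simp add: power3_eq_cube power2_eq_square)
    then have "2 * real d + 5 \<le> u" using dr by (simp add: u_def pos_le_divide_eq mult_ac)
    then show "2 * real d + 5 \<le> exp u" using exp_ge_add_one_self[of u] by linarith
  qed simp
  also have "\<dots> = exp (- (s ^ 3) / (2 ^ 20 * real d ^ 8))" by (simp add: mult_exp_exp u_def)
  finally show ?thesis by (simp add: GG)
qed

end

lemma no_long_component:
  assumes "finite V" "finite (set_pmf M)" "\<And>H. H \<in> set_pmf M \<Longrightarrow> H \<subseteq> all_edges V" "real (card V) \<le> r"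
  shows "measure_pmf.prob M {H. \<exists>C\<in>graph_components V H. r < real (graph_diam H C)} = 0"
proof -
  have "\<not> r < real (graph_diam H C)" if "H \<in> set_pmf M" "C \<in> graph_components V H" for H C
    using diam_less_card[OF assms(3)[OF that(1)] assms(1) that(2)] assms(4) by linarith
  then show ?thesis by (subst measure_pmf_zero_iff) blast
qed

text \<open>Replacing \<open>l\<close> by its absolute value only weakens the condition on
  \<open>p\<close> and makes the growth parameter nonnegative. For \<open>s \<ge> x\<close> the
  diameter threshold is at least the number of vertices.\<close>

lemma scaling:
  fixes n :: nat and A l :: real
  assumes "1 \<le> n" "0 \<le> S" "S\<^sup>2 \<le> A"
  defines "x \<equiv> real n powr (1/3)" and "s \<equiv> sqrt A"
  shows "x ^ 3 = real n" "1 \<le> x" "real n powr (-1/3) = 1 / x" "s\<^sup>2 = A" "S \<le> s" "A powr (3/2) = s ^ 3"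
    "1 + l * real n powr (-1/3) \<le> 1 + \<bar>l\<bar> / x" "\<not> s < x \<Longrightarrow> real n \<le> A * x"
proof -
  have n: "0 < real n" using assms by simp
  have A0: "0 \<le> A" using assms(3) zero_le_power2[of S] by linarith
  show x3: "x ^ 3 = real n" using n by (simp add: x_def powr_powr flip: powr_realpow)
  show x1: "1 \<le> x" using assms by (simp add: x_def ge_one_powr_ge_zero)
  show px: "real n powr (-1/3) = 1 / x" by (simp add: x_def powr_minus_divide flip: powr_minus)
  show sA: "s\<^sup>2 = A" using A0 by (simp add: s_def)
  show "S \<le> s" using assms by (simp add: s_def real_le_rsqrt)
  have s0: "0 \<le> s" using A0 by (simp add: s_def)
  show "A powr (3/2) = s ^ 3"
  proof (cases "A = 0")
    case False
    then have "0 < A" "0 < s" using A0 by (auto simp: s_def)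
    then have "s ^ 3 = s powr 3" by (simp add: powr_numeral)
    also have "\<dots> = A powr (3/2)" using \<open>0 < A\<close> by (simp add: s_def powr_half_sqrt[symmetric] powr_powr)
    finally show ?thesis by simp
  qed (simp add: s_def)
  have "l * (1 / x) \<le> \<bar>l\<bar> * (1 / x)" using x1 by (intro mult_right_mono) auto
  then show "1 + l * real n powr (-1/3) \<le> 1 + \<bar>l\<bar> / x" unfolding px by simp
  assume "\<not> s < x"
  then have "x\<^sup>2 * x \<le> s\<^sup>2 * x" using x1 by (intro mult_right_mono power_mono) auto
  also have "x\<^sup>2 * x = real n" unfolding x3[symmetric] by (simp add: power3_eq_cube power2_eq_square)
  finally show "real n \<le> A * x" unfolding sA .
qed

text \<open>A bound from some \<open>A0\<close> on is the correct form: for \<open>p = 1 / n\<close>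
  and \<open>A = n^(-1/3) / 2\<close> the event is that some edge is retained, which fails with
  exponentially small probability, whereas \<open>1 - exp (- c * A powr (3/2))\<close> is only of
  order \<open>n^(-1/2)\<close>. The rates obtained are free of \<open>l\<close>, which enters
  through \<open>A0\<close> alone.\<close>

theorem proposition1p4:
  fixes l :: real
  shows
    "(\<exists>c>0. \<exists>A0>0. \<forall>(n::nat) (p::real) (A::real).
        n \<ge> 1 \<longrightarrow> 0 < p \<longrightarrow> p < 1 \<longrightarrow> p \<le> (1 + l * real n powr (-1/3)) / real n \<longrightarrow> A \<ge> A0 \<longrightarrow>
        measure_pmf.prob (percolation_complete n p)
          {H. \<exists>C \<in> graph_components {..<n} H. real (graph_diam H C) > A * real n powr (1/3)}
        \<le> exp (- c * A powr (3/2))) \<and>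
     (\<forall>d::nat. d \<ge> 3 \<longrightarrow>
      (\<exists>c>0. \<exists>A0>0. \<forall>(n::nat) (p::real) (A::real).
        n \<ge> 1 \<longrightarrow> regular_graphs d {..<n} \<noteq> {} \<longrightarrow> 0 < p \<longrightarrow> p < 1 \<longrightarrow>
        p \<le> (1 + l * real n powr (-1/3)) / (real d - 1) \<longrightarrow> A \<ge> A0 \<longrightarrow>
        measure_pmf.prob (percolation_random_regular d n p)
          {H. \<exists>C \<in> graph_components {..<n} H. real (graph_diam H C) > A * real n powr (1/3)}
        \<le> exp (- c * A powr (3/2))))"
proof (intro conjI allI impI)
  \<comment> \<open>\<open>A0\<close> is \<open>S^2\<close>, so that \<open>s = sqrt A\<close> is at
    least \<open>S\<close> and satisfies all lower bounds of the window.\<close>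
  define S where "S = 6144 + 512 * (\<bar>l\<bar> + 1)"
  have S: "6144 \<le> S" "512 * (\<bar>l\<bar> + 1) \<le> S" by (auto simp: S_def)
  have main: "measure_pmf.prob (percolation_complete n p)
          {H. \<exists>C \<in> graph_components {..<n} H. real (graph_diam H C) > A * real n powr (1/3)}
        \<le> exp (- (1/65536) * A powr (3/2))"
    if n: "n \<ge> 1" and p: "0 < p" "p < 1" "p \<le> (1 + l * real n powr (-1/3)) / real n" and A: "S\<^sup>2 \<le> A"
    for n :: nat and p A :: real
  proof -
    define x where "x = real n powr (1/3)"
    define s where "s = sqrt A"
    have S0: "0 \<le> S" using S by simp
    note sc = scaling[OF n S0 A, folded x_def s_def]
    show ?thesis
    proof (cases "s < x")
      case True
      interpret window n x s "\<bar>l\<bar>" by unfold_locales (use sc True S in auto)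
      have "p * real n \<le> 1 + \<bar>l\<bar> / x" using p sc(7)[of l] n by (simp add: pos_le_divide_eq)
      then have "measure_pmf.prob (percolation p (all_edges {..<n}))
        {H. \<exists>C\<in>graph_components {..<n} H. s\<^sup>2 * x < real (graph_diam H C)} \<le> exp (- (s ^ 3) / 65536)"
        using p by (intro complete_window) auto
      then show ?thesis by (simp add: percolation_complete_def sc(4,6) x_def)
    next
      \<comment> \<open>Here \<open>A * x\<close> is at least \<open>n\<close>, and no component can
        have so large a diameter.\<close>
      case False
      then have "measure_pmf.prob (percolation_complete n p)
          {H. \<exists>C \<in> graph_components {..<n} H. A * x < real (graph_diam H C)} = 0"
        using sc(8) set_percolation finite_all_edges[of "{..<n}"]
        by (intro no_long_component) (auto simp: percolation_complete_def dest: set_percolation_all_edges[OF _ order_refl, rotated])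
      then show ?thesis by (simp add: x_def)
    qed
  qed
  show "\<exists>c>0. \<exists>A0>0. \<forall>(n::nat) (p::real) (A::real).
        n \<ge> 1 \<longrightarrow> 0 < p \<longrightarrow> p < 1 \<longrightarrow> p \<le> (1 + l * real n powr (-1/3)) / real n \<longrightarrow> A \<ge> A0 \<longrightarrow>
        measure_pmf.prob (percolation_complete n p)
          {H. \<exists>C \<in> graph_components {..<n} H. real (graph_diam H C) > A * real n powr (1/3)}
        \<le> exp (- c * A powr (3/2))"
  proof (rule exI[of _ "1/65536"], rule conjI, simp, rule exI[of _ "S\<^sup>2"], intro conjI allI impI)
    show "0 < S\<^sup>2" using S by simp
  qed (rule main)
next
  fix d :: nat assume d: "3 \<le> d"
  define S where "S = 6144 + 512 * (\<bar>l\<bar> + 1) + 1024 * real d ^ 6 * (\<bar>l\<bar> + 1) + 2 ^ 20 * real d ^ 8 * (2 * real d + 5)"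
  have "0 \<le> 512 * (\<bar>l\<bar> + 1)" "0 \<le> 1024 * real d ^ 6 * (\<bar>l\<bar> + 1)" "0 \<le> 2 ^ 20 * real d ^ 8 * (2 * real d + 5)"
    by auto
  then have S: "6144 \<le> S" "512 * (\<bar>l\<bar> + 1) \<le> S" "1024 * real d ^ 6 * (\<bar>l\<bar> + 1) \<le> S"
    "2 ^ 20 * real d ^ 8 * (2 * real d + 5) \<le> S" unfolding S_def by linarith+
  have main: "measure_pmf.prob (percolation_random_regular d n p)
          {H. \<exists>C \<in> graph_components {..<n} H. real (graph_diam H C) > A * real n powr (1/3)}
        \<le> exp (- (1 / (2 ^ 20 * real d ^ 8)) * A powr (3/2))"
    if n: "n \<ge> 1" and R: "regular_graphs d {..<n} \<noteq> {}" and p: "0 < p" "p < 1" "p \<le> (1 + l * real n powr (-1/3)) / (real d - 1)" and A: "S\<^sup>2 \<le> A"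
    for n :: nat and p A :: real
  proof -
    define x where "x = real n powr (1/3)"
    define s where "s = sqrt A"
    have S0: "0 \<le> S" using S by simp
    note sc = scaling[OF n S0 A, folded x_def s_def]
    show ?thesis
    proof (cases "s < x")
      case True
      interpret window n x s "\<bar>l\<bar>" by unfold_locales (use sc True S in auto)
      have "p * (real d - 1) \<le> 1 + \<bar>l\<bar> / x" using p sc(7)[of l] d by (simp add: pos_le_divide_eq)
      then have "measure_pmf.prob (bind_pmf (pmf_of_set (regular_graphs d {..<n})) (percolation p))
        {H. \<exists>C\<in>graph_components {..<n} H. s\<^sup>2 * x < real (graph_diam H C)} \<le> exp (- (s ^ 3) / (2 ^ 20 * real d ^ 8))"
        using p d S sc(5) R by (intro regular_window) auto
      then show ?thesis by (simp add: percolation_random_regular_def sc(4,6) x_def)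
    next
      case False
      have G: "finite (regular_graphs d {..<n})"
        by (rule finite_subset[of _ "Pow (all_edges {..<n})"]) (auto simp: regular_graphs_def finite_all_edges)
      have E: "E \<subseteq> all_edges {..<n}" "finite E" if "E \<in> regular_graphs d {..<n}" for E
        using that finite_all_edges[of "{..<n}"] finite_subset by (auto simp: regular_graphs_def)
      have "measure_pmf.prob (percolation_random_regular d n p)
          {H. \<exists>C \<in> graph_components {..<n} H. A * x < real (graph_diam H C)} = 0"
      proof (rule no_long_component)
        have "finite (set_pmf (percolation p E'))" if "E' \<in> regular_graphs d {..<n}" for E'
          by (rule set_percolation(2)[OF E(2)[OF that]])
        then show "finite (set_pmf (percolation_random_regular d n p))"
          using G R by (simp add: percolation_random_regular_def)
        fix H assume H: "H \<in> set_pmf (percolation_random_regular d n p)"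
        obtain E' where "E' \<in> regular_graphs d {..<n}" "H \<in> set_pmf (percolation p E')"
          using H G R by (auto simp: percolation_random_regular_def)
        then show "H \<subseteq> all_edges {..<n}"
          using set_percolation_all_edges[of "{..<n}" E'] E(1) by blast
      qed (use sc(8) False in auto)
      then show ?thesis by (simp add: x_def)
    qed
  qed
  show "\<exists>c>0. \<exists>A0>0. \<forall>(n::nat) (p::real) (A::real).
        n \<ge> 1 \<longrightarrow> regular_graphs d {..<n} \<noteq> {} \<longrightarrow> 0 < p \<longrightarrow> p < 1 \<longrightarrow>
        p \<le> (1 + l * real n powr (-1/3)) / (real d - 1) \<longrightarrow> A \<ge> A0 \<longrightarrow>
        measure_pmf.prob (percolation_random_regular d n p)
          {H. \<exists>C \<in> graph_components {..<n} H. real (graph_diam H C) > A * real n powr (1/3)}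
        \<le> exp (- c * A powr (3/2))"
  proof (rule exI[of _ "1 / (2 ^ 20 * real d ^ 8)"], rule conjI, use d in simp,
      rule exI[of _ "S\<^sup>2"], intro conjI allI impI)
    show "0 < S\<^sup>2" using S by simp
  qed (rule main)
qed

end
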